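(* Let $\theta:\mathbb{R}^m\to\,]-\infty,\infty]$ be CPWL with representation data $(a_i,\alpha_i)_{i=1}^l$, $(d_i,\beta_i)_{i=1}^p$, and let $\varphi_0:\mathbb{R}^n\times\mathbb{R}^d\to\mathbb{R}$ and $\Phi:\mathbb{R}^n\times\mathbb{R}^d\to\mathbb{R}^m$ be $\mathcal{C}^2$-smooth with respect to both variables. Let $(\bar w,\bar v)\in\mathbb{R}^d\times\mathbb{R}^n$ and let $\bar x$ be a feasible solution to $\mathcal{P}(\bar w,\bar v)$, where $$\mathcal{P}(w,v):\quad\text{minimize }\ \varphi_0(x,w)+\theta(\Phi(x,w))-\langle v,x\rangle\ \text{ over } x\in\mathbb{R}^n,$$ i.e., $\bar z:=\Phi(\bar x,\bar w)\in\operatorname{dom}\theta$, such that $$\bar v\in\nabla_x\varphi_0(\bar x,\bar w)+\nabla_x\Phi(\bar x,\bar w)^*\partial\theta(\bar z).$$ Assume the nondegeneracy condition ND: $\nabla_x\Phi(\bar x,\bar w)\mathbb{R}^n+\ker B=\mathbb{R}^m$, where $B$ is the reduction matrix of $\theta$ at $\bar z$ (as defined in the context), and let $\bar\lambda$ be the unique vector satisfying $\bar\lambda\in\partial\theta(\bar z)$ and $\bar v=\nabla_xL(\bar x,\bar w,\bar\lambda)$, where $L(x,w,\lambda):=\varphi_0(x,w)+\langle\lambda,\Phi(x,w)\rangle$. Then $\bar x$ is a fully stable local minimizer of $\mathcal{P}(\bar w,\bar v)$ if and only if the composite SSOSC holds at $(\bar x,\bar w,\bar v,\bar\lambda)$,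 i.e., $$\langle u,\nabla^2_{xx}L(\bar x,\bar w,\bar\lambda)u\rangle>0\quad\text{for all } 0\ne u\in\mathcal{S},$$ where $$\mathcal{S}:=\{u\in\mathbb{R}^n:\ \langle a_i-a_j,\nabla_x\Phi(\bar x,\bar w)u\rangle=0\ \text{for } i,j\in\Gamma(J_1),\ \ \langle d_t,\nabla_x\Phi(\bar x,\bar w)u\rangle=0\ \text{for } t\in\Gamma(J_2)\}$$ and the index sets $\Gamma(J_1),\Gamma(J_2)$ associated with $(\bar z,\bar\lambda)$ are defined in the context.
   Context: CPWL functions. $\theta:\mathbb{R}^m\to\,]-\infty,\infty]$ is convex piecewise linear (CPWL) if $\operatorname{dom}\theta=\{z:\theta(z)<\infty\}\neq\emptyset$ and $\operatorname{epi}\theta$ is a convex polyhedron; equivalently there are $a_i\in\mathbb{R}^m,\alpha_i\in\mathbb{R}$ ($i\in T_1=\{1,\dots,l\}$) and $d_i\in\mathbb{R}^m,\beta_i\in\mathbb{R}$ ($i\in T_2=\{1,\dots,p\}$) with $\operatorname{dom}\theta=\{z:\langle d_i,z\rangle\le\beta_i,\ i\in T_2\}$ and $\theta(z)=\max_{i\in T_1}\{\langle a_i,z\rangle-\alpha_i\}$ on $\operatorname{dom}\theta$, $\theta=\infty$ elsewhere. Such a representation is fixed. Put $K=K(\bar z)=\{i\in T_1:\langle a_j,\bar z\rangle-\alpha_j\le\langle a_i,\bar z\rangle-\alpha_i\ \forall j\in T_1\}$ and $I=I(\bar z)=\{i\in T_2:\langle d_i,\bar z\rangle=\beta_i\}$.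 One has $\partial\theta(\bar z)=\operatorname{conv}\{a_i:i\in K\}+\operatorname{cone}\{d_i:i\in I\}$ (subdifferential of convex analysis). Index sets. Write $\bar\lambda=\sum_{i\in K}\bar\eta_ia_i+\sum_{i\in I}\bar\mu_id_i$ with $\bar\eta_i\ge0$, $\sum_{i\in K}\bar\eta_i=1$, $\bar\mu_i\ge0$ (any fixed such representation), and set $J_1=\{i\in K:\bar\eta_i>0\}$, $J_2=\{i\in I:\bar\mu_i>0\}$. Let $\mathcal{G}$ be the set of $u\in\mathbb{R}^m$ with $\langle a_i-a_j,u\rangle=0$ for $i,j\in J_1$; $\langle a_i-a_j,u\rangle\le0$ for $(i,j)\in(K\setminus J_1)\times J_1$; $\langle d_i,u\rangle=0$ for $i\in J_2$; $\langle d_i,u\rangle\le0$ for $i\in I\setminus J_2$. Then $\Gamma(J_1)=\{i\in K:\langle a_i-a_j,u\rangle=0\ \forall j\in J_1,\ \forall u\in\mathcal{G}\}$ and $\Gamma(J_2)=\{t\in I:\langle d_t,u\rangle=0\ \forall u\in\mathcal{G}\}$. Reduction matrix. Let $S(\bar z)$ be the linear subspace parallel to $\operatorname{aff}\partial\theta(\bar z)$, $s=\dim S(\bar z)$. Let $A$ be an $m\times m$ matrix of a linear isometry (orthogonal matrix) of $\mathbb{R}^m=\mathbb{R}^s\times\mathbb{R}^{m-s}$ with $A^*(S(\bar z))=\mathbb{R}^s\times\{0\}$; $B$ is the $s\times m$ matrix obtained from $A^{-1}$ by deleting its last $m-s$ rows. Full stability. Let $\varphi(x,w)=\varphi_0(x,w)+\theta(\Phi(x,w))$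 and, for $\gamma>0$, $m_\gamma(w,v)=\inf_{\|x-\bar x\|\le\gamma}\{\varphi(x,w)-\langle v,x\rangle\}$, $M_\gamma(w,v)=\operatorname{argmin}_{\|x-\bar x\|\le\gamma}\{\varphi(x,w)-\langle v,x\rangle\}$ (with argmin $=\emptyset$ if the minimized expression is $\infty$). The point $\bar x$ is a fully stable local minimizer of $\mathcal{P}(\bar w,\bar v)$ if there are $\gamma>0$ and neighborhoods $W$ of $\bar w$, $V$ of $\bar v$ such that on $W\times V$ the mapping $M_\gamma$ is single-valued and Lipschitz continuous with $M_\gamma(\bar w,\bar v)=\{\bar x\}$, and $m_\gamma$ is Lipschitz continuous. *)

theory Defs
  imports "HOL-Analysis.Analysis"
begin

definition C2_smooth :: "('a::real_normed_vector \<Rightarrow> 'b::real_normed_vector) \<Rightarrow> bool" where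
  "C2_smooth f \<longleftrightarrow>
     (\<exists>(f' :: 'a \<Rightarrow> 'a \<Rightarrow>\<^sub>L 'b) (f'' :: 'a \<Rightarrow> 'a \<Rightarrow>\<^sub>L 'a \<Rightarrow>\<^sub>L 'b).
        (\<forall>x. (f has_derivative blinfun_apply (f' x)) (at x)) \<and>
        (\<forall>x. (f' has_derivative blinfun_apply (f'' x)) (at x)) \<and>
        continuous_on UNIV f'')"

definition gradient :: "('a::real_inner \<Rightarrow> real) \<Rightarrow> 'a \<Rightarrow> 'a" where
  "gradient f x = (THE D. GDERIV f x :> D)"

definition hessian :: "(real^'n \<Rightarrow> real) \<Rightarrow> real^'n \<Rightarrow> real^'n^'n" where
  "hessian f x = jacobian (gradient f) (at x)"

definition dom_of :: "('a \<Rightarrow> ereal) \<Rightarrow> 'a set" where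
  "dom_of f = {z. f z < \<infinity>}"

definition epi :: "('a \<Rightarrow> ereal) \<Rightarrow> ('a \<times> real) set" where
  "epi f = {(z, r). f z \<le> ereal r}"

definition subdifferential :: "('a::real_inner \<Rightarrow> ereal) \<Rightarrow> 'a \<Rightarrow> 'a set" where
  "subdifferential f z =
     (if \<bar>f z\<bar> = \<infinity> then {}
      else {v. \<forall>y. f z + ereal (v \<bullet> (y - z)) \<le> f y})"

definition CPWL :: "('a::euclidean_space \<Rightarrow> ereal) \<Rightarrow> bool" where
  "CPWL \<theta> \<longleftrightarrow> (\<forall>z. \<theta> z \<noteq> -\<infinity>) \<and> dom_of \<theta> \<noteq> {} \<and> polyhedron (epi \<theta>)"

text \<open>The index sets are \<open>T\<^sub>1 = {1..l}\<close>, which is nonempty, and \<open>T\<^sub>2 = {1..p}\<close>, which is empty for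
  \<open>p = 0\<close> (the case of a finite-valued \<open>\<theta>\<close>).\<close>

definition CPWL_representation ::
  "('a::euclidean_space \<Rightarrow> ereal) \<Rightarrow> nat \<Rightarrow> (nat \<Rightarrow> 'a) \<Rightarrow> (nat \<Rightarrow> real) \<Rightarrow>
     nat \<Rightarrow> (nat \<Rightarrow> 'a) \<Rightarrow> (nat \<Rightarrow> real) \<Rightarrow> bool" where
  "CPWL_representation \<theta> l a \<alpha> p d \<beta> \<longleftrightarrow>
     1 \<le> l \<and>
     dom_of \<theta> = {z. \<forall>i\<in>{1..p}. d i \<bullet> z \<le> \<beta> i} \<and>
     (\<forall>z\<in>dom_of \<theta>. \<theta> z = ereal (Max ((\<lambda>i. a i \<bullet> z - \<alpha> i) ` {1..l})))"

definition active_K :: "nat \<Rightarrow> (nat \<Rightarrow> 'a::euclidean_space) \<Rightarrow> (nat \<Rightarrow> real) \<Rightarrow> 'a \<Rightarrow> nat set" where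
  "active_K l a \<alpha> z = {i\<in>{1..l}. \<forall>j\<in>{1..l}. a j \<bullet> z - \<alpha> j \<le> a i \<bullet> z - \<alpha> i}"

definition active_I :: "nat \<Rightarrow> (nat \<Rightarrow> 'a::euclidean_space) \<Rightarrow> (nat \<Rightarrow> real) \<Rightarrow> 'a \<Rightarrow> nat set" where
  "active_I p d \<beta> z = {i\<in>{1..p}. d i \<bullet> z = \<beta> i}"

definition multiplier_representation ::
  "(nat \<Rightarrow> 'a::euclidean_space) \<Rightarrow> (nat \<Rightarrow> 'a) \<Rightarrow> nat set \<Rightarrow> nat set \<Rightarrow>
     'a \<Rightarrow> (nat \<Rightarrow> real) \<Rightarrow> (nat \<Rightarrow> real) \<Rightarrow> bool" where
  "multiplier_representation a d K I lam \<eta> \<mu> \<longleftrightarrow>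
     lam = (\<Sum>i\<in>K. \<eta> i *\<^sub>R a i) + (\<Sum>i\<in>I. \<mu> i *\<^sub>R d i) \<and>
     (\<forall>i\<in>K. 0 \<le> \<eta> i) \<and> (\<Sum>i\<in>K. \<eta> i) = 1 \<and> (\<forall>i\<in>I. 0 \<le> \<mu> i)"

definition positive_indices :: "nat set \<Rightarrow> (nat \<Rightarrow> real) \<Rightarrow> nat set" where
  "positive_indices K \<eta> = {i\<in>K. 0 < \<eta> i}"

definition cone_G ::
  "(nat \<Rightarrow> 'a::euclidean_space) \<Rightarrow> (nat \<Rightarrow> 'a) \<Rightarrow> nat set \<Rightarrow> nat set \<Rightarrow>
     nat set \<Rightarrow> nat set \<Rightarrow> 'a set" where
  "cone_G a d K I J1 J2 =
     {u. (\<forall>i\<in>J1. \<forall>j\<in>J1. (a i - a j) \<bullet> u = 0) \<and>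
         (\<forall>i\<in>K - J1. \<forall>j\<in>J1. (a i - a j) \<bullet> u \<le> 0) \<and>
         (\<forall>i\<in>J2. d i \<bullet> u = 0) \<and>
         (\<forall>i\<in>I - J2. d i \<bullet> u \<le> 0)}"

definition Gamma1 ::
  "(nat \<Rightarrow> 'a::euclidean_space) \<Rightarrow> nat set \<Rightarrow> nat set \<Rightarrow> 'a set \<Rightarrow> nat set" where
  "Gamma1 a K J1 G = {i\<in>K. \<forall>j\<in>J1. \<forall>u\<in>G. (a i - a j) \<bullet> u = 0}"

definition Gamma2 ::
  "(nat \<Rightarrow> 'a::euclidean_space) \<Rightarrow> nat set \<Rightarrow> 'a set \<Rightarrow> nat set" where
  "Gamma2 d I G = {t\<in>I. \<forall>u\<in>G. d t \<bullet> u = 0}"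

definition parallel_subspace :: "'a::euclidean_space set \<Rightarrow> 'a set" where
  "parallel_subspace C = (THE L. subspace L \<and> affine_parallel (affine hull C) L)"

text \<open>The splitting of $R^m$ into $R^s \times R^{m-s}$ uses the order of the coordinates, so
  \<open>'m\<close> is a linearly ordered finite type. As \<open>s\<close> depends on \<open>\<theta>\<close> and the point (and may be \<open>0\<close>),
  an \<open>s \<times> m\<close> matrix is the list of its \<open>s\<close> rows.\<close>

definition coords :: "'m::{finite,linorder} list" where
  "coords = sorted_list_of_set UNIV"

definition is_reduction_matrix ::
  "(real^('m::{finite,linorder}) \<Rightarrow> ereal) \<Rightarrow> real^('m::_) \<Rightarrow> (real^('m::_)) list \<Rightarrow> bool" where
  "is_reduction_matrix \<theta> z B \<longleftrightarrow>
     (let S = parallel_subspace (subdifferential \<theta> z); s = dim S in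
      \<exists>A :: real^('m::_)^('m::_).
        orthogonal_matrix A \<and>
        (\<lambda>y. transpose A *v y) ` S = {y. \<forall>i\<in>set (drop s coords). y $ i = 0} \<and>
        B = map (\<lambda>i. row i (matrix_inv A)) (take s coords))"

definition ker_rows :: "'a::real_inner list \<Rightarrow> 'a set" where
  "ker_rows B = {y. \<forall>r\<in>set B. r \<bullet> y = 0}"

definition m_gamma ::
  "('a::euclidean_space \<times> 'b \<Rightarrow> ereal) \<Rightarrow> 'a \<Rightarrow> real \<Rightarrow> 'b \<times> 'a \<Rightarrow> ereal" where
  "m_gamma \<phi> xb \<gamma> = (\<lambda>(w, v). INF x\<in>cball xb \<gamma>. \<phi> (x, w) - ereal (v \<bullet> x))"

text \<open>The argmin is empty when the minimized expression is identically \<open>\<infinity>\<close> on the ball.\<close>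

definition M_gamma ::
  "('a::euclidean_space \<times> 'b \<Rightarrow> ereal) \<Rightarrow> 'a \<Rightarrow> real \<Rightarrow> 'b \<times> 'a \<Rightarrow> 'a set" where
  "M_gamma \<phi> xb \<gamma> = (\<lambda>(w, v).
     {x\<in>cball xb \<gamma>. m_gamma \<phi> xb \<gamma> (w, v) < \<infinity> \<and>
        \<phi> (x, w) - ereal (v \<bullet> x) = m_gamma \<phi> xb \<gamma> (w, v)})"

text \<open>Single-valuedness of \<open>M_gamma\<close> means that its values are singletons (in particular
  nonempty); Lipschitz continuity of \<open>m_gamma\<close> includes that its values are finite.\<close>

definition fully_stable ::
  "('a::euclidean_space \<times> 'b::real_normed_vector \<Rightarrow> ereal) \<Rightarrow> 'a \<Rightarrow> 'b \<Rightarrow> 'a \<Rightarrow> bool" where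
  "fully_stable \<phi> xb wb vb \<longleftrightarrow>
     (\<exists>\<gamma>>0. \<exists>W V. open W \<and> wb \<in> W \<and> open V \<and> vb \<in> V \<and>
        (\<exists>\<xi> \<kappa>. (\<forall>q\<in>W \<times> V. M_gamma \<phi> xb \<gamma> q = {\<xi> q}) \<and> \<kappa>-lipschitz_on (W \<times> V) \<xi>) \<and>
        M_gamma \<phi> xb \<gamma> (wb, vb) = {xb} \<and>
        (\<exists>\<mu> \<kappa>. (\<forall>q\<in>W \<times> V. m_gamma \<phi> xb \<gamma> q = ereal (\<mu> q)) \<and> \<kappa>-lipschitz_on (W \<times> V) \<mu>))"

definition objective ::
  "('a \<times> 'b \<Rightarrow> real) \<Rightarrow> ('c \<Rightarrow> ereal) \<Rightarrow> ('a \<times> 'b \<Rightarrow> 'c) \<Rightarrow> 'a \<times> 'b \<Rightarrow> ereal" where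
  "objective \<phi>0 \<theta> \<Phi> = (\<lambda>q. ereal (\<phi>0 q) + \<theta> (\<Phi> q))"

definition lagrangian ::
  "('a \<times> 'b \<Rightarrow> real) \<Rightarrow> ('a \<times> 'b \<Rightarrow> 'c::real_inner) \<Rightarrow> 'a \<Rightarrow> 'b \<Rightarrow> 'c \<Rightarrow> real" where
  "lagrangian \<phi>0 \<Phi> x w lam = \<phi>0 (x, w) + lam \<bullet> \<Phi> (x, w)"

definition partial_jacobian ::
  "((real^'n) \<times> 'b \<Rightarrow> real^'m) \<Rightarrow> real^'n \<Rightarrow> 'b \<Rightarrow> real^'n^'m" where
  "partial_jacobian \<Phi> x w = jacobian (\<lambda>x'. \<Phi> (x', w)) (at x)"

text \<open>The argument \<open>D\<close> below stands for the partial Jacobian of \<open>\<Phi>\<close> in \<open>x\<close>.\<close>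

definition nondegenerate :: "real^'n^'m \<Rightarrow> (real^'m) list \<Rightarrow> bool" where
  "nondegenerate D B \<longleftrightarrow> {D *v u + y |u y. y \<in> ker_rows B} = UNIV"

definition subspace_S ::
  "(nat \<Rightarrow> real^'m) \<Rightarrow> (nat \<Rightarrow> real^'m) \<Rightarrow> nat set \<Rightarrow> nat set \<Rightarrow> real^'n^'m \<Rightarrow> (real^'n) set" where
  "subspace_S a d \<Gamma>1 \<Gamma>2 D =
     {u. (\<forall>i\<in>\<Gamma>1. \<forall>j\<in>\<Gamma>1. (a i - a j) \<bullet> (D *v u) = 0) \<and> (\<forall>t\<in>\<Gamma>2. d t \<bullet> (D *v u) = 0)}"

definition composite_SSOSC :: "real^'n^'n \<Rightarrow> (real^'n) set \<Rightarrow> bool" where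
  "composite_SSOSC H S \<longleftrightarrow> (\<forall>u\<in>S. u \<noteq> 0 \<longrightarrow> u \<bullet> (H *v u) > 0)"

end

theory Submission
  imports Defs
begin

text \<open>Near \<open>\<Phi>(xb, wb)\<close> one has \<open>\<theta>(z) = const + \<langle>lam, z\<rangle> + model(z - zb)\<close> with a nonnegative
  polyhedral sublinear function \<open>model\<close> that depends only on the component of its argument in \<open>S(zb)\<close>
  and vanishes exactly on \<open>G\<close>. Condition ND allows to change the variable \<open>x\<close> locally to
  \<open>y = \<psi>(x, w)\<close> such that \<open>model(\<Phi>(x, w) - zb) = model(D y) =: g(y)\<close>. The problem becomes: minimize
  \<open>h + g\<close> with \<open>h\<close> the Lagrangian in the new variable; the gradient of \<open>h\<close> vanishes at the reference point
  and its Hessian there is the Hessian of the Lagrangian.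

  Sufficiency: \<open>g\<close> dominates a multiple of the distance to the polyhedral cone \<open>C = {y. D y \<in> G}\<close>, so
  it is an exact penalty and the minimizers are those of \<open>h\<close> over \<open>C\<close>. By SSOSC the gradient of \<open>h\<close> is
  strongly monotone along \<open>C - C\<close>, so that the minimizers are unique and Lipschitz in the parameters.

  Necessity: Lipschitz dependence on the tilt gives uniform quadratic growth at the minimizers of all nearby
  tilts. Blowing up at \<open>xb\<close>, the quadratic form of the Hessian on \<open>C\<close> has, for every tilt \<open>s\<close>, a minimizer
  with this growth. Every relatively interior point \<open>e\<close> of \<open>C\<close> is such a minimizer, for the tilt
  minimizing \<open>s \<mapsto> max (\<langle>s, y - e\<rangle> - Q y)\<close>; growth at \<open>e \<plusminus> u\<close> makes the form positive definite
  on \<open>span C\<close>, which is the subspace of SSOSC.\<close>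

subsection \<open>Functions of class C2\<close>

text \<open>Growth at the single minimizer \<open>xb\<close> would give positivity of the Hessian on
  the cone \<open>C\<close> only, whereas SSOSC asks for it on the span. This is why necessity has
  to use nearby tilts, whose minimizers reach the relative interior of \<open>C\<close>. Condition
  ND does not make \<open>D\<close> surjective. It gives a linear \<open>T\<close> with
  \<open>c \<bullet> D (T z) = c \<bullet> z\<close> for all \<open>c\<close> in
  \<open>S(zb)\<close>, a right inverse of \<open>D\<close> modulo the orthogonal complement. The
  change of variable is \<open>\<psi>(x, w) = x - xb + T (\<Phi>(x, w) - zb - D (x - xb))\<close>.
  No second derivative of its local inverse \<open>X\<close> is formed. In the Hessian of
  \<open>h\<close> such a derivative would be multiplied by the \<open>x\<close>-gradient of the
  tilted Lagrangian, which vanishes at the reference point; a Lipschitz bound on the derivative of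
  \<open>X\<close> therefore suffices for strong monotonicity. In the blow-up the corresponding
  terms cancel against the tilt, so first order information on \<open>X\<close> is enough there
  too.\<close>

lemma strict_derivative_bound:
  fixes f :: "'a::real_normed_vector \<Rightarrow> 'b::real_normed_vector"
  assumes der: "\<And>x. (f has_derivative blinfun_apply (f' x)) (at x)"
    and cont: "continuous (at u) f'" and "0 < e"
  obtains r where "0 < r"
    "\<And>x y. x \<in> ball u r \<Longrightarrow> y \<in> ball u r \<Longrightarrow> norm (f x - f y - f' u (x - y)) \<le> e * norm (x - y)"
proof -
  obtain r where r: "0 < r" "\<And>x. dist x u < r \<Longrightarrow> dist (f' x) (f' u) < e"
    using cont \<open>0 < e\<close> unfolding continuous_at_eps_delta by blast
  have "norm (f x - f y - f' u (x - y)) \<le> e * norm (x - y)" if "x \<in> ball u r" "y \<in> ball u r" for x y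
  proof -
    \<comment> \<open>Mean value inequality for \<open>f - f' u\<close>, whose derivative has norm
      below \<open>e\<close> on the ball. Both points vary; in this two-point form the bound serves
      for increments of \<open>f\<close> and, one order higher, of \<open>f'\<close>.\<close>
    have "norm ((f x - f' u x) - (f y - f' u y)) \<le> e * norm (x - y)"
    proof (rule differentiable_bound[OF convex_ball])
      show "((\<lambda>x. f x - f' u x) has_derivative blinfun_apply (f' z - f' u)) (at z within ball u r)" for z
        unfolding minus_blinfun.rep_eq
        by (intro has_derivative_diff has_derivative_at_withinI[OF der]
            bounded_linear_imp_has_derivative blinfun.bounded_linear_right)
      show "onorm (blinfun_apply (f' z - f' u)) \<le> e" if "z \<in> ball u r" for z
        using r(2)[of z] that
        by (simp add: dist_commute[of u] dist_norm norm_blinfun.rep_eq[symmetric] norm_minus_commute)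
    qed (use that in auto)
    then show ?thesis by (simp add: blinfun.diff_right algebra_simps)
  qed
  with r(1) show thesis using that by blast
qed

lemma C2_smooth_bounded_linear:
  assumes "bounded_linear f"
  shows "C2_smooth f"
  unfolding C2_smooth_def
proof (intro exI conjI allI)
  show "(f has_derivative blinfun_apply (Blinfun f)) (at x)" for x
    using assms by (simp add: bounded_linear_Blinfun_apply bounded_linear_imp_has_derivative)
  show "((\<lambda>_. Blinfun f) has_derivative blinfun_apply 0) (at x)" for x
    by (simp add: zero_blinfun.rep_eq)
qed auto

lemma C2_smooth_const: "C2_smooth (\<lambda>x. c)"
  unfolding C2_smooth_def
proof (intro exI conjI allI)
  show "((\<lambda>x. c) has_derivative blinfun_apply 0) (at x)" for x
    by (simp add: zero_blinfun.rep_eq)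
  show "((\<lambda>_. 0) has_derivative blinfun_apply 0) (at x)" for x
    by (simp add: zero_blinfun.rep_eq)
qed auto

lemma C2_smooth_add:
  assumes "C2_smooth f" "C2_smooth g"
  shows "C2_smooth (\<lambda>x. f x + g x)"
proof -
  from assms(1) obtain f' f'' where f: "\<And>x. (f has_derivative blinfun_apply (f' x)) (at x)"
    "\<And>x. (f' has_derivative blinfun_apply (f'' x)) (at x)" "continuous_on UNIV f''"
    unfolding C2_smooth_def by blast
  from assms(2) obtain g' g'' where g: "\<And>x. (g has_derivative blinfun_apply (g' x)) (at x)"
    "\<And>x. (g' has_derivative blinfun_apply (g'' x)) (at x)" "continuous_on UNIV g''"
    unfolding C2_smooth_def by blast
  show ?thesis unfolding C2_smooth_def
  proof (intro exI conjI allI)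
    show "((\<lambda>x. f x + g x) has_derivative blinfun_apply (f' x + g' x)) (at x)" for x
      using has_derivative_add[OF f(1) g(1)] by (simp add: plus_blinfun.rep_eq)
    show "((\<lambda>x. f' x + g' x) has_derivative blinfun_apply (f'' x + g'' x)) (at x)" for x
      using has_derivative_add[OF f(2) g(2)] by (simp add: plus_blinfun.rep_eq)
    show "continuous_on UNIV (\<lambda>x. f'' x + g'' x)"
      using f(3) g(3) by (rule continuous_on_add)
  qed
qed

lemma C2_smooth_linear_compose:
  fixes T :: "'b::real_normed_vector \<Rightarrow> 'c::real_normed_vector"
    and f :: "'a::real_normed_vector \<Rightarrow> 'b"
  assumes T: "bounded_linear T" and "C2_smooth f"
  shows "C2_smooth (\<lambda>x. T (f x))"
proof -
  obtain f' f'' where f: "\<And>x. (f has_derivative blinfun_apply (f' x)) (at x)"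
    "\<And>x. (f' has_derivative blinfun_apply (f'' x)) (at x)" "continuous_on UNIV f''"
    using assms(2) unfolding C2_smooth_def by blast
  define T' where "T' = Blinfun T"
  have T': "T x = T' x" for x
    unfolding T'_def using T by (simp add: bounded_linear_Blinfun_apply)
  define R :: "('a \<Rightarrow>\<^sub>L 'b) \<Rightarrow>\<^sub>L ('a \<Rightarrow>\<^sub>L 'c)" where "R = Blinfun (\<lambda>h. T' o\<^sub>L h)"
  have R: "blinfun_apply R = (\<lambda>h. T' o\<^sub>L h)"
    unfolding R_def
    by (rule bounded_linear_Blinfun_apply) (intro bounded_linear_intros)
  show ?thesis unfolding C2_smooth_def
  proof (intro exI conjI allI)
    show "((\<lambda>x. T (f x)) has_derivative blinfun_apply (T' o\<^sub>L f' x)) (at x)" for x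
      unfolding T' using bounded_linear.has_derivative[OF blinfun.bounded_linear_right f(1), of T' x]
      by (simp add: o_def blinfun_compose.rep_eq)
    show "((\<lambda>x. T' o\<^sub>L f' x) has_derivative blinfun_apply (R o\<^sub>L f'' x)) (at x)" for x
      using bounded_linear.has_derivative[OF blinfun.bounded_linear_right f(2), of R x]
      by (simp add: o_def R blinfun_compose.rep_eq)
    show "continuous_on UNIV (\<lambda>x. R o\<^sub>L f'' x)"
      using f(3) by (intro continuous_intros)
  qed
qed

text \<open>Composing a total derivative with this embedding gives the partial derivative in the
  first variable.\<close>

definition inl_blinfun :: "'a::real_normed_vector \<Rightarrow>\<^sub>L ('a \<times> 'b::real_normed_vector)" where
  "inl_blinfun = Blinfun (\<lambda>k. (k, 0))"

lemma inl_blinfun_apply [simp]: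
  "blinfun_apply inl_blinfun (k::'a::real_normed_vector) = (k, 0::'b::real_normed_vector)"
proof -
  have "bounded_linear (\<lambda>k::'a. (k, 0::'b))"
    by (intro bounded_linear_Pair bounded_linear_ident bounded_linear_zero)
  then show ?thesis
    by (simp add: inl_blinfun_def bounded_linear_Blinfun_apply)
qed

lemma norm_inl_blinfun: "norm (inl_blinfun :: 'a::real_normed_vector \<Rightarrow>\<^sub>L ('a \<times> 'b::real_normed_vector)) \<le> 1"
  by (rule norm_blinfun_bound) (simp_all add: norm_Pair)

lemma has_derivative_partial_fst:
  assumes "(f has_derivative blinfun_apply F) (at (x, w))"
  shows "((\<lambda>x. f (x, w)) has_derivative blinfun_apply (F o\<^sub>L inl_blinfun)) (at x)"
proof -
  have "((\<lambda>x. (x, w)) has_derivative (\<lambda>k. (k, 0))) (at x)"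
    by (intro has_derivative_Pair has_derivative_ident has_derivative_const)
  from diff_chain_at[OF this assms] show ?thesis by (simp add: o_def blinfun_compose.rep_eq)
qed

lemma local_lipschitz_derivative:
  fixes f' :: "'a::real_normed_vector \<Rightarrow> 'b::real_normed_vector"
  assumes "\<And>x. (f' has_derivative blinfun_apply (f'' x)) (at x)" "continuous_on UNIV f''"
  obtains r L where "0 < r" "0 \<le> L"
    "\<And>x y. x \<in> ball u r \<Longrightarrow> y \<in> ball u r \<Longrightarrow> norm (f' x - f' y) \<le> L * norm (x - y)"
proof -
  have "continuous (at u) f''" using assms(2) by (simp add: continuous_on_eq_continuous_at)
  from strict_derivative_bound[OF assms(1) this zero_less_one] obtain r where r: "0 < r"
    "\<And>x y. x \<in> ball u r \<Longrightarrow> y \<in> ball u r \<Longrightarrow> norm (f' x - f' y - f'' u (x - y)) \<le> 1 * norm (x - y)"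
    by blast
  have "norm (f' x - f' y) \<le> (1 + norm (f'' u)) * norm (x - y)" if "x \<in> ball u r" "y \<in> ball u r" for x y
    using r(2)[OF that] norm_blinfun[of "f'' u" "x - y"]
      norm_triangle_ineq2[of "f' x - f' y" "f'' u (x - y)"] by (simp add: algebra_simps)
  with r(1) show thesis by (intro that[of r "1 + norm (f'' u)"]) simp_all
qed

subsection \<open>Parametric inverse functions\<close>

text \<open>The inverse function theorem for the map sending \<open>(x, w)\<close> to
  \<open>(\<psi> (x, w), w)\<close>, whose inverse keeps \<open>w\<close>. The Lipschitz property of
  \<open>X'\<close> comes without differentiating \<open>X\<close> twice: \<open>X'\<close> inverts
  the partial derivative of \<open>\<psi>\<close>, which is itself Lipschitz.\<close>

lemma parametric_inverse:
  fixes \<psi> :: "'a::euclidean_space \<times> 'b::euclidean_space \<Rightarrow> 'a"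
  assumes der: "\<And>p. (\<psi> has_derivative blinfun_apply (\<psi>' p)) (at p)"
    and der2: "\<And>p. (\<psi>' has_derivative blinfun_apply (\<psi>'' p)) (at p)"
    and cont: "continuous_on UNIV \<psi>''"
    and base: "\<psi> (xb, wb) = 0" and id: "\<psi>' (xb, wb) o\<^sub>L inl_blinfun = id_blinfun"
  obtains X X' r \<gamma> L where "0 < r" "0 < \<gamma>" "0 \<le> L"
    "\<And>u. u \<in> ball (0, wb) r \<Longrightarrow> \<psi> (X u, snd u) = fst u"
    "\<And>u v. u \<in> ball (0, wb) r \<Longrightarrow> v \<in> ball (0, wb) r \<Longrightarrow> norm (X u - X v) \<le> L * norm (u - v)"
    "\<And>y w. (y, w) \<in> ball (0, wb) r \<Longrightarrow> ((\<lambda>y. X (y, w)) has_derivative blinfun_apply (X' (y, w))) (at y)"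
    "\<And>u v. u \<in> ball (0, wb) r \<Longrightarrow> v \<in> ball (0, wb) r \<Longrightarrow> norm (X' u - X' v) \<le> L * norm (u - v)"
    "X' (0, wb) = id_blinfun" "X (0, wb) = xb"
    "\<And>x w. x \<in> ball xb \<gamma> \<Longrightarrow> w \<in> ball wb \<gamma> \<Longrightarrow>
        (\<psi> (x, w), w) \<in> ball (0, wb) r \<and> X (\<psi> (x, w), w) = x"
proof -
  define p0 where "p0 = (xb, wb)"
  define u0 where "u0 = (0::'a, wb)"
  define \<Psi> where "\<Psi> = (\<lambda>p. (\<psi> p, snd p))"
  define E :: "('a \<times> 'b) \<Rightarrow>\<^sub>L ('a \<times> 'b)" where "E = Blinfun (\<lambda>k. (0, snd k))"
  have E: "E k = (0, snd k)" for k
    unfolding E_def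
    by (subst bounded_linear_Blinfun_apply[OF bounded_linear_Pair[OF bounded_linear_zero bounded_linear_snd]]) simp
  define \<Psi>' where "\<Psi>' = (\<lambda>p. (inl_blinfun o\<^sub>L \<psi>' p) + E)"
  have \<Psi>': "\<Psi>' p k = (\<psi>' p k, snd k)" for p k
    by (simp add: \<Psi>'_def plus_blinfun.rep_eq E)
  have \<Psi>0: "\<Psi> p0 = u0" by (simp add: \<Psi>_def p0_def u0_def base)
  have der\<psi>': "continuous_on UNIV \<psi>'" by (rule has_derivative_continuous_on) (rule der2)
  have d\<Psi>: "(\<Psi> has_derivative blinfun_apply (\<Psi>' p)) (at p)" for p
  proof -
    have "(\<Psi> has_derivative (\<lambda>k. (\<psi>' p k, snd k))) (at p)"
      unfolding \<Psi>_def
      by (intro has_derivative_Pair der has_derivative_snd has_derivative_ident)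
    moreover have "blinfun_apply (\<Psi>' p) = (\<lambda>k. (\<psi>' p k, snd k))" by (rule ext) (rule \<Psi>')
    ultimately show ?thesis by simp
  qed
  have c\<Psi>: "continuous_on UNIV \<Psi>'" unfolding \<Psi>'_def using der\<psi>' by (intro continuous_intros)
  \<comment> \<open>Writing \<open>\<psi>' p0 (k, j) = k + P j\<close>, the derivative of
    \<open>\<Psi>\<close> at \<open>p0\<close> is block triangular and its inverse sends
    \<open>(k, j)\<close> to \<open>(k - P j, j)\<close>; this is \<open>N\<close>.\<close>
  define N where "N = id_blinfun - (inl_blinfun o\<^sub>L (\<psi>' p0 - fst_blinfun))"
  have idk: "\<psi>' p0 (k, 0) = k" for k
    using arg_cong[OF id, of "\<lambda>f. blinfun_apply f k"] by (simp add: p0_def)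
  have NI: "N o\<^sub>L \<Psi>' p0 = id_blinfun"
  proof (rule blinfun_eqI)
    fix k :: "'a \<times> 'b"
    have "\<psi>' p0 k = fst k + \<psi>' p0 (0, snd k)"
      using idk[of "fst k"] blinfun.add_right[of "\<psi>' p0" "(fst k, 0)" "(0, snd k)"] by simp
    moreover have "\<psi>' p0 (\<psi>' p0 k, snd k) = \<psi>' p0 k + \<psi>' p0 (0, snd k)"
      using idk[of "\<psi>' p0 k"] blinfun.add_right[of "\<psi>' p0" "(\<psi>' p0 k, 0)" "(0, snd k)"] by simp
    ultimately show "(N o\<^sub>L \<Psi>' p0) k = id_blinfun k"
      by (simp add: N_def \<Psi>' blinfun.diff_left blinfun.diff_right prod_eq_iff)
  qed
  obtain U' V g g' where U': "open U'" "p0 \<in> U'" and V: "open V" "\<Psi> p0 \<in> V"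
    and hom: "homeomorphism U' V \<Psi> g"
    and dg: "\<And>y. y \<in> V \<Longrightarrow> (g has_derivative (g' y)) (at y)"
    and g': "\<And>y. y \<in> V \<Longrightarrow> g' y = inv (blinfun_apply (\<Psi>' (g y)))"
    and bij: "\<And>y. y \<in> V \<Longrightarrow> bij (blinfun_apply (\<Psi>' (g y)))"
    using inverse_function_theorem[OF open_UNIV d\<Psi> c\<Psi> UNIV_I NI] by metis
  have gg: "g (\<Psi> p) = p" if "p \<in> U'" for p using hom that by (simp add: homeomorphism_def)
  have \<Psi>g: "\<Psi> (g u) = u" if "u \<in> V" for u using hom that by (simp add: homeomorphism_def)
  have g0: "g u0 = p0" using gg[OF U'(2)] \<Psi>0 by simp
  define K where "K = norm N + 1"
  have K: "0 < K" "norm N \<le> K" by (simp_all add: K_def add_nonneg_pos)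
  \<comment> \<open>With this tolerance \<open>N\<close> turns the linearization error into at most
    half of \<open>norm (x - y)\<close>, which is absorbed on the left; hence the constant
    \<open>2 * K\<close> of the inverse.\<close>
  have "0 < 1 / (2 * K)" using K by simp
  moreover have "isCont \<Psi>' p0" using c\<Psi> continuous_on_eq_continuous_at by blast
  ultimately
  obtain r1 where r1: "0 < r1" "\<And>x y. x \<in> ball p0 r1 \<Longrightarrow> y \<in> ball p0 r1 \<Longrightarrow>
      norm (\<Psi> x - \<Psi> y - \<Psi>' p0 (x - y)) \<le> 1 / (2 * K) * norm (x - y)"
    using strict_derivative_bound[of \<Psi> \<Psi>' p0, OF d\<Psi>] by blast
  have inv_lip: "norm (x - y) \<le> 2 * K * norm (\<Psi> x - \<Psi> y)"
    if "x \<in> ball p0 r1" "y \<in> ball p0 r1" for x y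
  proof -
    have "norm (x - y) = norm (N (\<Psi>' p0 (x - y)))"
      using NI by (metis blinfun_apply_blinfun_compose blinfun_apply_id_blinfun id_apply)
    also have "\<dots> \<le> K * norm (\<Psi>' p0 (x - y))"
      using norm_blinfun[of N "\<Psi>' p0 (x - y)"] K by (meson mult_right_mono norm_ge_zero order_trans)
    also have "norm (\<Psi>' p0 (x - y)) \<le> norm (\<Psi> x - \<Psi> y) + 1 / (2 * K) * norm (x - y)"
      using r1(2)[OF that] norm_triangle_ineq3[of "\<Psi>' p0 (x - y)" "\<Psi> x - \<Psi> y"]
        norm_minus_commute[of "\<Psi>' p0 (x - y)" "\<Psi> x - \<Psi> y"] by linarith
    then have "K * norm (\<Psi>' p0 (x - y)) \<le> K * (norm (\<Psi> x - \<Psi> y) + 1 / (2 * K) * norm (x - y))"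
      using K by simp
    also have "\<dots> = K * norm (\<Psi> x - \<Psi> y) + norm (x - y) / 2"
      using K by (simp add: field_simps)
    finally show ?thesis by simp
  qed
  obtain r3 L1 where r3: "0 < r3" "0 \<le> L1"
    "\<And>x y. x \<in> ball p0 r3 \<Longrightarrow> y \<in> ball p0 r3 \<Longrightarrow> norm (\<psi>' x - \<psi>' y) \<le> L1 * norm (x - y)"
    using local_lipschitz_derivative[OF der2 cont, of p0] by blast
  define A where "A = (\<lambda>p. \<psi>' p o\<^sub>L inl_blinfun)"
  have Aid: "A p0 = id_blinfun" using id by (simp add: A_def p0_def)
  have A_lip: "norm (A x - A y) \<le> L1 * norm (x - y)" if "x \<in> ball p0 r3" "y \<in> ball p0 r3" for x y
  proof -
    have "A x - A y = (\<psi>' x - \<psi>' y) o\<^sub>L inl_blinfun"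
      by (rule blinfun_eqI) (simp add: A_def blinfun.diff_left)
    then have "norm (A x - A y) \<le> norm (\<psi>' x - \<psi>' y) * norm (inl_blinfun :: 'a \<Rightarrow>\<^sub>L ('a \<times> 'b))"
      by (simp add: norm_blinfun_compose)
    also have "\<dots> \<le> norm (\<psi>' x - \<psi>' y) * 1"
      by (rule mult_left_mono[OF norm_inl_blinfun]) simp
    finally show ?thesis using r3(3)[OF that] by simp
  qed
  \<comment> \<open>The last entry keeps \<open>A p\<close> within \<open>1 / 2\<close> of the
    identity, so that \<open>A p\<close> shrinks no vector by more than the factor 2.\<close>
  define r4 where "r4 = min r1 (min r3 (1 / (2 * (L1 + 1))))"
  have r4: "0 < r4" using r1(1) r3(1,2) by (simp add: r4_def)
  have A_inv: "norm k \<le> 2 * norm (A p k)" if "p \<in> ball p0 r4" for p k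
  proof -
    have "norm (A p - id_blinfun) \<le> L1 * norm (p - p0)"
      using A_lip[of p p0] that r3(1) Aid by (simp add: r4_def)
    also have "\<dots> \<le> L1 * (1 / (2 * (L1 + 1)))"
      using that r3(2) by (intro mult_left_mono) (auto simp: r4_def dist_norm norm_minus_commute)
    also have "\<dots> \<le> 1 / 2" using r3(2) by (simp add: field_simps)
    finally have "norm ((A p - id_blinfun) k) \<le> 1 / 2 * norm k"
      using norm_blinfun[of "A p - id_blinfun" k] by (meson mult_right_mono norm_ge_zero order_trans)
    then have "norm (A p k - k) \<le> norm k / 2" by (simp add: blinfun.diff_left)
    then show ?thesis using norm_triangle_ineq3[of k "A p k"] norm_minus_commute[of k "A p k"] by linarith
  qed
  have "isCont g u0"
    using dg[of u0] V \<Psi>0 has_derivative_continuous by fastforce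
  then obtain r5 where r5: "0 < r5" "\<And>u. dist u u0 < r5 \<Longrightarrow> dist (g u) p0 < r4"
    using r4 g0 unfolding continuous_at_eps_delta by metis
  obtain r6 where r6: "0 < r6" "ball u0 r6 \<subseteq> V"
    using V \<Psi>0 by (metis open_contains_ball)
  define r where "r = min r5 r6"
  have r: "0 < r" using r5 r6 by (simp add: r_def)
  have rV: "u \<in> V" "g u \<in> ball p0 r4" if "u \<in> ball u0 r" for u
    using that r5(2)[of u] r6(2) by (auto simp: r_def dist_commute)
  have g_lip: "norm (g u - g v) \<le> 2 * K * norm (u - v)" if "u \<in> ball u0 r" "v \<in> ball u0 r" for u v
    using inv_lip[of "g u" "g v"] rV[OF that(1)] rV[OF that(2)] \<Psi>g by (simp add: r4_def)
  have sndg: "snd (g u) = snd u" "\<psi> (g u) = fst u" if "u \<in> V" for u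
    using \<Psi>g[OF that] unfolding \<Psi>_def by (metis fst_conv snd_conv)+
  define X where "X = (\<lambda>u. fst (g u))"
  \<comment> \<open>The upper left block of the inverse derivative. As \<open>\<Psi>'\<close> keeps
    the second component, \<open>g' u\<close> maps \<open>(k, 0)\<close> to
    \<open>(X' u k, 0)\<close>, so \<open>X' u\<close> is a right inverse of the partial derivative
    \<open>A (g u)\<close>.\<close>
  define X' where "X' = (\<lambda>u. fst_blinfun o\<^sub>L Blinfun (g' u) o\<^sub>L inl_blinfun)"
  have Bg': "blinfun_apply (Blinfun (g' u)) = g' u" if "u \<in> V" for u
    using dg[OF that] by (simp add: bounded_linear_Blinfun_apply has_derivative_bounded_linear)
  have AX: "A (g u) (X' u k) = k" if "u \<in> V" for u k
  proof -
    have e: "\<Psi>' (g u) (g' u (k, 0)) = (k, 0)"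
      using g'[OF that] bij[OF that] by (simp add: bij_is_surj surj_f_inv_f)
    then have "snd (g' u (k, 0)) = 0" by (simp add: \<Psi>')
    then have "g' u (k, 0) = (X' u k, 0)" using Bg'[OF that] by (simp add: X'_def prod_eq_iff)
    then show ?thesis using e by (simp add: A_def \<Psi>')
  qed
  have X'_bd: "norm (X' u k) \<le> 2 * norm k" if "u \<in> ball u0 r" for u k
    using A_inv[OF rV(2)[OF that], of "X' u k"] AX[OF rV(1)[OF that]] by simp
  \<comment> \<open>\<open>2 * K\<close> is the constant of \<open>g\<close>. In
    \<open>8 * L1 * K\<close> one factor 2 comes from \<open>A_inv\<close>,
    \<open>L1 * (2 * K)\<close> from \<open>A\<close> composed with \<open>g\<close>, and another 2
    from the bound on \<open>X'\<close>.\<close>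
  define L where "L = max (2 * K) (8 * L1 * K)"
  have "isCont \<Psi> p0" using d\<Psi> has_derivative_continuous by blast
  then obtain d1 where d1: "0 < d1" "\<And>p. dist p p0 < d1 \<Longrightarrow> dist (\<Psi> p) u0 < r"
    using r \<Psi>0 unfolding continuous_at_eps_delta by metis
  obtain d2 where d2: "0 < d2" "ball p0 d2 \<subseteq> U'"
    using U' by (metis open_contains_ball)
  define \<gamma> where "\<gamma> = min d1 d2 / 2"
  show thesis
  proof (rule that[of r \<gamma> L X X'])
    show "0 < \<gamma>" using d1 d2 by (simp add: \<gamma>_def)
    show "(\<psi> (x, w), w) \<in> ball (0, wb) r \<and> X (\<psi> (x, w), w) = x"
      if "x \<in> ball xb \<gamma>" "w \<in> ball wb \<gamma>" for x w
    proof -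
      have "dist (x, w) p0 \<le> dist x xb + dist w wb"
        unfolding p0_def dist_Pair_Pair by (rule sqrt_sum_squares_le_sum) auto
      also have "\<dots> < min d1 d2" using that by (simp add: \<gamma>_def dist_commute)
      finally have *: "dist (x, w) p0 < d1" "dist (x, w) p0 < d2" by auto
      then have "(x, w) \<in> U'" using d2 by (auto simp: dist_commute)
      then have "g (\<Psi> (x, w)) = (x, w)" using gg by simp
      then have "X (\<psi> (x, w), w) = x" by (simp add: \<Psi>_def X_def)
      moreover have "(\<psi> (x, w), w) \<in> ball (0, wb) r"
        using d1(2)[OF *(1)] by (simp add: \<Psi>_def u0_def dist_commute)
      ultimately show ?thesis by simp
    qed
    show "0 < r" by (rule r)
    show "0 \<le> L" using K by (simp add: L_def)
    show "\<psi> (X u, snd u) = fst u" if "u \<in> ball (0, wb) r" for u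
    proof -
      have "u \<in> V" using rV(1) that by (simp add: u0_def)
      from sndg[OF this] have "(X u, snd u) = g u" by (simp add: X_def prod_eq_iff)
      with sndg(2)[OF \<open>u \<in> V\<close>] show ?thesis by simp
    qed
    show "norm (X u - X v) \<le> L * norm (u - v)" if "u \<in> ball (0, wb) r" "v \<in> ball (0, wb) r" for u v
    proof -
      have "norm (X u - X v) \<le> norm (g u - g v)"
        using norm_fst_le[of "fst (g u - g v)" "snd (g u - g v)"]
        unfolding prod.collapse unfolding X_def fst_diff .
      also have "\<dots> \<le> 2 * K * norm (u - v)" using g_lip that by (simp add: u0_def)
      also have "\<dots> \<le> L * norm (u - v)" by (intro mult_right_mono) (auto simp: L_def)
      finally show ?thesis .
    qed
    show "((\<lambda>y. X (y, w)) has_derivative blinfun_apply (X' (y, w))) (at y)"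
      if "(y, w) \<in> ball (0, wb) r" for y w
    proof -
      have V: "(y, w) \<in> V" using rV(1) that by (simp add: u0_def)
      have "(g has_derivative blinfun_apply (Blinfun (g' (y, w)))) (at (y, w))"
        using dg[OF V] Bg'[OF V] by simp
      from has_derivative_fst[OF has_derivative_partial_fst[OF this]] show ?thesis
        by (simp add: X_def X'_def o_def blinfun_compose.rep_eq)
    qed
    show "norm (X' u - X' v) \<le> L * norm (u - v)" if "u \<in> ball (0, wb) r" "v \<in> ball (0, wb) r" for u v
    proof (rule norm_blinfun_bound)
      fix k
      have uv: "u \<in> ball u0 r" "v \<in> ball u0 r" using that by (auto simp: u0_def)
      have in3: "g u \<in> ball p0 r3" "g v \<in> ball p0 r3" using rV(2)[OF uv(1)] rV(2)[OF uv(2)] by (auto simp: r4_def)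
      \<comment> \<open>Both \<open>A (g u) (X' u k)\<close> and \<open>A (g v) (X' v k)\<close>
        equal \<open>k\<close>: the usual identity for differences of inverses.\<close>
      have "A (g u) (X' u k - X' v k) = (A (g v) - A (g u)) (X' v k)"
        using AX[OF rV(1)[OF uv(1)]] AX[OF rV(1)[OF uv(2)]]
        by (simp add: blinfun.diff_right blinfun.diff_left)
      then have "norm (X' u k - X' v k) \<le> 2 * norm ((A (g v) - A (g u)) (X' v k))"
        using A_inv[OF rV(2)[OF uv(1)], of "X' u k - X' v k"] by simp
      also have "\<dots> \<le> 2 * (norm (A (g v) - A (g u)) * norm (X' v k))"
        by (simp add: norm_blinfun)
      also have "\<dots> \<le> 2 * ((L1 * (2 * K * norm (u - v))) * (2 * norm k))"
      proof (intro mult_left_mono mult_mono)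
        show "norm (A (g v) - A (g u)) \<le> L1 * (2 * K * norm (u - v))"
          using A_lip[OF in3(2,1)] g_lip[OF uv(2,1)] r3(2)
          mult_left_mono[OF g_lip[OF uv(2,1)] r3(2)] by (simp add: norm_minus_commute[of v u])
      qed (use X'_bd[OF uv(2)] r3 K in auto)
      also have "\<dots> = 8 * L1 * K * norm (u - v) * norm k" by simp
      also have "\<dots> \<le> L * norm (u - v) * norm k"
        by (intro mult_right_mono) (auto simp: L_def)
      finally show "norm ((X' u - X' v) k) \<le> L * norm (u - v) * norm k"
        by (simp add: blinfun.diff_left)
    qed (use K in \<open>simp add: L_def\<close>)
    show "X' (0, wb) = id_blinfun"
    proof (rule blinfun_eqI)
      fix k
      show "X' (0, wb) k = id_blinfun k"
        using AX[of u0 k] rV(1)[of u0] r g0 Aid by (simp add: u0_def)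
    qed
    show "X (0, wb) = xb" using g0 by (simp add: X_def u0_def p0_def)
  qed
qed

subsection \<open>Minimizers of strongly monotone problems\<close>

lemma minimizer_variational_inequality:
  fixes h :: "'a::real_normed_vector \<Rightarrow> real"
  assumes "convex S" "x \<in> S" "y \<in> S" and der: "(h has_derivative blinfun_apply D) (at x)"
    and min: "\<And>z. z \<in> S \<Longrightarrow> h x \<le> h z"
  shows "0 \<le> D (y - x)"
proof (rule ccontr)
  assume neg: "\<not> 0 \<le> D (y - x)"
  define F where "F = (\<lambda>t. h (x + t *\<^sub>R (y - x)))"
  have "((\<lambda>t. x + t *\<^sub>R (y - x)) has_derivative (\<lambda>t. t *\<^sub>R (y - x))) (at 0)"
    by (auto intro!: derivative_eq_intros)
  from diff_chain_at[OF this, of h D] der have "(F has_derivative (\<lambda>t. t * D (y - x))) (at 0)"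
    by (simp add: o_def F_def blinfun.scaleR_right)
  then have "DERIV F 0 :> D (y - x)"
    by (rule has_derivative_imp_has_field_derivative) (simp add: mult.commute)
  from DERIV_neg_dec_right[OF this] neg obtain d where d: "0 < d" "\<And>t. 0 < t \<Longrightarrow> t < d \<Longrightarrow> F t < F 0"
    by auto
  define t where "t = min (d / 2) 1"
  have t: "0 < t" "t < d" "t \<le> 1" using d(1) by (auto simp: t_def)
  have "x + t *\<^sub>R (y - x) = (1 - t) *\<^sub>R x + t *\<^sub>R y" by (simp add: algebra_simps)
  then have "x + t *\<^sub>R (y - x) \<in> S"
    using assms(1-3) t by (simp add: convexD_alt)
  from min[OF this] d(2)[OF t(1,2)] show False by (simp add: F_def)
qed

text \<open>Adding the variational inequalities at two parameters bounds the distance of the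
  minimizers by the change of the gradient. The same estimate gives uniqueness (equal parameters),
  Lipschitz dependence, and \<open>Y qb = 0\<close>, since \<open>0\<close> satisfies the
  variational inequality when its gradient vanishes.\<close>

lemma strongly_monotone_minimizers:
  fixes h :: "'a::euclidean_space \<Rightarrow> 'q::real_normed_vector \<Rightarrow> real"
    and Dh :: "'a \<Rightarrow> 'q \<Rightarrow> 'a \<Rightarrow>\<^sub>L real"
  assumes S: "compact S" "convex S" "0 \<in> S" and "0 < \<kappa>" and "qb \<in> Q"
    and der: "\<And>y q. y \<in> S \<Longrightarrow> q \<in> Q \<Longrightarrow> ((\<lambda>y. h y q) has_derivative blinfun_apply (Dh y q)) (at y)"
    and mono: "\<And>x y q. x \<in> S \<Longrightarrow> y \<in> S \<Longrightarrow> q \<in> Q \<Longrightarrow>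
        \<kappa> * (norm (x - y))\<^sup>2 \<le> (Dh x q - Dh y q) (x - y)"
    and lip: "\<And>y q q'. y \<in> S \<Longrightarrow> q \<in> Q \<Longrightarrow> q' \<in> Q \<Longrightarrow> norm (Dh y q - Dh y q') \<le> L * norm (q - q')"
    and crit: "Dh 0 qb = 0"
  obtains Y where "\<And>q. q \<in> Q \<Longrightarrow> Y q \<in> S"
    "\<And>q y. q \<in> Q \<Longrightarrow> y \<in> S \<Longrightarrow> h (Y q) q \<le> h y q"
    "\<And>q y. q \<in> Q \<Longrightarrow> y \<in> S \<Longrightarrow> h y q \<le> h (Y q) q \<Longrightarrow> y = Y q"
    "\<And>q q'. q \<in> Q \<Longrightarrow> q' \<in> Q \<Longrightarrow> \<kappa> * norm (Y q - Y q') \<le> L * norm (q - q')"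
    "Y qb = 0"
proof -
  have vi_lip: "\<kappa> * norm (x - y) \<le> L * norm (q - q')"
    if "q \<in> Q" "q' \<in> Q" "x \<in> S" "y \<in> S" "0 \<le> Dh x q (y - x)" "0 \<le> Dh y q' (x - y)" for x y q q'
  proof (cases "x = y")
    \<comment> \<open>The sign of \<open>L\<close> is unknown; the right-hand side is nonnegative by
      \<open>lip\<close> at the point \<open>0\<close>.\<close>
    case True
    have "0 \<le> norm (Dh 0 q - Dh 0 q')" by simp
    also have "\<dots> \<le> L * norm (q - q')" using lip[OF S(3)] that by blast
    finally show ?thesis using True by simp
  next
    case False
    have "\<kappa> * (norm (x - y))\<^sup>2 \<le> Dh x q (x - y) - Dh y q (x - y)"
      using mono[OF that(3,4,1)] by (simp add: blinfun.diff_left)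
    also have "\<dots> \<le> (Dh y q' - Dh y q) (x - y)"
      using that(5,6) by (simp add: blinfun.diff_left blinfun.diff_right)
    also have "\<dots> \<le> norm (Dh y q' - Dh y q) * norm (x - y)"
      using norm_blinfun[of "Dh y q' - Dh y q" "x - y"] by simp
    also have "\<dots> \<le> (L * norm (q' - q)) * norm (x - y)"
      by (intro mult_right_mono lip that) simp
    finally have "(\<kappa> * norm (x - y)) * norm (x - y) \<le> (L * norm (q - q')) * norm (x - y)"
      by (simp add: power2_eq_square norm_minus_commute mult.assoc)
    then show ?thesis using False by simp
  qed
  have ex: "\<exists>y\<in>S. \<forall>z\<in>S. h y q \<le> h z q" if "q \<in> Q" for q
  proof (rule continuous_attains_inf)
    show "continuous_on S (\<lambda>y. h y q)"
      by (rule has_derivative_continuous_on) (rule has_derivative_at_withinI[OF der[OF _ that]])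
  qed (use S in auto)
  define Y where "Y = (\<lambda>q. SOME y. y \<in> S \<and> (\<forall>z\<in>S. h y q \<le> h z q))"
  have Y: "Y q \<in> S" "\<And>z. z \<in> S \<Longrightarrow> h (Y q) q \<le> h z q" if "q \<in> Q" for q
    using someI_ex[of "\<lambda>y. y \<in> S \<and> (\<forall>z\<in>S. h y q \<le> h z q)"] ex[OF that] unfolding Y_def by auto
  have vi: "0 \<le> Dh x q (z - x)" if "q \<in> Q" "x \<in> S" "z \<in> S" "\<And>z. z \<in> S \<Longrightarrow> h x q \<le> h z q" for x z q
    by (rule minimizer_variational_inequality[OF S(2) that(2,3) der[OF that(2,1)] that(4)])
  show thesis
  proof (rule that[of Y])
    show "y = Y q" if "q \<in> Q" "y \<in> S" "h y q \<le> h (Y q) q" for q y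
    proof -
      have "h y q \<le> h z q" if "z \<in> S" for z
        using Y(2)[OF \<open>q \<in> Q\<close> that] \<open>h y q \<le> h (Y q) q\<close> by simp
      from vi_lip[OF that(1,1,2) Y(1) vi[OF that(1,2) Y(1) this] vi[OF that(1) Y(1) that(2) Y(2)]]
      have "\<kappa> * norm (y - Y q) \<le> 0" using that(1) by simp
      then show ?thesis using \<open>0 < \<kappa>\<close> by (simp add: mult_le_0_iff)
    qed
    show lipY: "\<kappa> * norm (Y q - Y q') \<le> L * norm (q - q')" if "q \<in> Q" "q' \<in> Q" for q q'
      by (rule vi_lip[OF that Y(1) Y(1) vi[OF that(1) Y(1) Y(1) Y(2)] vi[OF that(2) Y(1) Y(1) Y(2)]])
        (use that in auto)
    have "\<kappa> * norm (Y qb - 0) \<le> L * norm (qb - qb)"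
      by (rule vi_lip[OF \<open>qb \<in> Q\<close> \<open>qb \<in> Q\<close> Y(1) S(3) vi[OF \<open>qb \<in> Q\<close> Y(1) S(3) Y(2)]])
        (use \<open>qb \<in> Q\<close> crit in auto)
    then show "Y qb = 0" using \<open>0 < \<kappa>\<close> by (simp add: mult_le_0_iff)
  qed (use Y in auto)
qed

lemma positive_definite_on_subspace:
  fixes B :: "'a::euclidean_space \<Rightarrow> 'a \<Rightarrow> real"
  assumes B: "bounded_bilinear B" and U: "subspace U" and pos: "\<And>u. u \<in> U \<Longrightarrow> u \<noteq> 0 \<Longrightarrow> 0 < B u u"
  obtains \<kappa> where "0 < \<kappa>" "\<And>u. u \<in> U \<Longrightarrow> \<kappa> * (norm u)\<^sup>2 \<le> B u u"
proof (cases "U \<inter> sphere 0 1 = {}")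
  case True
  have "u = 0" if "u \<in> U" for u
  proof (rule ccontr)
    assume "u \<noteq> 0"
    then have "(1 / norm u) *\<^sub>R u \<in> U \<inter> sphere 0 1" using that U by (auto simp: subspace_scale)
    with True show False by blast
  qed
  then show thesis using that[of 1] bounded_bilinear.zero_left[OF B] by fastforce
next
  case False
  have "compact (U \<inter> sphere 0 1)"
    by (intro closed_Int_compact closed_subspace U compact_sphere)
  moreover have "continuous_on (U \<inter> sphere 0 1) (\<lambda>u. B u u)"
    by (intro bounded_bilinear.continuous_on[OF B] continuous_on_id)
  ultimately obtain u0 where u0: "u0 \<in> U \<inter> sphere 0 1" "\<And>u. u \<in> U \<inter> sphere 0 1 \<Longrightarrow> B u0 u0 \<le> B u u"
    using continuous_attains_inf[OF _ False] by meson
  show thesis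
  proof (rule that[of "B u0 u0"])
    show "0 < B u0 u0" using u0(1) by (intro pos) auto
    show "B u0 u0 * (norm u)\<^sup>2 \<le> B u u" if "u \<in> U" for u
    proof (cases "u = 0")
      case True then show ?thesis by (simp add: bounded_bilinear.zero_left[OF B])
    next
      case False
      have "B u0 u0 \<le> B ((1 / norm u) *\<^sub>R u) ((1 / norm u) *\<^sub>R u)"
        using that U False by (intro u0(2)) (auto simp: subspace_scale)
      also have "\<dots> = B u u / (norm u)\<^sup>2"
        by (simp add: bounded_bilinear.scaleR_left[OF B] bounded_bilinear.scaleR_right[OF B] power2_eq_square)
      finally show ?thesis using False by (simp add: field_simps)
    qed
  qed
qed

subsection \<open>The straightened problem\<close>

text \<open>The problem seen through the change of variable: \<open>f\<close> stands for the
  Lagrangian up to a constant, \<open>C\<close> for the zero set of the penalty \<open>g\<close>,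
  and \<open>U\<close> for the subspace of SSOSC. The bound \<open>g_error\<close> is the exact
  penalty property, and \<open>repr\<close> ties \<open>\<phi>\<close> to these data near the
  reference point.\<close>

locale reduced_composite =
  fixes \<phi> :: "'a::euclidean_space \<times> 'b::euclidean_space \<Rightarrow> ereal"
    and f :: "'a \<times> 'b \<Rightarrow> real" and f' :: "'a \<times> 'b \<Rightarrow> ('a \<times> 'b) \<Rightarrow>\<^sub>L real"
    and f'' :: "'a \<times> 'b \<Rightarrow> ('a \<times> 'b) \<Rightarrow>\<^sub>L ('a \<times> 'b) \<Rightarrow>\<^sub>L real"
    and \<psi> :: "'a \<times> 'b \<Rightarrow> 'a" and \<psi>' :: "'a \<times> 'b \<Rightarrow> ('a \<times> 'b) \<Rightarrow>\<^sub>L 'a"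
    and \<psi>'' :: "'a \<times> 'b \<Rightarrow> ('a \<times> 'b) \<Rightarrow>\<^sub>L ('a \<times> 'b) \<Rightarrow>\<^sub>L 'a"
    and g :: "'a \<Rightarrow> ereal" and C U :: "'a set" and c :: real and xb vb :: 'a and wb :: 'b
  assumes df: "\<And>p. (f has_derivative blinfun_apply (f' p)) (at p)"
    and d2f: "\<And>p. (f' has_derivative blinfun_apply (f'' p)) (at p)"
    and cf: "continuous_on UNIV f''"
    and d\<psi>: "\<And>p. (\<psi> has_derivative blinfun_apply (\<psi>' p)) (at p)"
    and d2\<psi>: "\<And>p. (\<psi>' has_derivative blinfun_apply (\<psi>'' p)) (at p)"
    and c\<psi>: "continuous_on UNIV \<psi>''"
    and \<psi>_base: "\<psi> (xb, wb) = 0" and \<psi>'_base: "\<psi>' (xb, wb) o\<^sub>L inl_blinfun = id_blinfun"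
    and crit: "f' (xb, wb) o\<^sub>L inl_blinfun = blinfun_inner_right vb"
    and C: "closed C" "convex C" "cone C" "0 \<in> C" and U: "subspace U" "C \<subseteq> U"
    and c: "0 < c" and g_C: "\<And>y. y \<in> C \<Longrightarrow> g y = 0"
    and g_error: "\<And>y. ereal (c * norm (y - closest_point C y)) \<le> g y"
    and repr: "\<forall>\<^sub>F p in nhds (xb, wb). \<phi> p = ereal (f p) + g (\<psi> p)"
begin

definition curv :: "'a \<Rightarrow> 'a \<Rightarrow> real" where
  "curv k l = f'' (xb, wb) (k, 0) (l, 0)"

lemma curv_bound: "\<bar>curv k l\<bar> \<le> norm (f'' (xb, wb)) * norm k * norm l"
proof -
  have "\<bar>curv k l\<bar> \<le> norm (f'' (xb, wb) (k, 0)) * norm l"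
    using norm_blinfun[of "f'' (xb, wb) (k, 0)" "(l, 0)"] by (simp add: curv_def norm_Pair)
  also have "\<dots> \<le> (norm (f'' (xb, wb)) * norm k) * norm l"
    using norm_blinfun[of "f'' (xb, wb)" "(k, 0)"] by (intro mult_right_mono) (simp_all add: norm_Pair)
  finally show ?thesis .
qed

lemma bilinear_curv: "bounded_bilinear curv"
proof
  have pair: "(x + y, 0::'b) = (x, 0) + (y, 0)" "(r *\<^sub>R x, 0::'b) = r *\<^sub>R (x, 0)" for x y :: 'a and r
    by simp_all
  show "curv (a + a') b = curv a b + curv a' b" for a a' b
    unfolding curv_def pair by (simp only: blinfun.add_right blinfun.add_left)
  show "curv a (b + b') = curv a b + curv a b'" for a b b'
    unfolding curv_def pair by (simp only: blinfun.add_right blinfun.add_left)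
  show "curv (r *\<^sub>R a) b = r *\<^sub>R curv a b" for a b r
    unfolding curv_def pair by (simp only: blinfun.scaleR_right blinfun.scaleR_left)
  show "curv a (r *\<^sub>R b) = r *\<^sub>R curv a b" for a b r
    unfolding curv_def pair by (simp only: blinfun.scaleR_right blinfun.scaleR_left)
  show "\<exists>K. \<forall>a b. norm (curv a b) \<le> norm a * norm b * K"
    using curv_bound by (intro exI[of _ "norm (f'' (xb, wb))"]) (simp add: ac_simps)
qed

text \<open>\<open>0\<close> is its own projection and projections are nonexpansive. Thus projecting
  onto \<open>C\<close> does not leave the ball around \<open>0\<close> on which the estimates
  hold.\<close>

lemma norm_closest_point_le: "norm (closest_point C y) \<le> norm y"
proof -
  have "dist (closest_point C y) (closest_point C 0) \<le> dist y 0"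
    using C by (intro closest_point_lipschitz) auto
  then show ?thesis using closest_point_self[OF C(4)] by simp
qed

end

lemma norm_blinfun_inl: "norm (blinfun_apply F (k, 0)) \<le> norm F * norm k"
  using norm_blinfun[of F "(k, 0)"] by (simp add: norm_Pair)

lemma norm_Pair_le_add: "norm (a, b) \<le> norm a + norm b"
  unfolding norm_Pair by (rule sqrt_sum_squares_le_sum) auto

text \<open>In the monotonicity estimate the form is evaluated at two different perturbations of one
  increment: the difference of \<open>X\<close> and the value of its derivative. Replacing the first
  costs \<open>2 * M * e\<close>, because \<open>k2\<close> may have twice the length of
  \<open>k\<close>; replacing the second costs \<open>M * e\<close>.\<close>

lemma perturbed_form_lower_bound:
  fixes B :: "'a::real_normed_vector \<Rightarrow> 'a \<Rightarrow> real"
  assumes B: "bounded_bilinear B" and bd: "\<And>k l. \<bar>B k l\<bar> \<le> M * norm k * norm l" and "0 \<le> M"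
    and "norm (k1 - k) \<le> e * norm k" "norm (k2 - k) \<le> e * norm k" "0 \<le> e" "e \<le> 1"
  shows "B k k - 3 * M * e * (norm k)\<^sup>2 \<le> B k1 k2"
proof -
  have k2: "norm k2 \<le> 2 * norm k"
  proof -
    have "norm k2 \<le> norm (k2 - k) + norm k" using norm_triangle_sub[of k2 k] by simp
    also have "\<dots> \<le> e * norm k + norm k" using assms(5) by simp
    also have "\<dots> \<le> 1 * norm k + norm k" using assms(7) by (intro add_right_mono mult_right_mono) auto
    finally show ?thesis by simp
  qed
  have "\<bar>B (k1 - k) k2\<bar> \<le> M * norm (k1 - k) * norm k2" by (rule bd)
  also have "\<dots> \<le> M * (e * norm k) * (2 * norm k)"
    using assms k2 by (intro mult_mono) auto
  finally have 1: "\<bar>B (k1 - k) k2\<bar> \<le> 2 * M * e * (norm k)\<^sup>2" by (simp add: power2_eq_square ac_simps)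
  have "\<bar>B k (k2 - k)\<bar> \<le> M * norm k * norm (k2 - k)" by (rule bd)
  also have "\<dots> \<le> M * norm k * (e * norm k)"
    using assms by (intro mult_mono) auto
  finally have 2: "\<bar>B k (k2 - k)\<bar> \<le> M * e * (norm k)\<^sup>2" by (simp add: power2_eq_square ac_simps)
  have "B k1 k2 = B k k + B (k1 - k) k2 + B k (k2 - k)"
    by (simp add: bounded_bilinear.diff_left[OF B] bounded_bilinear.diff_right[OF B])
  then show ?thesis using 1 2 by (simp add: algebra_simps)
qed

section \<open>Strong monotonicity of the gradient in the straightened variable\<close>

context reduced_composite
begin

text \<open>The gradient in \<open>y\<close> is \<open>N\<close> composed with \<open>X'\<close>,
  where \<open>N\<close> is the \<open>x\<close>-gradient of \<open>f\<close> minus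
  \<open>v\<close>. Its increment splits into the increment of \<open>N\<close>, which reproduces
  \<open>curv\<close> up to small errors, and \<open>N\<close> times the increment of
  \<open>X'\<close>, which is small because \<open>N\<close> vanishes at the reference point and
  \<open>X'\<close> is Lipschitz. The bound \<open>c / 2\<close> on the gradient keeps half of the
  penalty slope \<open>c\<close> in reserve.\<close>

lemma straightened_gradient:
  assumes pos: "\<And>u. u \<in> U \<Longrightarrow> u \<noteq> 0 \<Longrightarrow> 0 < curv u u"
  obtains X and Dh :: "'a \<Rightarrow> 'b \<times> 'a \<Rightarrow> 'a \<Rightarrow>\<^sub>L real" and \<rho> L \<kappa> \<gamma> where
    "0 < \<rho>" "0 \<le> L" "0 < \<kappa>" "0 < \<gamma>" "X (0, wb) = xb"
    "\<And>y w v. y \<in> cball 0 \<rho> \<Longrightarrow> w \<in> ball wb \<rho> \<Longrightarrow> v \<in> ball vb \<rho> \<Longrightarrow>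
      ((\<lambda>y. f (X (y, w), w) - v \<bullet> X (y, w)) has_derivative blinfun_apply (Dh y (w, v))) (at y)"
    "\<And>x y w v. x \<in> cball 0 \<rho> \<Longrightarrow> y \<in> cball 0 \<rho> \<Longrightarrow> w \<in> ball wb \<rho> \<Longrightarrow> v \<in> ball vb \<rho> \<Longrightarrow>
      x \<in> U \<Longrightarrow> y \<in> U \<Longrightarrow> \<kappa> * (norm (x - y))\<^sup>2 \<le> (Dh x (w, v) - Dh y (w, v)) (x - y)"
    "\<And>y q q'. y \<in> cball 0 \<rho> \<Longrightarrow> q \<in> ball wb \<rho> \<times> ball vb \<rho> \<Longrightarrow> q' \<in> ball wb \<rho> \<times> ball vb \<rho> \<Longrightarrow>
      norm (Dh y q - Dh y q') \<le> L * norm (q - q')"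
    "Dh 0 (wb, vb) = 0"
    "\<And>y w v. y \<in> cball 0 \<rho> \<Longrightarrow> w \<in> ball wb \<rho> \<Longrightarrow> v \<in> ball vb \<rho> \<Longrightarrow> norm (Dh y (w, v)) \<le> c / 2"
    "\<And>u u'. u \<in> cball 0 \<rho> \<times> ball wb \<rho> \<Longrightarrow> u' \<in> cball 0 \<rho> \<times> ball wb \<rho> \<Longrightarrow>
      norm (X u - X u') \<le> L * norm (u - u')"
    "\<And>u u'. u \<in> cball 0 \<rho> \<times> ball wb \<rho> \<Longrightarrow> u' \<in> cball 0 \<rho> \<times> ball wb \<rho> \<Longrightarrow>
      norm (f (X u, snd u) - f (X u', snd u')) \<le> L * norm (u - u')"
    "\<And>y w. y \<in> cball 0 \<rho> \<Longrightarrow> w \<in> ball wb \<rho> \<Longrightarrow> \<phi> (X (y, w), w) = ereal (f (X (y, w), w)) + g y"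
    "\<And>x w. x \<in> ball xb \<gamma> \<Longrightarrow> w \<in> ball wb \<gamma> \<Longrightarrow> norm (\<psi> (x, w)) \<le> \<rho> \<and> X (\<psi> (x, w), w) = x"
proof -
  define p0 where "p0 = (xb, wb)"
  define u0 where "u0 = (0::'a, wb)"
  obtain \<kappa>0 where \<kappa>0: "0 < \<kappa>0" "\<And>u. u \<in> U \<Longrightarrow> \<kappa>0 * (norm u)\<^sup>2 \<le> curv u u"
    using positive_definite_on_subspace[OF bilinear_curv U(1) pos] by blast
  obtain X X' r \<gamma> L where r: "0 < r" and "0 < \<gamma>" and L: "0 \<le> L"
    and \<psi>X: "\<And>u. u \<in> ball (0, wb) r \<Longrightarrow> \<psi> (X u, snd u) = fst u"
    and X_lip: "\<And>u v. u \<in> ball (0, wb) r \<Longrightarrow> v \<in> ball (0, wb) r \<Longrightarrow> norm (X u - X v) \<le> L * norm (u - v)"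
    and dX: "\<And>y w. (y, w) \<in> ball (0, wb) r \<Longrightarrow> ((\<lambda>y. X (y, w)) has_derivative blinfun_apply (X' (y, w))) (at y)"
    and X'_lip: "\<And>u v. u \<in> ball (0, wb) r \<Longrightarrow> v \<in> ball (0, wb) r \<Longrightarrow> norm (X' u - X' v) \<le> L * norm (u - v)"
    and X'0: "X' (0, wb) = id_blinfun" and X0: "X (0, wb) = xb"
    and X\<psi>: "\<And>x w. x \<in> ball xb \<gamma> \<Longrightarrow> w \<in> ball wb \<gamma> \<Longrightarrow>
        (\<psi> (x, w), w) \<in> ball (0, wb) r \<and> X (\<psi> (x, w), w) = x"
    apply (rule parametric_inverse[OF d\<psi> d2\<psi> c\<psi> \<psi>_base \<psi>'_base])
    subgoal premises prems by (rule prems(1)[OF prems(2-)])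
    done
  define M where "M = norm (f'' p0)"
  have M: "0 \<le> M" by (simp add: M_def)
  \<comment> \<open>The entry 1 allows \<open>perturbed_form_lower_bound\<close>,
    \<open>c / 8\<close> yields the bound \<open>c / 2\<close> for \<open>Dh\<close>, and the last
    entry keeps the sum of the errors \<open>3 * M * e\<close>, \<open>4 * e\<close> and
    \<open>L * e\<close> at most \<open>\<kappa>0 / 2\<close>.\<close>
  define e where "e = Min {1, c / 8, \<kappa>0 / (2 * (3 * M + 4 + L))}"
  have e: "0 < e" "e \<le> 1" "e \<le> c / 8" "e \<le> \<kappa>0 / (2 * (3 * M + 4 + L))"
  proof -
    show "0 < e" using c \<kappa>0(1) M L by (simp add: e_def)
  qed (unfold e_def; rule Min_le; simp)+
  have eK: "e * (3 * M + 4 + L) \<le> \<kappa>0 / 2"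
    using e(4) M L by (simp add: field_simps)
  obtain rf where rf: "0 < rf" "\<And>p q. p \<in> ball p0 rf \<Longrightarrow> q \<in> ball p0 rf \<Longrightarrow>
      norm (f' p - f' q - f'' p0 (p - q)) \<le> e * norm (p - q)"
  proof -
    have "isCont f'' p0" using cf continuous_on_eq_continuous_at by blast
    from strict_derivative_bound[of f' f'' p0, OF d2f this e(1)] show thesis using that by blast
  qed
  have f'_lip: "norm (f' p - f' q) \<le> (M + 1) * norm (p - q)" if "p \<in> ball p0 rf" "q \<in> ball p0 rf" for p q
  proof -
    have "norm (f' p - f' q) \<le> norm (f' p - f' q - f'' p0 (p - q)) + norm (f'' p0 (p - q))"
      using norm_triangle_sub[of "f' p - f' q" "f'' p0 (p - q)"] by (simp add: add.commute)
    also have "\<dots> \<le> 1 * norm (p - q) + M * norm (p - q)"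
    proof (rule add_mono)
      show "norm (f' p - f' q - f'' p0 (p - q)) \<le> 1 * norm (p - q)"
        using rf(2)[OF that] e(2) by (meson mult_right_mono norm_ge_zero order_trans)
    qed (simp add: M_def norm_blinfun)
    finally show ?thesis by (simp add: algebra_simps)
  qed
  obtain rg where rg: "0 < rg" "\<And>p q. p \<in> ball p0 rg \<Longrightarrow> q \<in> ball p0 rg \<Longrightarrow>
      norm (f p - f q) \<le> (1 + norm (f' p0)) * norm (p - q)"
  proof -
    have "isCont f' p0" using d2f has_derivative_continuous by blast
    from strict_derivative_bound[of f f' p0, OF df this zero_less_one]
    obtain rg where rg: "0 < rg" "\<And>p q. p \<in> ball p0 rg \<Longrightarrow> q \<in> ball p0 rg \<Longrightarrow>
      norm (f p - f q - f' p0 (p - q)) \<le> 1 * norm (p - q)" by blast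
    have "norm (f p - f q) \<le> (1 + norm (f' p0)) * norm (p - q)" if "p \<in> ball p0 rg" "q \<in> ball p0 rg" for p q
      using rg(2)[OF that] norm_blinfun[of "f' p0" "p - q"]
        norm_triangle_ineq2[of "f p - f q" "f' p0 (p - q)"] by (simp add: algebra_simps)
    with rg(1) show thesis by (rule that)
  qed
  obtain rp where rp: "0 < rp" "\<And>p. p \<in> ball p0 rp \<Longrightarrow> \<phi> p = ereal (f p) + g (\<psi> p)"
    using repr unfolding eventually_nhds_metric p0_def by (metis dist_commute mem_ball)
  define H where "H = (M + 1) * (L + 1) + 1"
  have H: "1 \<le> H" using M L by (simp add: H_def)
  \<comment> \<open>The map \<open>P\<close> below has Lipschitz constant \<open>L + 1\<close>, so
    the divided radii make it land in the balls around \<open>p0\<close> on which \<open>f\<close>,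
    \<open>f'\<close> and \<open>\<phi>\<close> are controlled. The last two entries bound the
    deviation of \<open>X'\<close> from the identity and the norm of \<open>N\<close> by
    \<open>e\<close>.\<close>
  define r0 where "r0 = Min {r, rf / (L + 1), rg / (L + 1), rp / (L + 1), e / (L + 1), e / H}"
  have r0: "0 < r0" "r0 \<le> r" "r0 \<le> rf / (L + 1)" "r0 \<le> rg / (L + 1)" "r0 \<le> rp / (L + 1)"
    "r0 \<le> e / (L + 1)" "r0 \<le> e / H"
  proof -
    show "0 < r0" using r rf(1) rg(1) rp(1) e(1) L H by (simp add: r0_def)
  qed (unfold r0_def; rule Min_le; simp)+
  have r0': "(L + 1) * r0 \<le> rf" "(L + 1) * r0 \<le> rg" "(L + 1) * r0 \<le> rp" "L * r0 \<le> e" "H * r0 \<le> e"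
    using r0 L H by (simp_all add: field_simps)
  define P where "P = (\<lambda>u. (X u, snd u))"
  have sub: "u \<in> ball (0, wb) r" if "u \<in> ball u0 r0" for u
    using that r0(2) by (simp add: u0_def)
  have P_lip: "norm (P u - P v) \<le> (L + 1) * norm (u - v)" if "u \<in> ball u0 r0" "v \<in> ball u0 r0" for u v
  proof -
    have "norm (P u - P v) \<le> norm (X u - X v) + norm (snd (u - v))"
      using norm_Pair_le_add[of "X u - X v" "snd u - snd v"] by (simp add: P_def)
    also have "\<dots> \<le> L * norm (u - v) + norm (u - v)"
      using X_lip[OF sub[OF that(1)] sub[OF that(2)]] norm_snd_le[of "snd (u - v)" "fst (u - v)"]
      unfolding prod.collapse by linarith
    finally show ?thesis by (simp add: algebra_simps)
  qed
  have P0: "P u0 = p0" by (simp add: P_def u0_def p0_def X0)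
  have u00: "u0 \<in> ball u0 r0" using r0 by simp
  have Pball: "P u \<in> ball p0 ((L + 1) * r0)" if "u \<in> ball u0 r0" for u
  proof -
    have "norm (P u - p0) \<le> (L + 1) * norm (u - u0)" using P_lip[OF that u00] P0 by simp
    also have "\<dots> < (L + 1) * r0"
      using that L by (intro mult_strict_left_mono) (auto simp: dist_norm norm_minus_commute)
    finally show ?thesis by (simp add: dist_norm norm_minus_commute)
  qed
  have Prf: "P u \<in> ball p0 rf" "P u \<in> ball p0 rg" "P u \<in> ball p0 rp" if "u \<in> ball u0 r0" for u
    using Pball[OF that] r0'(1-3) by auto
  define N where "N = (\<lambda>u v. (f' (P u) o\<^sub>L inl_blinfun) - blinfun_inner_right v)"
  have Nk: "N u v k = f' (P u) (k, 0) - v \<bullet> k" for u v k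
    by (simp add: N_def blinfun.diff_left)
  have N0: "N u0 vb = 0" using crit P0 by (simp add: N_def p0_def)
  have N_lip: "norm (N u v - N u' v') \<le> (M + 1) * (L + 1) * norm (u - u') + norm (v - v')"
    if "u \<in> ball u0 r0" "u' \<in> ball u0 r0" for u u' v v'
  proof (rule norm_blinfun_bound)
    fix k
    have a: "norm (f' (P u) - f' (P u')) \<le> (M + 1) * ((L + 1) * norm (u - u'))"
      using M by (intro order_trans[OF f'_lip mult_left_mono[OF P_lip]] Prf that) simp
    have "norm ((f' (P u) - f' (P u')) (k, 0)) \<le> ((M + 1) * (L + 1) * norm (u - u')) * norm k"
      using order_trans[OF norm_blinfun_inl mult_right_mono[OF a norm_ge_zero]] by (simp add: mult.assoc)
    moreover have "norm ((v - v') \<bullet> k) \<le> norm (v - v') * norm k"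
      by (simp add: Cauchy_Schwarz_ineq2)
    moreover have "(N u v - N u' v') k = (f' (P u) - f' (P u')) (k, 0) - (v - v') \<bullet> k"
      by (simp add: blinfun.diff_left Nk inner_diff_left)
    ultimately show "norm ((N u v - N u' v') k) \<le> ((M + 1) * (L + 1) * norm (u - u') + norm (v - v')) * norm k"
      using norm_triangle_ineq4[of "(f' (P u) - f' (P u')) (k, 0)" "(v - v') \<bullet> k"]
      by (simp add: distrib_right)
  qed (use M L in simp)
  have N_small: "norm (N u v) \<le> e" if "u \<in> ball u0 r0" "v \<in> ball vb r0" for u v
  proof -
    have "norm (N u v) \<le> (M + 1) * (L + 1) * norm (u - u0) + norm (v - vb)"
      using N_lip[OF that(1) u00, of v vb] N0 by simp
    also have "\<dots> \<le> (M + 1) * (L + 1) * r0 + r0"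
      using that M L by (intro add_mono mult_left_mono) (auto simp: dist_norm norm_minus_commute)
    also have "\<dots> = H * r0" by (simp add: H_def algebra_simps)
    finally show ?thesis using r0' by simp
  qed
  have X'_id: "norm (X' u - id_blinfun) \<le> e" if "u \<in> ball u0 r0" for u
  proof -
    have "norm (X' u - id_blinfun) \<le> L * norm (u - u0)"
      using X'_lip[OF sub[OF that] sub[OF u00]] X'0 by (simp add: u0_def)
    also have "\<dots> \<le> L * r0" using that L by (intro mult_left_mono) (auto simp: dist_norm norm_minus_commute)
    finally show ?thesis using r0' by simp
  qed
  have X'_bd: "norm (X' u) \<le> 2" if "u \<in> ball u0 r0" for u
    using X'_id[OF that] e(2) norm_triangle_sub[of "X' u" id_blinfun] norm_blinfun_id_le[where 'a='a] by linarith
  define Dh where "Dh = (\<lambda>y (w, v). N (y, w) v o\<^sub>L X' (y, w))"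
  \<comment> \<open>Half of \<open>r0\<close>, since the norm of a pair is estimated by the sum of
    the norms.\<close>
  define \<rho> where "\<rho> = r0 / 2"
  have \<rho>: "0 < \<rho>" "\<rho> < r0" using r0 by (auto simp: \<rho>_def)
  have in_ball: "(y, w) \<in> ball u0 r0" if "y \<in> cball 0 \<rho>" "w \<in> ball wb \<rho>" for y w
  proof -
    have "norm ((y, w) - u0) \<le> norm y + norm (w - wb)"
      using norm_Pair_le_add[of y "w - wb"] by (simp add: u0_def)
    also have "\<dots> < r0" using that by (simp add: \<rho>_def dist_norm norm_minus_commute)
    finally show ?thesis by (simp add: dist_norm norm_minus_commute)
  qed
  \<comment> \<open>One constant for three estimates: for \<open>X\<close>; for \<open>Dh\<close>,
    with \<open>2 * H\<close> from \<open>N\<close> where \<open>norm X' \<le> 2\<close> and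
    \<open>L\<close> from \<open>X'\<close> where \<open>norm N \<le> 1\<close>; and for
    \<open>f\<close> along \<open>P\<close>.\<close>
  define L' where "L' = Max {L, 2 * H + L, (1 + norm (f' p0)) * (L + 1)}"
  have L': "0 \<le> L'" "L \<le> L'" "2 * H + L \<le> L'" "(1 + norm (f' p0)) * (L + 1) \<le> L'"
    using L by (auto simp: L'_def max_def)
  have "isCont \<psi> p0" using d\<psi> has_derivative_continuous by blast
  then obtain d1 where d1: "0 < d1" "\<And>p. dist p p0 < d1 \<Longrightarrow> dist (\<psi> p) 0 < \<rho>"
    using \<rho> \<psi>_base p0_def unfolding continuous_at_eps_delta by metis
  define \<gamma>' where "\<gamma>' = min \<gamma> (d1 / 2)"
  show thesis
  proof (rule that[of \<rho> L' "\<kappa>0 / 2" \<gamma>' X Dh])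
    show "0 < \<gamma>'" using \<open>0 < \<gamma>\<close> d1 by (simp add: \<gamma>'_def)
    show "((\<lambda>y. f (X (y, w), w) - v \<bullet> X (y, w)) has_derivative blinfun_apply (Dh y (w, v))) (at y)"
      if "y \<in> cball 0 \<rho>" "w \<in> ball wb \<rho>" "v \<in> ball vb \<rho>" for y w v
    proof -
      have u: "(y, w) \<in> ball u0 r0" by (rule in_ball[OF that(1,2)])
      note d = dX[OF sub[OF u]]
      have "((\<lambda>y. f (X (y, w), w)) has_derivative (\<lambda>k. f' (X (y, w), w) (X' (y, w) k, 0))) (at y)"
        using diff_chain_at[OF d has_derivative_partial_fst[OF df]]
        by (simp add: o_def)
      then have "((\<lambda>y. f (X (y, w), w) - v \<bullet> X (y, w)) has_derivative
          (\<lambda>k. f' (X (y, w), w) (X' (y, w) k, 0) - v \<bullet> X' (y, w) k)) (at y)"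
        by (intro has_derivative_diff has_derivative_inner_right d)
      moreover have "blinfun_apply (Dh y (w, v)) = (\<lambda>k. f' (X (y, w), w) (X' (y, w) k, 0) - v \<bullet> X' (y, w) k)"
        by (simp add: Dh_def fun_eq_iff Nk P_def)
      ultimately show ?thesis by simp
    qed
    show "\<kappa>0 / 2 * (norm (x - y))\<^sup>2 \<le> (Dh x (w, v) - Dh y (w, v)) (x - y)"
      if "x \<in> cball 0 \<rho>" "y \<in> cball 0 \<rho>" "w \<in> ball wb \<rho>" "v \<in> ball vb \<rho>" "x \<in> U" "y \<in> U" for x y w v
    proof -
      define k where "k = x - y"
      define k1 where "k1 = X (x, w) - X (y, w)"
      define k2 where "k2 = X' (x, w) k"
      have ux: "(x, w) \<in> ball u0 r0" and uy: "(y, w) \<in> ball u0 r0"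
        by (rule in_ball[OF that(1,3)], rule in_ball[OF that(2,3)])
      have k2: "norm (k2 - k) \<le> e * norm k"
      proof -
        have "norm (k2 - k) = norm ((X' (x, w) - id_blinfun) k)" by (simp add: k2_def blinfun.diff_left)
        also have "\<dots> \<le> norm (X' (x, w) - id_blinfun) * norm k" by (rule norm_blinfun)
        also have "\<dots> \<le> e * norm k" by (intro mult_right_mono X'_id[OF ux]) simp
        finally show ?thesis .
      qed
      have k1: "norm (k1 - k) \<le> e * norm k"
      proof -
        have "norm ((X (x, w) - x) - (X (y, w) - y)) \<le> e * norm (x - y)"
        proof (rule differentiable_bound[of "cball 0 \<rho>" "\<lambda>y. X (y, w) - y"
              "\<lambda>z. blinfun_apply (X' (z, w) - id_blinfun)" e x y])
          fix z assume z: "z \<in> cball (0::'a) \<rho>"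
          note uz = in_ball[OF z that(3)]
          show "((\<lambda>y. X (y, w) - y) has_derivative blinfun_apply (X' (z, w) - id_blinfun)) (at z within cball 0 \<rho>)"
            using has_derivative_at_withinI[OF has_derivative_diff[OF dX[OF sub[OF uz]] has_derivative_ident]]
            by (simp add: minus_blinfun.rep_eq)
          show "onorm (blinfun_apply (X' (z, w) - id_blinfun)) \<le> e"
            using X'_id[OF uz] by (simp add: norm_blinfun.rep_eq)
        qed (use that in simp_all)
        then show ?thesis by (simp add: k1_def k_def algebra_simps)
      qed
      have nk1: "norm k1 \<le> 2 * norm k" "norm k2 \<le> 2 * norm k"
        using k1 k2 norm_triangle_sub[of k1 k] norm_triangle_sub[of k2 k] mult_right_mono[OF e(2), of "norm k"] by simp_all
      \<comment> \<open>The tilt \<open>v\<close> cancels, and as \<open>w\<close> is the same at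
        both points the increment of \<open>P\<close> is \<open>(k1, 0)\<close>; hence
        \<open>f'' p0\<close> contributes \<open>curv k1 k2\<close>.\<close>
      have "(N (x, w) v - N (y, w) v) k2 = (f' (P (x, w)) - f' (P (y, w))) (k2, 0)"
        by (simp add: blinfun.diff_left Nk)
      also have "\<dots> = (f' (P (x, w)) - f' (P (y, w)) - f'' p0 (P (x, w) - P (y, w))) (k2, 0) + curv k1 k2"
        by (simp add: blinfun.diff_left curv_def P_def k1_def p0_def)
      finally have t1: "(N (x, w) v - N (y, w) v) k2 = \<dots>" .
      have "norm ((f' (P (x, w)) - f' (P (y, w)) - f'' p0 (P (x, w) - P (y, w))) (k2, 0))
          \<le> norm (f' (P (x, w)) - f' (P (y, w)) - f'' p0 (P (x, w) - P (y, w))) * norm k2"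
        by (rule norm_blinfun_inl)
      also have "\<dots> \<le> (e * norm k1) * norm k2"
        using rf(2)[OF Prf(1)[OF ux] Prf(1)[OF uy]]
        by (intro mult_right_mono) (simp_all add: P_def k1_def norm_Pair)
      also have "\<dots> \<le> (e * (2 * norm k)) * (2 * norm k)"
        using nk1 e by (intro mult_mono) auto
      finally have t2: "norm ((f' (P (x, w)) - f' (P (y, w)) - f'' p0 (P (x, w) - P (y, w))) (k2, 0))
          \<le> 4 * e * (norm k)\<^sup>2" by (simp add: power2_eq_square)
      have t3: "curv k k - 3 * M * e * (norm k)\<^sup>2 \<le> curv k1 k2"
        using e M by (intro perturbed_form_lower_bound[OF bilinear_curv curv_bound[folded p0_def, folded M_def]] k1 k2) simp_all
      have "norm (N (y, w) v ((X' (x, w) - X' (y, w)) k)) \<le> norm (N (y, w) v) * norm ((X' (x, w) - X' (y, w)) k)"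
        by (rule norm_blinfun)
      also have "\<dots> \<le> e * ((L * norm k) * norm k)"
      proof (intro mult_mono)
        show "norm (N (y, w) v) \<le> e" using that(4) \<rho> by (intro N_small[OF uy]) auto
        have "norm (X' (x, w) - X' (y, w)) \<le> L * norm k"
          using X'_lip[OF sub[OF ux] sub[OF uy]] by (simp add: k_def norm_Pair)
        then show "norm ((X' (x, w) - X' (y, w)) k) \<le> (L * norm k) * norm k"
          using norm_blinfun[of "X' (x, w) - X' (y, w)" k] by (meson mult_right_mono norm_ge_zero order_trans)
      qed (use e in auto)
      finally have t4: "norm (N (y, w) v ((X' (x, w) - X' (y, w)) k)) \<le> L * e * (norm k)\<^sup>2"
        by (simp add: power2_eq_square ac_simps)
      have "(Dh x (w, v) - Dh y (w, v)) k = (N (x, w) v - N (y, w) v) k2 + N (y, w) v ((X' (x, w) - X' (y, w)) k)"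
        by (simp add: Dh_def k2_def blinfun.diff_left blinfun.diff_right)
      moreover have "\<kappa>0 * (norm k)\<^sup>2 \<le> curv k k"
        using that U by (intro \<kappa>0(2)) (simp add: k_def subspace_diff)
      moreover have "e * (3 * M + 4 + L) * (norm k)\<^sup>2 \<le> \<kappa>0 / 2 * (norm k)\<^sup>2"
        by (intro mult_right_mono eK) simp
      moreover have "e * (3 * M + 4 + L) * (norm k)\<^sup>2 = 3 * M * e * (norm k)\<^sup>2 + 4 * e * (norm k)\<^sup>2 + L * e * (norm k)\<^sup>2"
        by (simp add: algebra_simps)
      ultimately show ?thesis using t1 t2 t3 t4 unfolding k_def[symmetric] real_norm_def by linarith
    qed
    show "norm (Dh y q - Dh y q') \<le> L' * norm (q - q')"
      if "y \<in> cball 0 \<rho>" "q \<in> ball wb \<rho> \<times> ball vb \<rho>" "q' \<in> ball wb \<rho> \<times> ball vb \<rho>" for y q q'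
    proof -
      obtain w v w' v' where q: "q = (w, v)" "q' = (w', v')" by fastforce
      have u: "(y, w) \<in> ball u0 r0" and u': "(y, w') \<in> ball u0 r0" and v': "v' \<in> ball vb r0"
        using in_ball[OF that(1), of w] in_ball[OF that(1), of w'] that q \<rho> by simp_all
      have nw: "norm (w - w') \<le> norm (q - q')" "norm (v - v') \<le> norm (q - q')"
        using norm_fst_le[of "w - w'" "v - v'"] norm_snd_le[of "v - v'" "w - w'"] by (simp_all add: q)
      have "Dh y q - Dh y q' = ((N (y, w) v - N (y, w') v') o\<^sub>L X' (y, w)) + (N (y, w') v' o\<^sub>L (X' (y, w) - X' (y, w')))"
        by (rule blinfun_eqI) (simp add: Dh_def q blinfun.diff_left blinfun.diff_right plus_blinfun.rep_eq)
      then have "norm (Dh y q - Dh y q') \<le> norm ((N (y, w) v - N (y, w') v') o\<^sub>L X' (y, w))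
          + norm (N (y, w') v' o\<^sub>L (X' (y, w) - X' (y, w')))"
        by (simp only: norm_triangle_ineq)
      also have "\<dots> \<le> norm (N (y, w) v - N (y, w') v') * norm (X' (y, w))
          + norm (N (y, w') v') * norm (X' (y, w) - X' (y, w'))"
        by (intro add_mono norm_blinfun_compose)
      also have "\<dots> \<le> (H * norm (q - q')) * 2 + 1 * (L * norm (q - q'))"
      proof (intro add_mono mult_mono)
        have "norm (N (y, w) v - N (y, w') v') \<le> (M + 1) * (L + 1) * norm (w - w') + norm (v - v')"
          using N_lip[OF u u', of v v'] by (simp add: norm_Pair)
        also have "\<dots> \<le> (M + 1) * (L + 1) * norm (q - q') + norm (q - q')"
          using nw M L by (intro add_mono mult_left_mono) auto
        finally show "norm (N (y, w) v - N (y, w') v') \<le> H * norm (q - q')" by (simp add: H_def algebra_simps)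
        show "norm (N (y, w') v') \<le> 1" using N_small[OF u' v'] e by simp
        have "norm (X' (y, w) - X' (y, w')) \<le> L * norm (w - w')"
          using X'_lip[OF sub[OF u] sub[OF u']] by (simp add: norm_Pair)
        also have "\<dots> \<le> L * norm (q - q')" using nw L by (intro mult_left_mono) auto
        finally show "norm (X' (y, w) - X' (y, w')) \<le> L * norm (q - q')" .
      qed (use X'_bd[OF u] H in auto)
      also have "\<dots> = (2 * H + L) * norm (q - q')" by (simp add: algebra_simps)
      also have "\<dots> \<le> L' * norm (q - q')" using L' by (intro mult_right_mono) auto
      finally show ?thesis .
    qed
    show "Dh 0 (wb, vb) = 0" using N0 by (simp add: Dh_def u0_def)
    show "norm (Dh y (w, v)) \<le> c / 2" if "y \<in> cball 0 \<rho>" "w \<in> ball wb \<rho>" "v \<in> ball vb \<rho>" for y w v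
    proof -
      have u: "(y, w) \<in> ball u0 r0" by (rule in_ball[OF that(1,2)])
      have "norm (Dh y (w, v)) \<le> norm (N (y, w) v) * norm (X' (y, w))"
        by (simp add: Dh_def norm_blinfun_compose)
      also have "\<dots> \<le> c / 8 * 2"
        using N_small[OF u, of v] e X'_bd[OF u] that(3) \<rho> c by (intro mult_mono) auto
      finally show ?thesis using c by simp
    qed
    show "norm (X u - X u') \<le> L' * norm (u - u')"
      if "u \<in> cball 0 \<rho> \<times> ball wb \<rho>" "u' \<in> cball 0 \<rho> \<times> ball wb \<rho>" for u u'
    proof -
      have "u \<in> ball u0 r0" "u' \<in> ball u0 r0"
        using that in_ball[of "fst u" "snd u"] in_ball[of "fst u'" "snd u'"] by (simp_all add: mem_Times_iff)
      then have "norm (X u - X u') \<le> L * norm (u - u')"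
        by (intro X_lip sub)
      also have "\<dots> \<le> L' * norm (u - u')" using L' by (intro mult_right_mono) auto
      finally show ?thesis .
    qed
    show "norm (f (X u, snd u) - f (X u', snd u')) \<le> L' * norm (u - u')"
      if "u \<in> cball 0 \<rho> \<times> ball wb \<rho>" "u' \<in> cball 0 \<rho> \<times> ball wb \<rho>" for u u'
    proof -
      have u: "u \<in> ball u0 r0" "u' \<in> ball u0 r0"
        using that in_ball[of "fst u" "snd u"] in_ball[of "fst u'" "snd u'"] by (simp_all add: mem_Times_iff)
      have "norm (f (P u) - f (P u')) \<le> (1 + norm (f' p0)) * norm (P u - P u')"
        by (intro rg(2) Prf u)
      also have "\<dots> \<le> (1 + norm (f' p0)) * ((L + 1) * norm (u - u'))"
        by (intro mult_left_mono P_lip u) simp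
      also have "\<dots> = ((1 + norm (f' p0)) * (L + 1)) * norm (u - u')" by simp
      also have "\<dots> \<le> L' * norm (u - u')" by (intro mult_right_mono L') simp
      finally show ?thesis by (simp add: P_def)
    qed
    show "\<phi> (X (y, w), w) = ereal (f (X (y, w), w)) + g y" if "y \<in> cball 0 \<rho>" "w \<in> ball wb \<rho>" for y w
      using rp(2)[OF Prf(3)[OF in_ball[OF that]]] \<psi>X[OF sub[OF in_ball[OF that]]] by (simp add: P_def)
    show "norm (\<psi> (x, w)) \<le> \<rho> \<and> X (\<psi> (x, w), w) = x" if "x \<in> ball xb \<gamma>'" "w \<in> ball wb \<gamma>'" for x w
    proof -
      have "norm ((x, w) - p0) \<le> norm (x - xb) + norm (w - wb)"
        using norm_Pair_le_add[of "x - xb" "w - wb"] by (simp add: p0_def)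
      also have "\<dots> < d1" using that by (simp add: \<gamma>'_def dist_norm norm_minus_commute)
      finally have "dist (\<psi> (x, w)) 0 < \<rho>" by (intro d1) (simp add: dist_norm)
      moreover have "X (\<psi> (x, w), w) = x" using X\<psi>[of x w] that by (simp add: \<gamma>'_def)
      ultimately show ?thesis by simp
    qed
  qed (use L' \<rho> \<kappa>0 X0 in auto)
qed

end

section \<open>Sufficiency: exact penalization over the cone\<close>

context reduced_composite
begin

theorem fully_stable_if_positive_definite:
  assumes pos: "\<And>u. u \<in> U \<Longrightarrow> u \<noteq> 0 \<Longrightarrow> 0 < curv u u"
  shows "fully_stable \<phi> xb wb vb"
proof -
  obtain X and Dh :: "'a \<Rightarrow> 'b \<times> 'a \<Rightarrow> 'a \<Rightarrow>\<^sub>L real" and \<rho> L \<kappa> \<gamma> where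
    \<rho>: "0 < \<rho>" and L: "0 \<le> L" and \<kappa>: "0 < \<kappa>" and \<gamma>: "0 < \<gamma>" and X0: "X (0, wb) = xb"
    and dh: "\<And>y w v. y \<in> cball 0 \<rho> \<Longrightarrow> w \<in> ball wb \<rho> \<Longrightarrow> v \<in> ball vb \<rho> \<Longrightarrow>
      ((\<lambda>y. f (X (y, w), w) - v \<bullet> X (y, w)) has_derivative blinfun_apply (Dh y (w, v))) (at y)"
    and mono: "\<And>x y w v. x \<in> cball 0 \<rho> \<Longrightarrow> y \<in> cball 0 \<rho> \<Longrightarrow> w \<in> ball wb \<rho> \<Longrightarrow> v \<in> ball vb \<rho> \<Longrightarrow>
      x \<in> U \<Longrightarrow> y \<in> U \<Longrightarrow> \<kappa> * (norm (x - y))\<^sup>2 \<le> (Dh x (w, v) - Dh y (w, v)) (x - y)"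
    and lip: "\<And>y q q'. y \<in> cball 0 \<rho> \<Longrightarrow> q \<in> ball wb \<rho> \<times> ball vb \<rho> \<Longrightarrow> q' \<in> ball wb \<rho> \<times> ball vb \<rho> \<Longrightarrow>
      norm (Dh y q - Dh y q') \<le> L * norm (q - q')"
    and Dh0: "Dh 0 (wb, vb) = 0"
    and Dh_small: "\<And>y w v. y \<in> cball 0 \<rho> \<Longrightarrow> w \<in> ball wb \<rho> \<Longrightarrow> v \<in> ball vb \<rho> \<Longrightarrow> norm (Dh y (w, v)) \<le> c / 2"
    and X_lip: "\<And>u u'. u \<in> cball 0 \<rho> \<times> ball wb \<rho> \<Longrightarrow> u' \<in> cball 0 \<rho> \<times> ball wb \<rho> \<Longrightarrow>
      norm (X u - X u') \<le> L * norm (u - u')"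
    and f_lip: "\<And>u u'. u \<in> cball 0 \<rho> \<times> ball wb \<rho> \<Longrightarrow> u' \<in> cball 0 \<rho> \<times> ball wb \<rho> \<Longrightarrow>
      norm (f (X u, snd u) - f (X u', snd u')) \<le> L * norm (u - u')"
    and \<phi>X: "\<And>y w. y \<in> cball 0 \<rho> \<Longrightarrow> w \<in> ball wb \<rho> \<Longrightarrow> \<phi> (X (y, w), w) = ereal (f (X (y, w), w)) + g y"
    and X\<psi>: "\<And>x w. x \<in> ball xb \<gamma> \<Longrightarrow> w \<in> ball wb \<gamma> \<Longrightarrow> norm (\<psi> (x, w)) \<le> \<rho> \<and> X (\<psi> (x, w), w) = x"
    apply (rule straightened_gradient[OF pos], assumption, assumption)
    subgoal premises prems by (rule prems(1)[OF prems(2-)])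
    done
  define Q where "Q = ball wb \<rho> \<times> ball vb \<rho>"
  \<comment> \<open>Truncating \<open>C\<close> supplies compactness for the existence of
    minimizers; projections onto \<open>C\<close> of points of the ball stay in
    \<open>S\<close>.\<close>
  define S where "S = C \<inter> cball 0 \<rho>"
  define h where "h = (\<lambda>y q. f (X (y, fst q), fst q) - snd q \<bullet> X (y, fst q))"
  have S: "y \<in> cball 0 \<rho>" "y \<in> C" "y \<in> U" if "y \<in> S" for y using that U by (auto simp: S_def)
  have q0: "(wb, vb) \<in> Q" using \<rho> by (simp add: Q_def)
  have dh': "((\<lambda>y. h y q) has_derivative blinfun_apply (Dh y q)) (at y)" if "y \<in> cball 0 \<rho>" "q \<in> Q" for y q
    using dh[OF that(1), of "fst q" "snd q"] that(2) by (simp add: h_def Q_def mem_Times_iff)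
  have S1: "compact S" using C by (simp add: S_def closed_Int_compact)
  have S2: "convex S" using C by (simp add: S_def convex_Int)
  have S3: "0 \<in> S" using C \<rho> by (simp add: S_def)
  have S4: "((\<lambda>y. h y q) has_derivative blinfun_apply (Dh y q)) (at y)" if "y \<in> S" "q \<in> Q" for y q
      by (rule dh'[OF S(1)[OF that(1)] that(2)])
  have S5: "\<kappa> * (norm (x - y))\<^sup>2 \<le> (Dh x q - Dh y q) (x - y)" if "x \<in> S" "y \<in> S" "q \<in> Q" for x y q
      using mono[OF S(1)[OF that(1)] S(1)[OF that(2)], of "fst q" "snd q"] S(3)[OF that(1)] S(3)[OF that(2)] that(3)
      by (simp add: Q_def mem_Times_iff)
  have S6: "norm (Dh y q - Dh y q') \<le> L * norm (q - q')" if "y \<in> S" "q \<in> Q" "q' \<in> Q" for y q q'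
      using lip[OF S(1)[OF that(1)]] that(2,3) by (simp add: Q_def)
  obtain Y where Y: "\<And>q. q \<in> Q \<Longrightarrow> Y q \<in> S"
    and Y_min: "\<And>q y. q \<in> Q \<Longrightarrow> y \<in> S \<Longrightarrow> h (Y q) q \<le> h y q"
    and Y_unique: "\<And>q y. q \<in> Q \<Longrightarrow> y \<in> S \<Longrightarrow> h y q \<le> h (Y q) q \<Longrightarrow> y = Y q"
    and Y_lip: "\<And>q q'. q \<in> Q \<Longrightarrow> q' \<in> Q \<Longrightarrow> \<kappa> * norm (Y q - Y q') \<le> L * norm (q - q')"
    and Y0: "Y (wb, vb) = 0"
    apply (rule strongly_monotone_minimizers[OF S1 S2 S3 \<kappa> q0 S4 S5 S6 Dh0], assumption+)
    subgoal premises prems by (rule prems(1)[OF prems(2-)])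
    done
  have Y_lip': "norm (Y q - Y q') \<le> L / \<kappa> * norm (q - q')" if "q \<in> Q" "q' \<in> Q" for q q'
    using Y_lip[OF that] \<kappa> by (simp add: field_simps)
  define \<xi> where "\<xi> = (\<lambda>q. X (Y q, fst q))"
  define L2 where "L2 = L / \<kappa> + 1"
  have L2: "0 < L2" using L \<kappa> by (simp add: L2_def add_nonneg_pos)
  have YQ: "(Y q, fst q) \<in> cball 0 \<rho> \<times> ball wb \<rho>" if "q \<in> Q" for q
    using S(1)[OF Y[OF that]] that by (simp add: Q_def mem_Times_iff)
  have pair_lip: "norm ((Y q, fst q) - (Y q', fst q')) \<le> L2 * norm (q - q')" if "q \<in> Q" "q' \<in> Q" for q q'
  proof -
    have "norm ((Y q, fst q) - (Y q', fst q')) \<le> norm (Y q - Y q') + norm (fst (q - q'))"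
      using norm_Pair_le_add[of "Y q - Y q'" "fst (q - q')"] by simp
    also have "\<dots> \<le> L / \<kappa> * norm (q - q') + norm (q - q')"
      using Y_lip'[OF that] norm_fst_le[of "fst (q - q')" "snd (q - q')"] unfolding prod.collapse by linarith
    finally show ?thesis by (simp add: L2_def algebra_simps)
  qed
  have \<xi>_lip: "norm (\<xi> q - \<xi> q') \<le> L * L2 * norm (q - q')" if "q \<in> Q" "q' \<in> Q" for q q'
  proof -
    have "norm (\<xi> q - \<xi> q') \<le> L * norm ((Y q, fst q) - (Y q', fst q'))"
      unfolding \<xi>_def by (intro X_lip YQ that)
    also have "\<dots> \<le> L * (L2 * norm (q - q'))" by (intro mult_left_mono pair_lip that L)
    finally show ?thesis by simp
  qed
  have \<xi>0: "\<xi> (wb, vb) = xb" using Y0 X0 by (simp add: \<xi>_def)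
  \<comment> \<open>Smaller than \<open>\<gamma>\<close>, so that the closed ball of the stability
    definition lies in the open ball on which \<open>X\<close> recovers \<open>x\<close> from its
    new variable.\<close>
  define \<gamma>' where "\<gamma>' = \<gamma> / 2"
  have \<gamma>': "0 < \<gamma>'" "\<gamma>' < \<gamma>" using \<gamma> by (auto simp: \<gamma>'_def)
  \<comment> \<open>Parameters in \<open>W \<times> V\<close> are within \<open>2 * \<sigma>\<close>
    of the reference one and \<open>\<xi>\<close> has Lipschitz constant \<open>L * L2\<close>; the
    last entry keeps the minimizers in the ball of radius \<open>\<gamma>'\<close>.\<close>
  define \<sigma> where "\<sigma> = min (min \<rho> \<gamma>) (\<gamma>' / (2 * (L * L2 + 1)))"
  have LL2: "0 < L * L2 + 1" using L L2 by (simp add: add_nonneg_pos)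
  have \<sigma>: "0 < \<sigma>" "\<sigma> \<le> \<rho>" "\<sigma> \<le> \<gamma>" "\<sigma> \<le> \<gamma>' / (2 * (L * L2 + 1))"
    using \<rho> \<gamma> \<gamma>' LL2 by (simp_all add: \<sigma>_def)
  define W where "W = ball wb \<sigma>"
  define V where "V = ball vb \<sigma>"
  have WVQ: "q \<in> Q" "fst q \<in> ball wb \<gamma>" if "q \<in> W \<times> V" for q
    using that \<sigma> by (auto simp: W_def V_def Q_def)
  have \<xi>_ball: "\<xi> q \<in> cball xb \<gamma>'" if "q \<in> W \<times> V" for q
  proof -
    have "norm (q - (wb, vb)) \<le> norm (fst q - wb) + norm (snd q - vb)"
      using norm_Pair_le_add[of "fst q - wb" "snd q - vb"] by (cases q) simp
    also have "\<dots> \<le> 2 * \<sigma>"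
      using that by (auto simp: W_def V_def dist_norm norm_minus_commute)
    finally have "norm (\<xi> q - xb) \<le> L * L2 * (2 * \<sigma>)"
      using order_trans[OF \<xi>_lip[OF WVQ(1)[OF that] q0] mult_left_mono] L L2 \<xi>0 by simp
    also have "\<dots> \<le> (L * L2 + 1) * (2 * \<sigma>)" using \<sigma> by (intro mult_right_mono) auto
    also have "\<dots> \<le> \<gamma>'" using \<sigma>(4) LL2 by (simp add: field_simps)
    finally show ?thesis by (simp add: dist_norm norm_minus_commute)
  qed
  have h_drop: "h z q - c / 2 * norm (y - z) \<le> h y q"
    if "y \<in> cball 0 \<rho>" "z \<in> cball 0 \<rho>" "q \<in> Q" for y z q
  proof -
    have "norm (h y q - h z q) \<le> c / 2 * norm (y - z)"
    proof (rule differentiable_bound[of "cball 0 \<rho>" "\<lambda>y. h y q" "\<lambda>y. blinfun_apply (Dh y q)" "c / 2" y z])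
      fix x assume x: "x \<in> cball (0::'a) \<rho>"
      show "((\<lambda>y. h y q) has_derivative blinfun_apply (Dh x q)) (at x within cball 0 \<rho>)"
        by (rule has_derivative_at_withinI[OF dh'[OF x that(3)]])
      show "onorm (blinfun_apply (Dh x q)) \<le> c / 2"
        using Dh_small[OF x, of "fst q" "snd q"] that(3) by (simp add: Q_def mem_Times_iff norm_blinfun.rep_eq)
    qed (use that in simp_all)
    then show ?thesis unfolding real_norm_def by linarith
  qed
  have value_at: "\<phi> (\<xi> q, fst q) - ereal (snd q \<bullet> \<xi> q) = ereal (h (Y q) q)" if "q \<in> W \<times> V" for q
    using \<phi>X[of "Y q" "fst q"] YQ[OF WVQ(1)[OF that]] g_C[OF S(2)[OF Y[OF WVQ(1)[OF that]]]]
    by (simp add: \<xi>_def h_def)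
  \<comment> \<open>Leaving \<open>C\<close> costs at least \<open>c\<close> times the distance, which exceeds what \<open>h\<close> can gain.\<close>
  have value_ge: "ereal (h (Y q) q) \<le> \<phi> (x, fst q) - ereal (snd q \<bullet> x) \<and>
      (\<phi> (x, fst q) - ereal (snd q \<bullet> x) \<le> ereal (h (Y q) q) \<longrightarrow> x = \<xi> q)"
    if q: "q \<in> W \<times> V" and x: "x \<in> cball xb \<gamma>'" for q x
  proof -
    define y where "y = \<psi> (x, fst q)"
    define z where "z = closest_point C y"
    have "x \<in> ball xb \<gamma>" using x \<gamma>' by simp
    from X\<psi>[OF this WVQ(2)[OF q]] have y: "y \<in> cball 0 \<rho>" "X (y, fst q) = x" by (auto simp: y_def)
    have zC: "z \<in> C" unfolding z_def using C by (intro closest_point_in_set) auto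
    have z: "z \<in> cball 0 \<rho>" using norm_closest_point_le[of y] y by (simp add: z_def)
    have zS: "z \<in> S" using zC z by (simp add: S_def)
    have Qq: "q \<in> Q" by (rule WVQ(1)[OF q])
    have val: "\<phi> (x, fst q) - ereal (snd q \<bullet> x) = ereal (h y q) + g y"
    proof -
      have "\<phi> (x, fst q) = ereal (f (x, fst q)) + g y"
        using \<phi>X[OF y(1), of "fst q"] y(2) Qq by (simp add: Q_def mem_Times_iff)
      then show ?thesis by (cases "g y") (simp_all add: h_def y(2))
    qed
    have b1: "h (Y q) q \<le> h z q" by (rule Y_min[OF Qq zS])
    have b2: "h z q - c / 2 * norm (y - z) \<le> h y q" by (rule h_drop[OF y(1) z Qq])
    have b3: "ereal (c * norm (y - z)) \<le> g y" unfolding z_def by (rule g_error)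
    have "ereal (h z q + c / 2 * norm (y - z)) \<le> ereal (h y q) + ereal (c * norm (y - z))"
      using b2 by simp
    also have "\<dots> \<le> ereal (h y q) + g y" by (intro add_left_mono b3)
    finally have lower: "ereal (h z q + c / 2 * norm (y - z)) \<le> \<phi> (x, fst q) - ereal (snd q \<bullet> x)"
      by (simp add: val)
    have "h (Y q) q \<le> h z q + c / 2 * norm (y - z)" using b1 c by (simp add: add_increasing2)
    then have "ereal (h (Y q) q) \<le> \<phi> (x, fst q) - ereal (snd q \<bullet> x)"
      using lower by (meson ereal_less_eq(3) order_trans)
    moreover have "x = \<xi> q" if "\<phi> (x, fst q) - ereal (snd q \<bullet> x) \<le> ereal (h (Y q) q)"
    proof -
      \<comment> \<open>Together with the minimality of \<open>Y q\<close> over \<open>S\<close>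
        this forces the surplus \<open>c / 2 * norm (y - z)\<close> to vanish; so \<open>y\<close>
        lies in \<open>C\<close> and uniqueness over \<open>S\<close> applies.\<close>
      have *: "h z q + c / 2 * norm (y - z) \<le> h (Y q) q"
        using order_trans[OF lower that] by simp
      have nn: "0 \<le> c / 2 * norm (y - z)" using c by simp
      have "c / 2 * norm (y - z) \<le> 0" using * b1 by linarith
      then have "y = z" using c by (simp add: mult_le_0_iff)
      moreover have "z = Y q" by (rule Y_unique[OF Qq zS]) (use * nn in linarith)
      ultimately show ?thesis using y(2) by (simp add: \<xi>_def)
    qed
    ultimately show ?thesis by blast
  qed
  have m_eq: "m_gamma \<phi> xb \<gamma>' q = ereal (h (Y q) q)" if q: "q \<in> W \<times> V" for q
  proof -
    have "(INF x\<in>cball xb \<gamma>'. \<phi> (x, fst q) - ereal (snd q \<bullet> x)) = ereal (h (Y q) q)"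
    proof (rule antisym)
      show "(INF x\<in>cball xb \<gamma>'. \<phi> (x, fst q) - ereal (snd q \<bullet> x)) \<le> ereal (h (Y q) q)"
        by (rule INF_lower2[OF \<xi>_ball[OF q]]) (simp add: value_at[OF q])
      show "ereal (h (Y q) q) \<le> (INF x\<in>cball xb \<gamma>'. \<phi> (x, fst q) - ereal (snd q \<bullet> x))"
        by (rule INF_greatest) (rule value_ge[OF q, THEN conjunct1])
    qed
    then show ?thesis by (simp add: m_gamma_def case_prod_beta)
  qed
  have M_eq: "M_gamma \<phi> xb \<gamma>' q = {\<xi> q}" if q: "q \<in> W \<times> V" for q
  proof -
    have "M_gamma \<phi> xb \<gamma>' q = {x \<in> cball xb \<gamma>'. \<phi> (x, fst q) - ereal (snd q \<bullet> x) = ereal (h (Y q) q)}"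
      using m_eq[OF q] by (simp add: M_gamma_def case_prod_beta)
    also have "\<dots> = {\<xi> q}"
    proof (intro subset_antisym subsetI)
      fix x assume "x \<in> {x \<in> cball xb \<gamma>'. \<phi> (x, fst q) - ereal (snd q \<bullet> x) = ereal (h (Y q) q)}"
      then have "x \<in> cball xb \<gamma>'" "\<phi> (x, fst q) - ereal (snd q \<bullet> x) \<le> ereal (h (Y q) q)" by simp_all
      then have "x = \<xi> q" using value_ge[OF q] by simp
      then show "x \<in> {\<xi> q}" by simp
    qed (use value_at[OF q] \<xi>_ball[OF q] in simp)
    finally show ?thesis .
  qed
  have \<xi>_Lip: "(L * L2)-lipschitz_on (W \<times> V) \<xi>"
    using \<xi>_lip WVQ(1) L L2 by (intro lipschitz_onI) (simp_all add: dist_norm)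
  \<comment> \<open>Bounds for the tilts and for the minimizers, needed for the bilinear term
    \<open>v \<bullet> x\<close> of the optimal value.\<close>
  define B where "B = norm vb + \<sigma>"
  define B' where "B' = norm xb + \<gamma>'"
  have hY: "norm (h (Y q) q - h (Y q') q') \<le> (L * L2 + (B * (L * L2) + B')) * norm (q - q')"
    if "q \<in> W \<times> V" "q' \<in> W \<times> V" for q q'
  proof -
    have Qq: "q \<in> Q" "q' \<in> Q" using WVQ that by auto
    have "norm (f (\<xi> q, fst q) - f (\<xi> q', fst q')) \<le> L * norm ((Y q, fst q) - (Y q', fst q'))"
      using f_lip[OF YQ[OF Qq(1)] YQ[OF Qq(2)]] by (simp add: \<xi>_def)
    also have "\<dots> \<le> L * (L2 * norm (q - q'))" by (intro mult_left_mono pair_lip Qq L)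
    finally have 1: "norm (f (\<xi> q, fst q) - f (\<xi> q', fst q')) \<le> L * L2 * norm (q - q')" by simp
    have vq: "norm (snd q) \<le> B"
      using that(1) norm_triangle_sub[of "snd q" vb]
      by (auto simp: B_def V_def mem_Times_iff dist_norm norm_minus_commute)
    have xq: "norm (\<xi> q') \<le> B'"
      using \<xi>_ball[OF that(2)] norm_triangle_sub[of "\<xi> q'" xb] by (simp add: B'_def dist_norm norm_minus_commute)
    have "snd q \<bullet> \<xi> q - snd q' \<bullet> \<xi> q' = snd q \<bullet> (\<xi> q - \<xi> q') + (snd q - snd q') \<bullet> \<xi> q'"
      by (simp add: inner_diff_left inner_diff_right)
    then have "norm (snd q \<bullet> \<xi> q - snd q' \<bullet> \<xi> q') \<le> norm (snd q) * norm (\<xi> q - \<xi> q') + norm (snd q - snd q') * norm (\<xi> q')"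
      using Cauchy_Schwarz_ineq2[of "snd q" "\<xi> q - \<xi> q'"] Cauchy_Schwarz_ineq2[of "snd q - snd q'" "\<xi> q'"] by simp
    also have "\<dots> \<le> B * (L * L2 * norm (q - q')) + norm (q - q') * B'"
    proof (intro add_mono mult_mono)
      show "norm (snd q - snd q') \<le> norm (q - q')"
        using norm_snd_le[of "snd (q - q')" "fst (q - q')"] unfolding prod.collapse by simp
      show "0 \<le> B" using \<sigma> by (simp add: B_def)
    qed (use vq xq \<xi>_lip[OF Qq] in auto)
    finally have 2: "norm (snd q \<bullet> \<xi> q - snd q' \<bullet> \<xi> q') \<le> (B * (L * L2) + B') * norm (q - q')"
      by (simp add: algebra_simps)
    have "h (Y q) q - h (Y q') q' = (f (\<xi> q, fst q) - f (\<xi> q', fst q')) - (snd q \<bullet> \<xi> q - snd q' \<bullet> \<xi> q')"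
      by (simp add: h_def \<xi>_def)
    then have "norm (h (Y q) q - h (Y q') q') \<le> norm (f (\<xi> q, fst q) - f (\<xi> q', fst q')) + norm (snd q \<bullet> \<xi> q - snd q' \<bullet> \<xi> q')"
      by (simp only: norm_triangle_ineq4)
    with 1 2 show ?thesis by (simp add: distrib_right)
  qed
  have h_Lip: "(L * L2 + (B * (L * L2) + B'))-lipschitz_on (W \<times> V) (\<lambda>q. h (Y q) q)"
  proof (rule lipschitz_onI)
    show "dist (h (Y q) q) (h (Y q') q') \<le> (L * L2 + (B * (L * L2) + B')) * dist q q'"
      if "q \<in> W \<times> V" "q' \<in> W \<times> V" for q q'
      using hY[OF that] unfolding dist_norm .
  qed (use L L2 \<sigma> \<gamma>' in \<open>simp add: B_def B'_def\<close>)
  show ?thesis unfolding fully_stable_def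
  proof (rule exI[of _ \<gamma>'], intro conjI \<gamma>'(1) exI[of _ W] exI[of _ V])
    show "open W" "open V" "wb \<in> W" "vb \<in> V" using \<sigma> by (simp_all add: W_def V_def)
    then show "M_gamma \<phi> xb \<gamma>' (wb, vb) = {xb}" using M_eq[of "(wb, vb)"] \<xi>0 by simp
    show "\<exists>\<xi> \<kappa>. (\<forall>q\<in>W \<times> V. M_gamma \<phi> xb \<gamma>' q = {\<xi> q}) \<and> \<kappa>-lipschitz_on (W \<times> V) \<xi>"
      using M_eq \<xi>_Lip by blast
    show "\<exists>\<mu> \<kappa>. (\<forall>q\<in>W \<times> V. m_gamma \<phi> xb \<gamma>' q = ereal (\<mu> q)) \<and> \<kappa>-lipschitz_on (W \<times> V) \<mu>"
      using m_eq h_Lip by (intro exI[of _ "\<lambda>q. h (Y q) q"] exI[of _ "L * L2 + (B * (L * L2) + B')"]) simp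
  qed
qed

end

subsection \<open>Uniform quadratic growth\<close>

text \<open>\<open>\<Psi>\<close> is the conjugate of \<open>Q\<close> on \<open>C\<close>, shifted
  by \<open>e\<close>. Formally its gradient is \<open>\<eta> s - e\<close>, which lies in
  \<open>U\<close>, so a minimizer over \<open>U\<close> is a tilt whose solution is
  \<open>e\<close>. The minimum exists because \<open>e\<close> is interior relative to
  \<open>U\<close>: testing with \<open>e + u\<close>, where \<open>u\<close> is parallel to
  \<open>s\<close>, makes \<open>\<Psi>\<close> coercive on \<open>U\<close>.\<close>

lemma attained_tilt:
  fixes Q :: "'a::euclidean_space \<Rightarrow> real"
  assumes U: "subspace U" "C \<subseteq> U" and e: "e \<in> C" and "0 < \<rho>"
    and relint: "\<And>u. u \<in> U \<Longrightarrow> norm u \<le> \<rho> \<Longrightarrow> e + u \<in> C"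
    and Q: "continuous_on UNIV Q" and k: "0 < k"
    and growth: "\<And>s. \<exists>x\<in>C. \<forall>y\<in>C. Q x + s \<bullet> (y - x) + k * (norm (y - x))\<^sup>2 \<le> Q y"
  obtains s where "\<And>y. y \<in> C \<Longrightarrow> Q e + s \<bullet> (y - e) + k * (norm (y - e))\<^sup>2 \<le> Q y"
proof -
  obtain \<eta> where \<eta>C: "\<And>s. \<eta> s \<in> C"
    and \<eta>: "\<And>s y. y \<in> C \<Longrightarrow> Q (\<eta> s) + s \<bullet> (y - \<eta> s) + k * (norm (y - \<eta> s))\<^sup>2 \<le> Q y"
    using growth by metis
  have lip: "2 * k * norm (\<eta> s - \<eta> s') \<le> norm (s - s')" for s s'
  proof (cases "\<eta> s = \<eta> s'")
    case False
    have "Q (\<eta> s) + s \<bullet> (\<eta> s' - \<eta> s) + k * (norm (\<eta> s' - \<eta> s))\<^sup>2 \<le> Q (\<eta> s')" by (rule \<eta>[OF \<eta>C])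
    moreover have "Q (\<eta> s') + s' \<bullet> (\<eta> s - \<eta> s') + k * (norm (\<eta> s - \<eta> s'))\<^sup>2 \<le> Q (\<eta> s)" by (rule \<eta>[OF \<eta>C])
    ultimately have "2 * k * (norm (\<eta> s - \<eta> s'))\<^sup>2 \<le> (s - s') \<bullet> (\<eta> s - \<eta> s')"
      by (simp add: inner_diff_left inner_diff_right norm_minus_commute[of "\<eta> s'"])
    also have "\<dots> \<le> norm (s - s') * norm (\<eta> s - \<eta> s')" by (rule norm_cauchy_schwarz)
    finally have "(2 * k * norm (\<eta> s - \<eta> s')) * norm (\<eta> s - \<eta> s') \<le> norm (s - s') * norm (\<eta> s - \<eta> s')"
      by (simp add: power2_eq_square mult.assoc)
    with False show ?thesis by simp
  qed simp
  have "continuous_on UNIV \<eta>"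
  proof (rule lipschitz_on_continuous_on)
    show "(1 / (2 * k))-lipschitz_on UNIV \<eta>"
      using lip k by (intro lipschitz_onI) (simp_all add: dist_norm field_simps)
  qed
  define \<Psi> where "\<Psi> = (\<lambda>s. s \<bullet> \<eta> s - Q (\<eta> s) - s \<bullet> e)"
  have c\<Psi>: "continuous_on A \<Psi>" for A
    unfolding \<Psi>_def using \<open>continuous_on UNIV \<eta>\<close>
    by (intro continuous_intros continuous_on_compose2[OF Q]) (auto intro: continuous_on_subset)
  have \<Psi>_ge: "s \<bullet> (y - e) - Q y \<le> \<Psi> s" if "y \<in> C" for s y
  proof -
    have "0 \<le> k * (norm (y - \<eta> s))\<^sup>2" using k by simp
    then show ?thesis using \<eta>[OF that, of s] by (simp add: \<Psi>_def inner_diff_right)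
  qed
  have "continuous_on (cball 0 \<rho>) (\<lambda>u. Q (e + u))"
    by (intro continuous_on_compose2[OF Q] continuous_intros) auto
  moreover have "cball (0::'a) \<rho> \<noteq> {}" using \<open>0 < \<rho>\<close> by simp
  ultimately obtain m where m: "\<forall>u\<in>cball 0 \<rho>. Q (e + u) \<le> Q (e + m)"
    using continuous_attains_sup[OF compact_cball] by blast
  define B where "B = Q (e + m)"
  have coercive: "\<rho> * norm s - B \<le> \<Psi> s" if "s \<in> U" "s \<noteq> 0" for s
  proof -
    define u where "u = (\<rho> / norm s) *\<^sub>R s"
    have u: "u \<in> U" "norm u \<le> \<rho>" using that U \<open>0 < \<rho>\<close> by (auto simp: u_def subspace_scale)
    have "s \<bullet> u = \<rho> * norm s" using that by (simp add: u_def power2_norm_eq_inner[symmetric] power2_eq_square)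
    moreover have "Q (e + u) \<le> B" using m u by (simp add: B_def)
    ultimately show ?thesis using \<Psi>_ge[OF relint[OF u], of s] by simp
  qed
  \<comment> \<open>Beyond this radius the coercive lower bound \<open>\<rho> * norm s - B\<close>
    is at least \<open>\<Psi> 0\<close>, so minimizing over the ball is enough.\<close>
  define R where "R = (\<bar>\<Psi> 0\<bar> + \<bar>B\<bar>) / \<rho>"
  have R0: "0 \<le> R" using \<open>0 < \<rho>\<close> by (simp add: R_def)
  have "compact (U \<inter> cball 0 R)" using U by (intro closed_Int_compact closed_subspace) auto
  moreover have "0 \<in> U \<inter> cball 0 R" using U R0 by (simp add: subspace_0)
  ultimately obtain s where s: "s \<in> U \<inter> cball 0 R" "\<And>s'. s' \<in> U \<inter> cball 0 R \<Longrightarrow> \<Psi> s \<le> \<Psi> s'"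
    using continuous_attains_inf[OF _ _ c\<Psi>, of "U \<inter> cball 0 R"] by blast
  have min: "\<Psi> s \<le> \<Psi> s'" if "s' \<in> U" for s'
  proof (cases "norm s' \<le> R")
    case True then show ?thesis using that s(2) by simp
  next
    case False
    then have "s' \<noteq> 0" using R0 by auto
    have "\<Psi> s \<le> \<Psi> 0" using s(2) \<open>0 \<in> U \<inter> cball 0 R\<close> by blast
    also have "\<dots> \<le> \<rho> * R - B" using \<open>0 < \<rho>\<close> by (simp add: R_def)
    also have "\<dots> \<le> \<rho> * norm s' - B" using False \<open>0 < \<rho>\<close> by simp
    also have "\<dots> \<le> \<Psi> s'" by (rule coercive[OF that \<open>s' \<noteq> 0\<close>])
    finally show ?thesis .
  qed
  have "\<eta> s = e"
  proof -
    define d where "d = e - \<eta> s"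
    have "d \<in> U" using U e \<eta>C[of s] by (auto simp: d_def intro: subspace_diff)
    \<comment> \<open>By \<open>lip\<close> this step moves the tilted minimizer by at most
      \<open>norm d / 2\<close>. Minimality of \<open>\<Psi> s\<close> then gives
      \<open>norm d ^ 2 \<le> norm d ^ 2 / 2\<close>, with no differentiation of
      \<open>\<Psi>\<close>.\<close>
    define s' where "s' = s + k *\<^sub>R d"
    have "s' \<in> U" using U s(1) \<open>d \<in> U\<close> by (auto simp: s'_def intro: subspace_add subspace_scale)
    have "0 \<le> \<Psi> s' - \<Psi> s" using min[OF \<open>s' \<in> U\<close>] by simp
    also have "\<dots> \<le> k * (d \<bullet> (\<eta> s' - e))"
      using \<Psi>_ge[OF \<eta>C[of s'], of s] by (simp add: \<Psi>_def s'_def inner_add_left inner_diff_right algebra_simps)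
    finally have "0 \<le> d \<bullet> (\<eta> s' - e)" using k by (simp add: zero_le_mult_iff)
    then have "d \<bullet> d \<le> d \<bullet> (\<eta> s' - \<eta> s)" by (simp add: d_def inner_diff_right)
    also have "\<dots> \<le> norm d * norm (\<eta> s' - \<eta> s)" by (rule norm_cauchy_schwarz)
    also have "\<dots> \<le> norm d * (norm d / 2)"
    proof (rule mult_left_mono)
      have "2 * k * norm (\<eta> s' - \<eta> s) \<le> k * norm d" using lip[of s' s] k by (simp add: s'_def)
      then show "norm (\<eta> s' - \<eta> s) \<le> norm d / 2" using k by simp
    qed simp
    finally have "(norm d)\<^sup>2 \<le> (norm d)\<^sup>2 / 2" by (simp add: power2_norm_eq_inner[symmetric] power2_eq_square)
    then have "d = 0" by simp
    then show ?thesis by (simp add: d_def)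
  qed
  with \<eta>[of _ s] show thesis by (intro that[of s]) simp
qed

text \<open>The optimal value \<open>\<nu>\<close> is concave in the tilt with supergradients
  \<open>- \<xi>\<close>. A Lipschitz \<open>\<xi>\<close> bounds its bend from below by a
  quadratic, and \<open>\<phi>\<close>, which dominates \<open>\<nu> v' + v' \<bullet> x\<close> for
  every nearby \<open>v'\<close>, inherits the conjugate quadratic; this turns the Lipschitz
  constant \<open>k\<close> into the growth constant \<open>1 / (4 * k)\<close>.\<close>

lemma fully_stable_growth:
  fixes \<phi> :: "'a::euclidean_space \<times> 'b::euclidean_space \<Rightarrow> ereal"
  assumes "fully_stable \<phi> xb wb vb"
  obtains \<xi> r k where "0 < r" "0 < k" "\<xi> vb = xb"
    "\<And>v v'. v \<in> ball vb r \<Longrightarrow> v' \<in> ball vb r \<Longrightarrow> norm (\<xi> v - \<xi> v') \<le> k * norm (v - v')"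
    "\<And>v x. v \<in> ball vb r \<Longrightarrow> x \<in> ball xb r \<Longrightarrow>
        \<phi> (\<xi> v, wb) + ereal (v \<bullet> (x - \<xi> v) + (norm (x - \<xi> v))\<^sup>2 / (4 * k)) \<le> \<phi> (x, wb)"
proof -
  from assms obtain \<gamma> W V \<xi>' \<kappa> \<mu> where "0 < \<gamma>" and WV: "wb \<in> W" "open V" "vb \<in> V"
    and M: "\<forall>q\<in>W \<times> V. M_gamma \<phi> xb \<gamma> q = {\<xi>' q}" and lip: "\<kappa>-lipschitz_on (W \<times> V) \<xi>'"
    and M0: "M_gamma \<phi> xb \<gamma> (wb, vb) = {xb}"
    and m: "\<forall>q\<in>W \<times> V. m_gamma \<phi> xb \<gamma> q = ereal (\<mu> q)"
    unfolding fully_stable_def by blast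
  define \<xi> where "\<xi> = (\<lambda>v. \<xi>' (wb, v))"
  define \<nu> where "\<nu> = (\<lambda>v. \<mu> (wb, v))"
  obtain r0 where r0: "0 < r0" "ball vb r0 \<subseteq> V" using WV by (metis open_contains_ball)
  \<comment> \<open>At least 1, which permits division by \<open>k\<close> and the estimate
    \<open>r \<le> k * r\<close> for the radius.\<close>
  define k where "k = \<kappa> + 1"
  have k: "1 \<le> k" using lipschitz_on_nonneg[OF lip] by (simp add: k_def)
  have \<xi>_lip: "norm (\<xi> v - \<xi> v') \<le> k * norm (v - v')" if "v \<in> V" "v' \<in> V" for v v'
  proof -
    have "norm (\<xi> v - \<xi> v') \<le> \<kappa> * norm (v - v')"
      using lipschitz_onD[OF lip, of "(wb, v)" "(wb, v')"] that WV by (simp add: \<xi>_def dist_norm norm_Pair)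
    also have "\<dots> \<le> k * norm (v - v')" by (intro mult_right_mono) (simp_all add: k_def)
    finally show ?thesis .
  qed
  have \<nu>_le: "ereal (\<nu> v) \<le> \<phi> (x, wb) - ereal (v \<bullet> x)" if "v \<in> V" "x \<in> cball xb \<gamma>" for v x
  proof -
    have "ereal (\<nu> v) = (INF x\<in>cball xb \<gamma>. \<phi> (x, wb) - ereal (v \<bullet> x))"
      using m that(1) WV by (auto simp: m_gamma_def \<nu>_def)
    also have "\<dots> \<le> \<phi> (x, wb) - ereal (v \<bullet> x)" by (rule INF_lower[OF that(2)])
    finally show ?thesis .
  qed
  have \<nu>_eq: "\<phi> (\<xi> v, wb) = ereal (\<nu> v + v \<bullet> \<xi> v)" "\<xi> v \<in> cball xb \<gamma>" if "v \<in> V" for v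
  proof -
    have "\<xi> v \<in> M_gamma \<phi> xb \<gamma> (wb, v)" using M that WV by (simp add: \<xi>_def)
    then have *: "\<xi> v \<in> cball xb \<gamma>" "\<phi> (\<xi> v, wb) - ereal (v \<bullet> \<xi> v) = ereal (\<nu> v)"
      using m that WV by (auto simp: M_gamma_def \<nu>_def)
    then show "\<xi> v \<in> cball xb \<gamma>" by simp
    show "\<phi> (\<xi> v, wb) = ereal (\<nu> v + v \<bullet> \<xi> v)" using *(2) by (cases "\<phi> (\<xi> v, wb)") auto
  qed
  have \<xi>0: "\<xi> vb = xb" using M M0 WV by (auto simp: \<xi>_def)
  \<comment> \<open>Half of \<open>r0\<close>, because the comparison tilt \<open>v'\<close> differs
    from \<open>v\<close> by \<open>norm d / (2 * k) < r\<close> and must stay in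
    \<open>V\<close>.\<close>
  define r where "r = min (r0 / 2) \<gamma>"
  have r: "0 < r" "2 * r \<le> r0" "r \<le> \<gamma>" using r0 \<open>0 < \<gamma>\<close> by (auto simp: r_def)
  have inV: "v \<in> V" if "v \<in> ball vb r" for v using that r r0 by auto
  show thesis
  proof (rule that[of r k \<xi>])
    show "norm (\<xi> v - \<xi> v') \<le> k * norm (v - v')" if "v \<in> ball vb r" "v' \<in> ball vb r" for v v'
      by (intro \<xi>_lip inV that)
    show "\<phi> (\<xi> v, wb) + ereal (v \<bullet> (x - \<xi> v) + (norm (x - \<xi> v))\<^sup>2 / (4 * k)) \<le> \<phi> (x, wb)"
      if v: "v \<in> ball vb r" and x: "x \<in> ball xb r" for v x
    proof -
      \<comment> \<open>the tilt at which comparing \<open>\<xi> v'\<close> with \<open>x\<close> is most profitable\<close>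
      define d where "d = x - \<xi> v"
      define v' where "v' = v + (1 / (2 * k)) *\<^sub>R d"
      have "norm (\<xi> v - xb) \<le> k * norm (v - vb)"
        using \<xi>_lip[OF inV[OF v] WV(3)] \<xi>0 by simp
      moreover have "norm (v - vb) < r" using v by (simp add: dist_norm norm_minus_commute)
      then have "k * norm (v - vb) \<le> k * r" using k by simp
      moreover have "norm d \<le> norm (x - xb) + norm (\<xi> v - xb)"
        using norm_triangle_ineq4[of "x - xb" "\<xi> v - xb"] by (simp add: d_def)
      moreover have "norm (x - xb) < r" using x by (simp add: dist_norm norm_minus_commute)
      ultimately have "norm d < r + k * r" by linarith
      also have "\<dots> \<le> k * r + k * r" using k r by simp
      finally have "norm d / (2 * k) < r" using k by (simp add: field_simps)
      moreover have "norm (v' - v) = norm d / (2 * k)" using k by (simp add: v'_def)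
      ultimately have "norm (v' - vb) < r + r"
        using norm_triangle_ineq[of "v' - v" "v - vb"] \<open>norm (v - vb) < r\<close> by simp
      then have v': "v' \<in> V" using r r0(2) by (auto simp: dist_norm norm_minus_commute)
      have "ereal (\<nu> v) \<le> \<phi> (\<xi> v', wb) - ereal (v \<bullet> \<xi> v')"
        by (rule \<nu>_le[OF inV[OF v] \<nu>_eq(2)[OF v']])
      then have "\<nu> v \<le> \<nu> v' + (v' - v) \<bullet> \<xi> v'" by (simp add: \<nu>_eq(1)[OF v'] inner_diff_left)
      also have "(v' - v) \<bullet> \<xi> v' = (v' - v) \<bullet> \<xi> v + (v' - v) \<bullet> (\<xi> v' - \<xi> v)"
        by (simp add: inner_diff_right)
      also have "(v' - v) \<bullet> (\<xi> v' - \<xi> v) \<le> norm (v' - v) * norm (\<xi> v' - \<xi> v)"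
        by (rule norm_cauchy_schwarz)
      also have "\<dots> \<le> norm (v' - v) * (k * norm (v' - v))"
        by (intro mult_left_mono \<xi>_lip v' inV v) simp
      also have "\<dots> = (norm d)\<^sup>2 / (4 * k)"
        using k by (simp add: \<open>norm (v' - v) = norm d / (2 * k)\<close> power2_eq_square field_simps)
      finally have 1: "\<nu> v \<le> \<nu> v' + (v' - v) \<bullet> \<xi> v + (norm d)\<^sup>2 / (4 * k)" by simp
      have "(v' - v) \<bullet> x - (v' - v) \<bullet> \<xi> v = (v' - v) \<bullet> d" by (simp add: d_def inner_diff_right)
      also have "\<dots> = (norm d)\<^sup>2 / (2 * k)" by (simp add: v'_def power2_norm_eq_inner)
      finally have 2: "(v' - v) \<bullet> x - (v' - v) \<bullet> \<xi> v = (norm d)\<^sup>2 / (2 * k)" .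
      have 3: "(norm d)\<^sup>2 / (2 * k) = (norm d)\<^sup>2 / (4 * k) + (norm d)\<^sup>2 / (4 * k)" using k by (simp add: field_simps)
      have "x \<in> cball xb \<gamma>" using x r by simp
      from \<nu>_le[OF v' this] have "ereal (\<nu> v' + v' \<bullet> x) \<le> \<phi> (x, wb)"
        by (cases "\<phi> (x, wb)") auto
      moreover have "\<nu> v + v \<bullet> \<xi> v + (v \<bullet> d + (norm d)\<^sup>2 / (4 * k)) \<le> \<nu> v' + v' \<bullet> x"
        using 1 2 3 by (simp add: d_def inner_diff_left inner_diff_right)
      ultimately have "ereal (\<nu> v + v \<bullet> \<xi> v + (v \<bullet> d + (norm d)\<^sup>2 / (4 * k))) \<le> \<phi> (x, wb)"
        by (meson ereal_less_eq(3) order_trans)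
      then show ?thesis by (simp add: \<nu>_eq(1)[OF inV[OF v]] d_def)
    qed
  qed (use r k \<xi>0 in auto)
qed

subsection \<open>Blow-up at the reference point\<close>

text \<open>Rescales a remainder of order \<open>o(norm k ^ p)\<close> along bounded directions:
  \<open>p = 1\<close> yields difference quotients with moving directions, \<open>p = 2\<close> the
  second order expansion of \<open>f\<close>.\<close>

lemma remainder_blowup:
  fixes R :: "'a::real_normed_vector \<Rightarrow> 'b::real_normed_vector"
  assumes small: "\<And>e. 0 < e \<Longrightarrow> \<exists>d>0. \<forall>k. norm k < d \<longrightarrow> norm (R k) \<le> e * norm k ^ p"
    and t: "t \<longlonglongrightarrow> 0" "\<And>n. 0 < t n" and h: "\<And>n. norm (h n) \<le> B"
  shows "(\<lambda>n. R (t n *\<^sub>R h n) /\<^sub>R t n ^ p) \<longlonglongrightarrow> 0"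
proof (rule LIMSEQ_I)
  fix e :: real assume "0 < e"
  have B: "0 \<le> B" by (rule order_trans[OF norm_ge_zero h[of 0]])
  define D where "D = B ^ p + 1"
  define e' where "e' = e / (2 * D)"
  have Bp: "0 \<le> B ^ p" using B by simp
  have D: "0 < D" using Bp by (simp add: D_def add_nonneg_pos)
  have e': "0 < e'" using \<open>0 < e\<close> D by (simp add: e'_def)
  obtain d where d: "0 < d" "\<And>k. norm k < d \<Longrightarrow> norm (R k) \<le> e' * norm k ^ p"
    using small[OF e'] by blast
  have "0 < d / (B + 1)" using d B by simp
  from LIMSEQ_D[OF t(1) this] obtain n0 where n0: "\<forall>n\<ge>n0. norm (t n - 0) < d / (B + 1)" by blast
  have "norm (R (t n *\<^sub>R h n) /\<^sub>R t n ^ p - 0) < e" if "n0 \<le> n" for n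
  proof -
    have tp: "0 < t n ^ p" using t(2)[of n] by simp
    have "t n * norm (h n) \<le> t n * (B + 1)"
      using h[of n] t(2)[of n] by (intro mult_left_mono) auto
    also have "\<dots> < d" using n0[rule_format, OF that] t(2)[of n] B by (simp add: pos_less_divide_eq)
    finally have "norm (t n *\<^sub>R h n) < d" using t(2)[of n] by simp
    from d(2)[OF this] have "norm (R (t n *\<^sub>R h n)) \<le> e' * (t n ^ p * norm (h n) ^ p)"
      using t(2)[of n] by (simp add: power_mult_distrib)
    also have "\<dots> \<le> e' * (t n ^ p * B ^ p)"
      using h[of n] t(2)[of n] e' by (intro mult_left_mono power_mono) auto
    finally have "norm (R (t n *\<^sub>R h n)) / t n ^ p \<le> e' * B ^ p"
      using tp by (simp add: pos_divide_le_eq ac_simps)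
    also have "\<dots> \<le> e' * D" using e' by (simp add: D_def)
    also have "\<dots> = e / 2" using D by (simp add: e'_def)
    also have "\<dots> < e" using \<open>0 < e\<close> by simp
    finally show ?thesis using tp by (simp add: divide_inverse_commute)
  qed
  then show "\<exists>n0. \<forall>n\<ge>n0. norm (R (t n *\<^sub>R h n) /\<^sub>R t n ^ p - 0) < e" by blast
qed

lemma difference_quotient_tendsto:
  fixes F :: "'a::real_normed_vector \<Rightarrow> 'b::real_normed_vector"
  assumes F: "(F has_derivative F') (at x)"
    and t: "t \<longlonglongrightarrow> 0" "\<And>n. 0 < t n" and h: "\<And>n. norm (h n) \<le> B" "h \<longlonglongrightarrow> l"
  shows "(\<lambda>n. (F (x + t n *\<^sub>R h n) - F x) /\<^sub>R t n) \<longlonglongrightarrow> F' l"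
proof -
  interpret F': bounded_linear F' using F by (rule has_derivative_bounded_linear)
  define R where "R = (\<lambda>k. F (x + k) - F x - F' k)"
  have "(\<lambda>n. R (t n *\<^sub>R h n) /\<^sub>R t n ^ 1) \<longlonglongrightarrow> 0"
  proof (rule remainder_blowup[OF _ t h(1)])
    fix e :: real assume "0 < e"
    then obtain d where d: "0 < d" "\<forall>y. norm (y - x) < d \<longrightarrow> norm (F y - F x - F' (y - x)) \<le> e * norm (y - x)"
      using F unfolding has_derivative_at_alt by blast
    have "norm (R k) \<le> e * norm k ^ 1" if "norm k < d" for k
      using d(2)[rule_format, of "x + k"] that by (simp add: R_def)
    with d(1) show "\<exists>d>0. \<forall>k. norm k < d \<longrightarrow> norm (R k) \<le> e * norm k ^ 1" by blast
  qed
  from tendsto_add[OF this F'.tendsto[OF h(2)]]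
  have "(\<lambda>n. R (t n *\<^sub>R h n) /\<^sub>R t n + F' (h n)) \<longlonglongrightarrow> F' l" by simp
  moreover have "R (t n *\<^sub>R h n) /\<^sub>R t n + F' (h n) = (F (x + t n *\<^sub>R h n) - F x) /\<^sub>R t n" for n
    using t(2)[of n] by (simp add: R_def F'.scaleR scaleR_diff_right)
  ultimately show ?thesis by simp
qed

context reduced_composite
begin

lemma second_order_remainder:
  assumes "0 < e"
  shows "\<exists>r>0. \<forall>k. norm k < r \<longrightarrow>
    norm (f (xb + k, wb) - f (xb, wb) - vb \<bullet> k - curv k k / 2) \<le> e * norm k ^ 2"
proof -
  define p0 where "p0 = (xb, wb)"
  have "isCont f'' p0" using cf continuous_on_eq_continuous_at by blast
  from strict_derivative_bound[of f' f'' p0, OF d2f this assms] obtain r where r: "0 < r"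
    "\<And>x y. x \<in> ball p0 r \<Longrightarrow> y \<in> ball p0 r \<Longrightarrow> norm (f' x - f' y - f'' p0 (x - y)) \<le> e * norm (x - y)"
    by blast
  have f'0: "f' p0 (k, 0) = vb \<bullet> k" for k
    using arg_cong[OF crit, of "\<lambda>F. blinfun_apply F k"] by (simp add: p0_def)
  have "norm (f (xb + k, wb) - f (xb, wb) - vb \<bullet> k - curv k k / 2) \<le> e * norm k ^ 2" if k: "norm k < r" for k
  proof -
    \<comment> \<open>The linear and quadratic Taylor terms are subtracted along the segment, so
      that one application of the mean value theorem reduces the claim to the two-point bound for
      \<open>f'\<close>.\<close>
    define F where "F = (\<lambda>\<tau>. f (xb + \<tau> *\<^sub>R k, wb) - \<tau> * (vb \<bullet> k) - \<tau>\<^sup>2 / 2 * curv k k)"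
    have dF: "DERIV F \<tau> :> f' (xb + \<tau> *\<^sub>R k, wb) (k, 0) - vb \<bullet> k - \<tau> * curv k k" for \<tau>
    proof -
      have "((\<lambda>\<tau>. (xb + \<tau> *\<^sub>R k, wb)) has_derivative (\<lambda>s. (s *\<^sub>R k, 0))) (at \<tau>)"
        by (auto intro!: derivative_eq_intros)
      from diff_chain_at[OF this df] have "((\<lambda>\<tau>. f (xb + \<tau> *\<^sub>R k, wb)) has_derivative
          (\<lambda>s. f' (xb + \<tau> *\<^sub>R k, wb) (s *\<^sub>R k, 0))) (at \<tau>)" by (simp add: o_def)
      moreover have "(s *\<^sub>R k, 0::'b) = s *\<^sub>R (k, 0)" for s by simp
      ultimately have "DERIV (\<lambda>\<tau>. f (xb + \<tau> *\<^sub>R k, wb)) \<tau> :> f' (xb + \<tau> *\<^sub>R k, wb) (k, 0)"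
        by (intro has_derivative_imp_has_field_derivative[where D = "\<lambda>s. f' (xb + \<tau> *\<^sub>R k, wb) (s *\<^sub>R k, 0)"])
          (simp_all only: blinfun.scaleR_right real_scaleR_def mult.commute)
      then show ?thesis unfolding F_def by (auto intro!: derivative_eq_intros)
    qed
    obtain \<tau> where \<tau>: "0 < \<tau>" "\<tau> < 1"
      "F 1 - F 0 = (1 - 0) * (f' (xb + \<tau> *\<^sub>R k, wb) (k, 0) - vb \<bullet> k - \<tau> * curv k k)"
      using MVT2[of 0 1 F, OF _ dF] by auto
    define p where "p = (xb + \<tau> *\<^sub>R k, wb)"
    have pd: "p - p0 = \<tau> *\<^sub>R (k, 0)" by (simp add: p_def p0_def)
    have np: "norm (p - p0) \<le> norm k" unfolding pd using \<tau> by (simp add: norm_Pair mult_left_le_one_le)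
    have "norm (f' p - f' p0 - f'' p0 (p - p0)) \<le> e * norm (p - p0)"
      using np k r(1) by (intro r(2)) (auto simp: dist_norm norm_minus_commute)
    also have "\<dots> \<le> e * norm k" using np assms by (intro mult_left_mono) auto
    finally have "norm ((f' p - f' p0 - f'' p0 (p - p0)) (k, 0)) \<le> (e * norm k) * norm k"
      using order_trans[OF norm_blinfun_inl mult_right_mono[OF _ norm_ge_zero]] by blast
    moreover have "(f' p - f' p0 - f'' p0 (p - p0)) (k, 0) = F 1 - F 0"
      unfolding \<tau>(3) pd by (simp only: blinfun.diff_left blinfun.scaleR_right blinfun.scaleR_left f'0)
        (simp add: p_def curv_def p0_def)
    ultimately show ?thesis by (simp add: F_def power2_eq_square mult.assoc)
  qed
  with r(1) show ?thesis by blast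
qed

end

section \<open>Necessity: the limit of the rescaled tilted problems\<close>

context reduced_composite
begin

text \<open>For tilts \<open>vb + t s\<close> the minimizers are \<open>xb + t h\<close> with
  \<open>h\<close> bounded by the Lipschitz property, so a subsequence of the \<open>h\<close> has a
  limit \<open>x\<close>. The competitors are \<open>X (t y)\<close> with \<open>y \<in> C\<close>:
  there the new variable is \<open>t y \<in> C\<close>, hence \<open>g\<close> vanishes. The terms
  linear in \<open>vb\<close> cancel between \<open>f\<close> and the tilt, so only first order
  information on \<open>X\<close> and \<open>\<psi>\<close> enters after division by
  \<open>t^2\<close>.\<close>

lemma blow_up:
  assumes stable: "fully_stable \<phi> xb wb vb"
  obtains k where "0 < k"
    "\<And>s. \<exists>x\<in>C. \<forall>y\<in>C. curv x x / 2 + s \<bullet> (y - x) + k * (norm (y - x))\<^sup>2 \<le> curv y y / 2"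
proof -
  obtain \<xi> r K where r: "0 < r" and K: "0 < K" and \<xi>0: "\<xi> vb = xb"
    and \<xi>_lip: "\<And>v v'. v \<in> ball vb r \<Longrightarrow> v' \<in> ball vb r \<Longrightarrow> norm (\<xi> v - \<xi> v') \<le> K * norm (v - v')"
    and growth: "\<And>v x. v \<in> ball vb r \<Longrightarrow> x \<in> ball xb r \<Longrightarrow>
        \<phi> (\<xi> v, wb) + ereal (v \<bullet> (x - \<xi> v) + (norm (x - \<xi> v))\<^sup>2 / (4 * K)) \<le> \<phi> (x, wb)"
    using fully_stable_growth[OF stable] by metis
  obtain X X' rX \<gamma> L where rX: "0 < rX"
    and \<psi>X: "\<And>u. u \<in> ball (0, wb) rX \<Longrightarrow> \<psi> (X u, snd u) = fst u"
    and dX: "\<And>y w. (y, w) \<in> ball (0, wb) rX \<Longrightarrow> ((\<lambda>y. X (y, w)) has_derivative blinfun_apply (X' (y, w))) (at y)"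
    and X'0: "X' (0, wb) = id_blinfun" and X0: "X (0, wb) = xb"
    apply (rule parametric_inverse[OF d\<psi> d2\<psi> c\<psi> \<psi>_base \<psi>'_base])
    subgoal premises prems by (rule prems(1)[OF prems(2) prems(5) prems(7) prems(9,10)])
    done
  obtain rp where rp: "0 < rp" "\<And>p. p \<in> ball (xb, wb) rp \<Longrightarrow> \<phi> p = ereal (f p) + g (\<psi> p)"
    using repr unfolding eventually_nhds_metric by (metis dist_commute mem_ball)
  have dX0: "((\<lambda>y. X (y, wb)) has_derivative (\<lambda>k. k)) (at 0)"
    using dX[of 0 wb] rX X'0 by simp
  have d\<psi>0: "((\<lambda>x. \<psi> (x, wb)) has_derivative (\<lambda>k. k)) (at xb)"
    using has_derivative_partial_fst[OF d\<psi>[of "(xb, wb)"]] \<psi>'_base by simp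
  define R where "R = (\<lambda>k. f (xb + k, wb) - f (xb, wb) - vb \<bullet> k - curv k k / 2)"
  have R_small: "\<exists>d>0. \<forall>k. norm k < d \<longrightarrow> norm (R k) \<le> e * norm k ^ 2" if "0 < e" for e
    using second_order_remainder[OF that] by (simp only: R_def)
  have main: "\<exists>x\<in>C. \<forall>y\<in>C. curv x x / 2 + s \<bullet> (y - x) + 1 / (4 * K) * (norm (y - x))\<^sup>2 \<le> curv y y / 2" for s
  proof -
    \<comment> \<open>Scales the sequence so that all tilts stay in the ball of radius
      \<open>r\<close>; the 1 covers \<open>s = 0\<close>.\<close>
    define \<tau> where "\<tau> = r / (norm s + 1)"
    have ns: "0 < norm s + 1" by (simp add: add_nonneg_pos)
    have \<tau>: "0 < \<tau>" using r ns by (simp add: \<tau>_def)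
    have \<tau>s: "\<tau> * norm s < r" using r ns by (simp add: \<tau>_def pos_divide_less_eq)
    define t0 where "t0 = (\<lambda>n. \<tau> * inverse (real (Suc n)))"
    have t0: "0 < t0 n" "t0 n \<le> \<tau>" for n
      using \<tau> by (simp_all add: t0_def mult_left_le inverse_le_1_iff)
    have t0_lim: "t0 \<longlonglongrightarrow> 0"
      unfolding t0_def using tendsto_mult_right_zero[OF LIMSEQ_inverse_real_of_nat] by simp
    have v_in: "vb + t0 n *\<^sub>R s \<in> ball vb r" for n
    proof -
      have "t0 n * norm s \<le> \<tau> * norm s" by (intro mult_right_mono t0) simp
      then show ?thesis using \<tau>s t0(1)[of n] by (simp add: dist_norm)
    qed
    define \<eta>0 where "\<eta>0 = (\<lambda>n. (\<xi> (vb + t0 n *\<^sub>R s) - xb) /\<^sub>R t0 n)"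
    have \<eta>0_bd: "\<eta>0 n \<in> cball 0 (K * norm s)" for n
    proof -
      have "norm (\<xi> (vb + t0 n *\<^sub>R s) - xb) \<le> K * (t0 n * norm s)"
        using \<xi>_lip[OF v_in, of vb n] r \<xi>0 t0(1)[of n] by simp
      moreover have "norm (\<eta>0 n) = norm (\<xi> (vb + t0 n *\<^sub>R s) - xb) / t0 n"
        using t0(1)[of n] by (simp add: \<eta>0_def divide_inverse_commute)
      ultimately show ?thesis using t0(1)[of n] by (simp add: pos_divide_le_eq ac_simps)
    qed
    obtain x \<sigma> where \<sigma>: "strict_mono \<sigma>" "(\<eta>0 \<circ> \<sigma>) \<longlonglongrightarrow> x"
      using compact_cball[of 0 "K * norm s"] \<eta>0_bd unfolding compact_def by blast
    define t where "t = t0 \<circ> \<sigma>"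
    define h where "h = \<eta>0 \<circ> \<sigma>"
    have t: "t \<longlonglongrightarrow> 0" "\<And>n. 0 < t n"
      using LIMSEQ_subseq_LIMSEQ[OF t0_lim \<sigma>(1)] t0(1) by (auto simp: t_def)
    have h: "\<And>n. norm (h n) \<le> K * norm s" "h \<longlonglongrightarrow> x"
      using \<eta>0_bd \<sigma>(2) by (auto simp: h_def)
    have \<xi>t: "\<xi> (vb + t n *\<^sub>R s) = xb + t n *\<^sub>R h n" "vb + t n *\<^sub>R s \<in> ball vb r" for n
      using t(2)[of n] v_in by (simp_all add: t_def h_def \<eta>0_def)
    have th: "(\<lambda>n. t n *\<^sub>R h n) \<longlonglongrightarrow> 0" using tendsto_scaleR[OF t(1) h(2)] by simp
    have near: "\<forall>\<^sub>F n in sequentially. (xb + t n *\<^sub>R h n, wb) \<in> ball (xb, wb) rp"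
    proof -
      have "(\<lambda>n. (xb + t n *\<^sub>R h n, wb)) \<longlonglongrightarrow> (xb + 0, wb)"
        by (intro tendsto_intros th)
      from tendstoD[OF this rp(1)] show ?thesis by (simp add: dist_commute)
    qed
    define dst where "dst = (\<lambda>n. norm (\<psi> (xb + t n *\<^sub>R h n, wb) - closest_point C (\<psi> (xb + t n *\<^sub>R h n, wb))))"
    \<comment> \<open>The growth inequality at \<open>\<xi> (vb + t s)\<close>, divided by \<open>t\<^sup>2\<close>.\<close>
    have scaled: "\<exists>k. k \<longlonglongrightarrow> y \<and> (y = 0 \<longrightarrow> k = (\<lambda>n. 0)) \<and> (\<exists>\<epsilon>. \<epsilon> \<longlonglongrightarrow> 0 \<and> (\<forall>\<^sub>F n in sequentially.
        curv (h n) (h n) / 2 + c * dst n / (t n)\<^sup>2 + s \<bullet> (k n - h n) + (norm (k n - h n))\<^sup>2 / (4 * K)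
          \<le> curv (k n) (k n) / 2 + \<epsilon> n))" if y: "y \<in> C" for y
    proof -
      \<comment> \<open>The rescaled competitor. It tends to \<open>y\<close>, as \<open>X\<close>
        has the identity as derivative at \<open>0\<close>; for \<open>y = 0\<close> it is exactly
        zero, which makes the comparison with \<open>xb\<close> explicit.\<close>
      define k where "k = (\<lambda>n. (X (t n *\<^sub>R y, wb) - xb) /\<^sub>R t n)"
      have k: "k \<longlonglongrightarrow> y"
        using difference_quotient_tendsto[OF dX0 t, of "\<lambda>_. y" "norm y" y] X0 by (simp add: k_def)
      have k0: "y = 0 \<longrightarrow> k = (\<lambda>n. 0)" by (simp add: k_def X0)
      obtain Bk where Bk: "\<And>n. norm (k n) \<le> Bk"
        using convergent_imp_Bseq[of k] k unfolding convergent_def Bseq_def by blast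
      define \<epsilon> where "\<epsilon> = (\<lambda>n. R (t n *\<^sub>R k n) /\<^sub>R (t n)\<^sup>2 - R (t n *\<^sub>R h n) /\<^sub>R (t n)\<^sup>2)"
      have \<epsilon>: "\<epsilon> \<longlonglongrightarrow> 0"
        unfolding \<epsilon>_def
        using tendsto_diff[OF remainder_blowup[OF R_small t Bk] remainder_blowup[OF R_small t h(1)]] by simp
      have Xk: "X (t n *\<^sub>R y, wb) = xb + t n *\<^sub>R k n" for n using t(2)[of n] by (simp add: k_def)
      have tk: "(\<lambda>n. t n *\<^sub>R k n) \<longlonglongrightarrow> 0" using tendsto_scaleR[OF t(1) k] by simp
      have nearX: "\<forall>\<^sub>F n in sequentially. (xb + t n *\<^sub>R k n, wb) \<in> ball (xb, wb) rp"
      proof -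
        have "(\<lambda>n. (xb + t n *\<^sub>R k n, wb)) \<longlonglongrightarrow> (xb + 0, wb)"
          by (intro tendsto_intros tk)
        from tendstoD[OF this rp(1)] show ?thesis by (simp add: dist_commute)
      qed
      have nearx: "\<forall>\<^sub>F n in sequentially. xb + t n *\<^sub>R k n \<in> ball xb r"
        using tendstoD[OF tk r] by (simp add: dist_norm)
      have neary: "\<forall>\<^sub>F n in sequentially. (t n *\<^sub>R y, wb) \<in> ball (0, wb) rX"
      proof -
        have "(\<lambda>n. (t n *\<^sub>R y, wb)) \<longlonglongrightarrow> (0 *\<^sub>R y, wb)"
          by (intro tendsto_intros t)
        from tendstoD[OF this rX] show ?thesis by (simp add: dist_commute)
      qed
      have "\<forall>\<^sub>F n in sequentially.
        curv (h n) (h n) / 2 + c * dst n / (t n)\<^sup>2 + s \<bullet> (k n - h n) + (norm (k n - h n))\<^sup>2 / (4 * K)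
          \<le> curv (k n) (k n) / 2 + \<epsilon> n"
        using near nearX nearx neary
      proof eventually_elim
        case (elim n)
        define T where "T = t n"
        have T: "0 < T" using t(2) by (simp add: T_def)
        define p where "p = xb + T *\<^sub>R h n"
        define q where "q = xb + T *\<^sub>R k n"
        have "T *\<^sub>R y \<in> C" using C(3) y T by (simp add: cone_def)
        moreover have "\<psi> (q, wb) = T *\<^sub>R y" using \<psi>X[OF elim(4)] Xk[of n] by (simp add: q_def T_def)
        ultimately have \<phi>q: "\<phi> (q, wb) = ereal (f (q, wb))"
          using rp(2)[OF elim(2)] g_C by (simp add: q_def T_def)
        have \<phi>p: "\<phi> (p, wb) = ereal (f (p, wb)) + g (\<psi> (p, wb))"
          using rp(2)[OF elim(1)] by (simp add: p_def T_def)
        have qp: "q - p = T *\<^sub>R (k n - h n)" by (simp add: p_def q_def scaleR_diff_right)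
        have gr: "\<phi> (p, wb) + ereal ((vb + T *\<^sub>R s) \<bullet> (q - p) + (norm (q - p))\<^sup>2 / (4 * K)) \<le> ereal (f (q, wb))"
          using growth[OF \<xi>t(2)[of n] elim(3)] \<phi>q \<xi>t(1)[of n] by (simp add: p_def q_def T_def)
        have gd: "ereal (c * dst n) \<le> g (\<psi> (p, wb))"
          using g_error[of "\<psi> (p, wb)"] by (simp add: dst_def p_def T_def)
        have "ereal (f (p, wb) + c * dst n + ((vb + T *\<^sub>R s) \<bullet> (q - p) + (norm (q - p))\<^sup>2 / (4 * K))) \<le>
            \<phi> (p, wb) + ereal ((vb + T *\<^sub>R s) \<bullet> (q - p) + (norm (q - p))\<^sup>2 / (4 * K))"
          unfolding \<phi>p plus_ereal.simps(1)[symmetric] by (intro add_mono gd order_refl)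
        also note gr
        finally have le: "f (p, wb) + c * dst n + ((vb + T *\<^sub>R s) \<bullet> (q - p) + (norm (q - p))\<^sup>2 / (4 * K)) \<le> f (q, wb)"
          by simp
        have fp: "f (p, wb) = f (xb, wb) + T * (vb \<bullet> h n) + T\<^sup>2 * (curv (h n) (h n) / 2) + R (T *\<^sub>R h n)"
          by (simp add: R_def p_def bounded_bilinear.scaleR_left[OF bilinear_curv]
              bounded_bilinear.scaleR_right[OF bilinear_curv] power2_eq_square)
        have fq: "f (q, wb) = f (xb, wb) + T * (vb \<bullet> k n) + T\<^sup>2 * (curv (k n) (k n) / 2) + R (T *\<^sub>R k n)"
          by (simp add: R_def q_def bounded_bilinear.scaleR_left[OF bilinear_curv]
              bounded_bilinear.scaleR_right[OF bilinear_curv] power2_eq_square)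
        have in1: "(vb + T *\<^sub>R s) \<bullet> (q - p) = T * (vb \<bullet> k n) - T * (vb \<bullet> h n) + T\<^sup>2 * (s \<bullet> (k n - h n))"
          by (simp add: qp inner_add_left inner_diff_right power2_eq_square algebra_simps)
        have n2: "(norm (q - p))\<^sup>2 / (4 * K) = T\<^sup>2 * ((norm (k n - h n))\<^sup>2 / (4 * K))"
          by (simp add: qp power_mult_distrib)
        have "T\<^sup>2 * (curv (h n) (h n) / 2) + c * dst n + T\<^sup>2 * (s \<bullet> (k n - h n)) + T\<^sup>2 * ((norm (k n - h n))\<^sup>2 / (4 * K))
            \<le> T\<^sup>2 * (curv (k n) (k n) / 2) + (R (T *\<^sub>R k n) - R (T *\<^sub>R h n))"
          using le unfolding fp fq in1 n2 by linarith
        moreover have "c * dst n = T\<^sup>2 * (c * dst n / T\<^sup>2)" using T by simp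
        moreover have "\<epsilon> n = (R (T *\<^sub>R k n) - R (T *\<^sub>R h n)) / T\<^sup>2"
          by (simp add: \<epsilon>_def T_def right_diff_distrib divide_inverse_commute)
        then have "R (T *\<^sub>R k n) - R (T *\<^sub>R h n) = T\<^sup>2 * \<epsilon> n" using T by simp
        ultimately have "T\<^sup>2 * (curv (h n) (h n) / 2 + c * dst n / T\<^sup>2 + s \<bullet> (k n - h n) + (norm (k n - h n))\<^sup>2 / (4 * K))
            \<le> T\<^sup>2 * (curv (k n) (k n) / 2 + \<epsilon> n)"
          by (simp only: distrib_left)
        then show ?case using T by (simp add: T_def mult_le_cancel_left_pos)
      qed
      with k k0 \<epsilon> show ?thesis by blast
    qed
    have curv_lim: "(\<lambda>n. curv (k n) (k n) / 2) \<longlonglongrightarrow> curv y y / 2" if "k \<longlonglongrightarrow> y" for k y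
      by (intro tendsto_divide bounded_bilinear.tendsto[OF bilinear_curv] that tendsto_const) simp
    have "x \<in> C"
    proof -
      define p where "p = (\<lambda>n. \<psi> (xb + t n *\<^sub>R h n, wb))"
      \<comment> \<open>Comparison with \<open>xb\<close> bounds \<open>dst / t^2\<close> by the
        convergent sequence \<open>E\<close>. So \<open>dst / t\<close> tends to zero, and the
        rescaled projections, which lie in the closed cone, have the same limit \<open>x\<close> as
        the rescaled points \<open>p\<close>.\<close>
      obtain \<epsilon> where \<epsilon>: "\<epsilon> \<longlonglongrightarrow> 0" "\<forall>\<^sub>F n in sequentially.
        curv (h n) (h n) / 2 + c * dst n / (t n)\<^sup>2 + s \<bullet> (0 - h n) + (norm (0 - h n))\<^sup>2 / (4 * K)
          \<le> curv 0 0 / 2 + \<epsilon> n"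
        using scaled[OF C(4)] by fastforce
      define E where "E = (\<lambda>n. (curv 0 0 / 2 + \<epsilon> n - curv (h n) (h n) / 2 - s \<bullet> (0 - h n) - (norm (0 - h n))\<^sup>2 / (4 * K)) / c)"
      have "E \<longlonglongrightarrow> (curv 0 0 / 2 + 0 - curv x x / 2 - s \<bullet> (0 - x) - (norm (0 - x))\<^sup>2 / (4 * K)) / c"
        unfolding E_def using c K by (intro tendsto_intros curv_lim h \<epsilon>) auto
      from tendsto_mult[OF t(1) this] have tE: "(\<lambda>n. t n * E n) \<longlonglongrightarrow> 0" by simp
      have "\<forall>\<^sub>F n in sequentially. norm ((p n - closest_point C (p n)) /\<^sub>R t n) \<le> t n * E n"
        using \<epsilon>(2)
      proof eventually_elim
        case (elim n)
        then have "c * dst n / (t n)\<^sup>2 \<le> c * E n" using c by (simp add: E_def)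
        then have "dst n / (t n)\<^sup>2 \<le> E n" using c by (simp add: mult_le_cancel_left_pos flip: times_divide_eq_right)
        then have "t n * (dst n / (t n)\<^sup>2) \<le> t n * E n" using t(2)[of n] by (intro mult_left_mono) auto
        moreover have "t n * (dst n / (t n)\<^sup>2) = dst n / t n"
          using t(2)[of n] by (simp add: power2_eq_square)
        moreover have "norm ((p n - closest_point C (p n)) /\<^sub>R t n) = dst n / t n"
          using t(2)[of n] by (simp add: dst_def p_def divide_inverse_commute)
        ultimately show ?case by simp
      qed
      then have "(\<lambda>n. (p n - closest_point C (p n)) /\<^sub>R t n) \<longlonglongrightarrow> 0"
        by (rule Lim_null_comparison[OF _ tE])
      moreover have "(\<lambda>n. p n /\<^sub>R t n) \<longlonglongrightarrow> x"
        using difference_quotient_tendsto[OF d\<psi>0 t h] \<psi>_base by (simp add: p_def)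
      ultimately have "(\<lambda>n. p n /\<^sub>R t n - (p n - closest_point C (p n)) /\<^sub>R t n) \<longlonglongrightarrow> x - 0"
        by (intro tendsto_diff)
      then have lim: "(\<lambda>n. closest_point C (p n) /\<^sub>R t n) \<longlonglongrightarrow> x" by (simp add: scaleR_diff_right)
      have "closest_point C (p n) /\<^sub>R t n \<in> C" for n
      proof -
        have "closest_point C (p n) \<in> C" using C by (intro closest_point_in_set) auto
        then show ?thesis using C(3) t(2)[of n] by (simp add: cone_def)
      qed
      then show ?thesis using closed_sequentially[OF C(1) _ lim] by blast
    qed
    moreover have "curv x x / 2 + s \<bullet> (y - x) + 1 / (4 * K) * (norm (y - x))\<^sup>2 \<le> curv y y / 2" if y: "y \<in> C" for y
    proof -
      obtain k \<epsilon> where k: "k \<longlonglongrightarrow> y" and \<epsilon>: "\<epsilon> \<longlonglongrightarrow> 0" and ev: "\<forall>\<^sub>F n in sequentially.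
        curv (h n) (h n) / 2 + c * dst n / (t n)\<^sup>2 + s \<bullet> (k n - h n) + (norm (k n - h n))\<^sup>2 / (4 * K)
          \<le> curv (k n) (k n) / 2 + \<epsilon> n"
        using scaled[OF y] by blast
      have "\<forall>\<^sub>F n in sequentially. curv (h n) (h n) / 2 + s \<bullet> (k n - h n) + (norm (k n - h n))\<^sup>2 / (4 * K)
          \<le> curv (k n) (k n) / 2 + \<epsilon> n"
        using ev
      proof eventually_elim
        case (elim n)
        have "0 \<le> c * dst n / (t n)\<^sup>2" using c by (simp add: dst_def)
        with elim show ?case by linarith
      qed
      moreover have "(\<lambda>n. curv (h n) (h n) / 2 + s \<bullet> (k n - h n) + (norm (k n - h n))\<^sup>2 / (4 * K))
          \<longlonglongrightarrow> curv x x / 2 + s \<bullet> (y - x) + (norm (y - x))\<^sup>2 / (4 * K)"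
        using K by (intro tendsto_intros curv_lim h k) auto
      moreover have "(\<lambda>n. curv (k n) (k n) / 2 + \<epsilon> n) \<longlonglongrightarrow> curv y y / 2 + 0"
        by (intro tendsto_add curv_lim k \<epsilon>)
      ultimately have "curv x x / 2 + s \<bullet> (y - x) + (norm (y - x))\<^sup>2 / (4 * K) \<le> curv y y / 2 + 0"
        using tendsto_le[OF sequentially_bot] by blast
      then show ?thesis by simp
    qed
    ultimately show ?thesis by blast
  qed
  show thesis by (rule that[of "1 / (4 * K)"]) (use K main in auto)
qed

theorem positive_definite_if_fully_stable:
  assumes stable: "fully_stable \<phi> xb wb vb"
    and e: "e \<in> C" "0 < \<rho>" "\<And>u. u \<in> U \<Longrightarrow> norm u \<le> \<rho> \<Longrightarrow> e + u \<in> C"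
    and u: "u \<in> U" "u \<noteq> 0"
  shows "0 < curv u u"
proof -
  obtain k where k: "0 < k"
    and ex: "\<And>s. \<exists>x\<in>C. \<forall>y\<in>C. curv x x / 2 + s \<bullet> (y - x) + k * (norm (y - x))\<^sup>2 \<le> curv y y / 2"
    using blow_up[OF stable] by blast
  have cont: "continuous_on UNIV (\<lambda>x. curv x x / 2)"
    by (intro continuous_on_divide bounded_bilinear.continuous_on[OF bilinear_curv]) auto
  obtain s where s: "\<And>y. y \<in> C \<Longrightarrow> curv e e / 2 + s \<bullet> (y - e) + k * (norm (y - e))\<^sup>2 \<le> curv y y / 2"
    using attained_tilt[OF U e cont k ex] by blast
  define v where "v = (\<rho> / norm u) *\<^sub>R u"
  have v: "v \<in> U" "norm v = \<rho>" using u U e(2) by (simp_all add: v_def subspace_scale)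
  have "e + v \<in> C" "e + - v \<in> C" using v U by (intro e(3); simp add: subspace_neg)+
  \<comment> \<open>In the sum the tilt \<open>s\<close> cancels, and the parallelogram identity for
    the form leaves \<open>curv v v\<close>.\<close>
  from s[OF this(1)] s[OF this(2)] have "2 * k * \<rho>\<^sup>2 \<le> curv v v"
    using v by (simp add: bounded_bilinear.add_left[OF bilinear_curv] bounded_bilinear.add_right[OF bilinear_curv]
        bounded_bilinear.diff_left[OF bilinear_curv] bounded_bilinear.diff_right[OF bilinear_curv])
  moreover have "0 < 2 * k * \<rho>\<^sup>2" using k e(2) by simp
  ultimately have "0 < curv v v" by linarith
  then have "0 < (\<rho> / norm u) * ((\<rho> / norm u) * curv u u)"
    by (simp add: v_def bounded_bilinear.scaleR_left[OF bilinear_curv] bounded_bilinear.scaleR_right[OF bilinear_curv])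
  moreover have "0 < \<rho> / norm u" using u e(2) by simp
  ultimately show ?thesis by (simp only: zero_less_mult_iff) (auto)
qed

end

subsection \<open>Polyhedral cones\<close>

lemma open_halfspaces_cball:
  fixes c :: "'i \<Rightarrow> 'a::euclidean_space"
  assumes "finite J" "\<And>i. i \<in> J \<Longrightarrow> c i \<bullet> x < b i"
  obtains r where "0 < r" "\<And>u i. norm u \<le> r \<Longrightarrow> i \<in> J \<Longrightarrow> c i \<bullet> (x + u) < b i"
proof -
  define S where "S = (\<Inter>i\<in>J. {y. c i \<bullet> y < b i})"
  have "open S" unfolding S_def using assms(1) by (intro open_INT ballI open_halfspace_lt)
  moreover have "x \<in> S" using assms(2) by (simp add: S_def)
  ultimately obtain r where r: "0 < r" "cball x r \<subseteq> S" by (metis open_contains_cball)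
  show thesis
  proof (rule that[OF r(1)])
    fix u :: 'a and i assume "norm u \<le> r" "i \<in> J"
    then have "x + u \<in> S" using r(2) by (auto simp: dist_norm)
    with \<open>i \<in> J\<close> show "c i \<bullet> (x + u) < b i" by (simp add: S_def)
  qed
qed

text \<open>A unit vector normal to the cone at a point with active set \<open>A\<close> lies in the polar cone of
  \<open>{u. \<forall>i\<in>A. c i \<bullet> u \<le> 0}\<close>, hence outside that cone itself; compactness makes this uniform.\<close>

lemma polyhedral_cone_error_bound:
  fixes c :: "'i \<Rightarrow> 'a::euclidean_space"
  assumes fin: "finite I"
  defines "C \<equiv> {y. \<forall>i\<in>I. c i \<bullet> y \<le> 0}"
  obtains \<delta> where "0 < \<delta>" "\<And>y m. 0 \<le> m \<Longrightarrow> (\<And>i. i \<in> I \<Longrightarrow> c i \<bullet> y \<le> m) \<Longrightarrow>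
      \<delta> * norm (y - closest_point C y) \<le> m"
proof -
  \<comment> \<open>Unit vectors of the polar of the cone cut out by the constraints in
    \<open>A\<close>; \<open>\<Phi> A\<close> below measures the total violation of these
    constraints.\<close>
  define P where "P = (\<lambda>A. sphere 0 1 \<inter> (\<Inter>u\<in>{u. \<forall>i\<in>A. c i \<bullet> u \<le> 0}. {n. u \<bullet> n \<le> 0}))"
  define \<Phi> where "\<Phi> = (\<lambda>A n. \<Sum>i\<in>A. max 0 (c i \<bullet> n))"
  have ex: "\<exists>\<delta>>0. \<forall>n\<in>P A. \<delta> \<le> \<Phi> A n" if A: "A \<subseteq> I" for A
  proof (cases "P A = {}")
    case False
    have finA: "finite A" using A fin finite_subset by blast
    have "compact (P A)" unfolding P_def
      by (intro compact_Int_closed compact_sphere closed_INT ballI closed_halfspace_le)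
    moreover have "continuous_on (P A) (\<Phi> A)"
      unfolding \<Phi>_def by (intro continuous_intros)
    ultimately obtain n where n: "n \<in> P A" "\<And>n'. n' \<in> P A \<Longrightarrow> \<Phi> A n \<le> \<Phi> A n'"
      using continuous_attains_inf[OF _ False] by meson
    have "0 < \<Phi> A n"
    proof (rule ccontr)
      assume "\<not> 0 < \<Phi> A n"
      moreover have "0 \<le> \<Phi> A n" unfolding \<Phi>_def by (intro sum_nonneg) simp
      ultimately have "\<Phi> A n = 0" by simp
      then have "\<forall>i\<in>A. max 0 (c i \<bullet> n) = 0"
        unfolding \<Phi>_def using finA by (subst (asm) sum_nonneg_eq_0_iff) auto
      then have "\<forall>i\<in>A. c i \<bullet> n \<le> 0" by (metis max.cobounded2)
      with n(1) have "n \<bullet> n \<le> 0" by (auto simp: P_def)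
      moreover have "norm n = 1" using n(1) by (simp add: P_def)
      ultimately show False by (simp add: norm_eq_sqrt_inner)
    qed
    with n(2) show ?thesis by blast
  qed (use zero_less_one in blast)
  then obtain \<delta>' where \<delta>': "\<And>A. A \<subseteq> I \<Longrightarrow> 0 < \<delta>' A" "\<And>A n. A \<subseteq> I \<Longrightarrow> n \<in> P A \<Longrightarrow> \<delta>' A \<le> \<Phi> A n"
    by metis
  \<comment> \<open>There are finitely many active sets, so the constants from compactness have a
    positive minimum.\<close>
  define \<delta>0 where "\<delta>0 = Min (\<delta>' ` Pow I)"
  have finP: "finite (\<delta>' ` Pow I)" "\<delta>' ` Pow I \<noteq> {}" using fin by auto
  have \<delta>0: "0 < \<delta>0" "\<And>A n. A \<subseteq> I \<Longrightarrow> n \<in> P A \<Longrightarrow> \<delta>0 \<le> \<Phi> A n"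
  proof -
    show "0 < \<delta>0" unfolding \<delta>0_def using finP \<delta>'(1) by (subst Min_gr_iff) auto
    show "\<delta>0 \<le> \<Phi> A n" if "A \<subseteq> I" "n \<in> P A" for A n
    proof -
      have "\<delta>0 \<le> \<delta>' A" unfolding \<delta>0_def using that finP by (intro Min_le) auto
      then show ?thesis using \<delta>'(2)[OF that] by simp
    qed
  qed
  have C: "closed C" "convex C" "C \<noteq> {}"
  proof -
    have eq: "C = (\<Inter>i\<in>I. {y. c i \<bullet> y \<le> 0})" by (auto simp: C_def)
    show "closed C" unfolding eq by (intro closed_INT ballI closed_halfspace_le)
    show "convex C" unfolding eq by (intro convex_INT convex_halfspace_le)
    have "0 \<in> C" by (simp add: C_def)
    then show "C \<noteq> {}" by blast
  qed
  define N where "N = real (card I) + 1"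
  have N: "0 < N" by (simp add: N_def)
  show thesis
  proof (rule that[of "\<delta>0 / N"])
    show "0 < \<delta>0 / N" using \<delta>0 N by simp
    fix y :: 'a and m :: real
    assume m: "0 \<le> m" and viol: "\<And>i. i \<in> I \<Longrightarrow> c i \<bullet> y \<le> m"
    define \<pi> where "\<pi> = closest_point C y"
    define t where "t = norm (y - \<pi>)"
    show "\<delta>0 / N * norm (y - closest_point C y) \<le> m"
    proof (cases "t = 0")
      case True then show ?thesis using m by (simp add: t_def \<pi>_def)
    next
      case False
      then have t: "0 < t" by (simp add: t_def)
      define n where "n = (y - \<pi>) /\<^sub>R t"
      define A where "A = {i\<in>I. c i \<bullet> \<pi> = 0}"
      have A: "A \<subseteq> I" by (auto simp: A_def)
      have \<pi>: "\<pi> \<in> C" unfolding \<pi>_def by (rule closest_point_in_set[OF C(1,3)])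
      have "n \<in> P A"
      proof -
        have "u \<bullet> n \<le> 0" if u: "\<forall>i\<in>A. c i \<bullet> u \<le> 0" for u
        proof -
          have strict: "c i \<bullet> \<pi> < 0" if "i \<in> I - A" for i
            using \<pi> that by (auto simp: C_def A_def intro: le_neq_trans)
          obtain r where r: "0 < r" "\<And>v i. norm v \<le> r \<Longrightarrow> i \<in> I - A \<Longrightarrow> c i \<bullet> (\<pi> + v) < 0"
            using open_halfspaces_cball[of "I - A" c \<pi> "\<lambda>_. 0", OF finite_Diff[OF fin] strict] by blast
          define e where "e = r / (norm u + 1)"
          have nu: "0 < norm u + 1" by (simp add: add_nonneg_pos)
          have e: "0 < e" "norm (e *\<^sub>R u) \<le> r" using r(1) nu by (simp_all add: e_def pos_divide_le_eq)
          have "\<pi> + e *\<^sub>R u \<in> C"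
          proof -
            have "c i \<bullet> (\<pi> + e *\<^sub>R u) \<le> 0" if "i \<in> I" for i
            proof (cases "i \<in> A")
              case True
              then show ?thesis using u e(1) by (simp add: A_def inner_add_right mult_nonneg_nonpos)
            next
              case False
              then show ?thesis using r(2)[OF e(2), of i] that by simp
            qed
            then show ?thesis by (simp add: C_def)
          qed
          from closest_point_dot[OF C(2,1) this, of y] have "(y - \<pi>) \<bullet> (e *\<^sub>R u) \<le> 0" by (simp add: \<pi>_def)
          then have "(y - \<pi>) \<bullet> u \<le> 0" using e(1) by (simp add: mult_le_0_iff)
          then show ?thesis using t by (simp add: n_def inner_commute mult_le_0_iff)
        qed
        moreover have "norm n = 1" using t by (simp add: n_def t_def)
        ultimately show ?thesis by (simp add: P_def)
      qed
      \<comment> \<open>Active constraints vanish at \<open>\<pi>\<close>, so at the normal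
        \<open>n\<close> they take their values at \<open>y\<close> divided by \<open>t\<close>,
        each at most \<open>m / t\<close>; summing over \<open>A\<close> costs the factor
        \<open>N\<close>.\<close>
      from \<delta>0(2)[OF A this] have "\<delta>0 \<le> (\<Sum>i\<in>A. max 0 (c i \<bullet> n))" by (simp add: \<Phi>_def)
      also have "\<dots> \<le> (\<Sum>i\<in>A. m / t)"
      proof (rule sum_mono)
        fix i assume i: "i \<in> A"
        have "c i \<bullet> n = c i \<bullet> y / t" using i by (simp add: n_def A_def inner_diff_right divide_inverse_commute)
        also have "\<dots> \<le> m / t" using viol[of i] i A t by (intro divide_right_mono) auto
        finally show "max 0 (c i \<bullet> n) \<le> m / t" using m t by simp
      qed
      also have "\<dots> = real (card A) * (m / t)" by simp
      also have "\<dots> \<le> N * (m / t)"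
        using m t card_mono[OF fin A] by (intro mult_right_mono) (simp_all add: N_def)
      finally have "\<delta>0 * t \<le> N * m" using t by (simp add: pos_le_divide_eq)
      then show ?thesis using N by (simp add: t_def \<pi>_def pos_divide_le_eq mult.commute)
    qed
  qed
qed

lemma parallel_subspace_properties:
  fixes C :: "'a::euclidean_space set"
  assumes "C \<noteq> {}"
  shows "subspace (parallel_subspace C)"
    and "x \<in> C \<Longrightarrow> y \<in> C \<Longrightarrow> x - y \<in> parallel_subspace C"
proof -
  have "\<exists>!L. subspace L \<and> affine_parallel (affine hull C) L"
    using assms by (intro affine_parallel_subspace) auto
  from theI'[OF this] have L: "subspace (parallel_subspace C)" "affine_parallel (affine hull C) (parallel_subspace C)"
    unfolding parallel_subspace_def by auto
  show "subspace (parallel_subspace C)" by (rule L(1))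
  show "x - y \<in> parallel_subspace C" if "x \<in> C" "y \<in> C"
  proof -
    obtain b where b: "parallel_subspace C = (\<lambda>x. b + x) ` (affine hull C)"
      using L(2) unfolding affine_parallel_def by blast
    have "b + x \<in> parallel_subspace C" "b + y \<in> parallel_subspace C"
      unfolding b using that by (auto intro: hull_inc)
    from subspace_diff[OF L(1) this] show ?thesis by simp
  qed
qed

subsection \<open>The local model of a CPWL function\<close>

locale cpwl_multiplier =
  fixes \<theta> :: "'a::euclidean_space \<Rightarrow> ereal" and l p :: nat and a d :: "nat \<Rightarrow> 'a"
    and \<alpha> \<beta> :: "nat \<Rightarrow> real" and zb lam :: 'a and \<eta> \<mu> :: "nat \<Rightarrow> real" and K I J1 J2 :: "nat set" and G :: "'a set"
  assumes rep: "CPWL_representation \<theta> l a \<alpha> p d \<beta>" and zb: "zb \<in> dom_of \<theta>"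
    and lam_sub: "lam \<in> subdifferential \<theta> zb"
    and lam_rep: "multiplier_representation a d K I lam \<eta> \<mu>"
    and K_def: "K = active_K l a \<alpha> zb" and I_def: "I = active_I p d \<beta> zb"
    and J1_def: "J1 = positive_indices K \<eta>" and J2_def: "J2 = positive_indices I \<mu>"
    and G_def: "G = cone_G a d K I J1 J2"
begin

definition \<theta>b :: real where "\<theta>b = Max ((\<lambda>i. a i \<bullet> zb - \<alpha> i) ` {1..l})"

definition S :: "'a set" where "S = parallel_subspace (subdifferential \<theta> zb)"

text \<open>The directional derivative of \<open>\<theta>\<close> at \<open>zb\<close> minus the
  linear function given by \<open>lam\<close>; equivalently, the support function of the
  subdifferential translated by \<open>- lam\<close>.\<close>

definition model :: "'a \<Rightarrow> ereal" where
  "model z = (if \<forall>t\<in>I. d t \<bullet> z \<le> 0 then ereal (Max ((\<lambda>i. (a i - lam) \<bullet> z) ` K)) else \<infinity>)"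

text \<open>Normals of \<open>G\<close>. The equalities for \<open>J1\<close> arise because
  \<open>a i - a j\<close> occurs in both orders, those for \<open>J2\<close> because
  \<open>d t\<close> occurs with both signs; this makes the error bound for finitely many
  inequalities applicable.\<close>

definition constraints :: "'a set" where
  "constraints = (\<lambda>(i, j). a i - a j) ` (K \<times> J1) \<union> d ` I \<union> (\<lambda>t. - d t) ` J2"

lemma dom_iff: "z \<in> dom_of \<theta> \<longleftrightarrow> (\<forall>i\<in>{1..p}. d i \<bullet> z \<le> \<beta> i)"
  using rep unfolding CPWL_representation_def by blast

lemma \<theta>_dom: "z \<in> dom_of \<theta> \<Longrightarrow> \<theta> z = ereal (Max ((\<lambda>i. a i \<bullet> z - \<alpha> i) ` {1..l}))"
  using rep unfolding CPWL_representation_def by blast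

lemma finite_idx: "finite K" "finite I" "finite J1" "finite J2"
  by (simp_all add: K_def I_def J1_def J2_def active_K_def active_I_def positive_indices_def)

lemma idx_subset: "K \<subseteq> {1..l}" "I \<subseteq> {1..p}" "J1 \<subseteq> K" "J2 \<subseteq> I"
  by (auto simp: K_def I_def J1_def J2_def active_K_def active_I_def positive_indices_def)

lemma active_value: "i \<in> K \<Longrightarrow> a i \<bullet> zb - \<alpha> i = \<theta>b"
  unfolding \<theta>b_def by (intro Max_eqI[symmetric]) (auto simp: K_def active_K_def)

lemma inactive_value:
  assumes "j \<in> {1..l} - K"
  shows "a j \<bullet> zb - \<alpha> j < \<theta>b"
proof -
  have "\<exists>i\<in>{1..l}. a j \<bullet> zb - \<alpha> j < a i \<bullet> zb - \<alpha> i"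
    using assms by (auto simp: K_def active_K_def not_le)
  then obtain i where i: "i \<in> {1..l}" "a j \<bullet> zb - \<alpha> j < a i \<bullet> zb - \<alpha> i" by blast
  have "a i \<bullet> zb - \<alpha> i \<le> \<theta>b" unfolding \<theta>b_def using i by (intro Max_ge) auto
  with i show ?thesis by simp
qed

lemma \<theta>_zb: "\<theta> zb = ereal \<theta>b"
  using \<theta>_dom[OF zb] by (simp add: \<theta>b_def)

lemma sum_\<eta>: "(\<Sum>i\<in>K. \<eta> i) = 1" and \<eta>_nonneg: "i \<in> K \<Longrightarrow> 0 \<le> \<eta> i" and \<mu>_nonneg: "t \<in> I \<Longrightarrow> 0 \<le> \<mu> t"
  and lam_eq: "lam = (\<Sum>i\<in>K. \<eta> i *\<^sub>R a i) + (\<Sum>i\<in>I. \<mu> i *\<^sub>R d i)"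
  using lam_rep unfolding multiplier_representation_def by auto

lemma J1_nonempty: "J1 \<noteq> {}"
proof
  assume "J1 = {}"
  then have "\<eta> i = 0" if "i \<in> K" for i using \<eta>_nonneg[OF that] that by (force simp: J1_def positive_indices_def)
  then show False using sum_\<eta> by simp
qed

lemma K_nonempty: "K \<noteq> {}"
  using J1_nonempty idx_subset(3) by blast

text \<open>Enough subgradients to place \<open>a i - a j\<close> and \<open>d t\<close> in
  \<open>S\<close> as differences.\<close>

lemma active_in_subdifferential:
  assumes i: "i \<in> K" and c: "c = 0 \<or> c \<in> d ` I"
  shows "a i + c \<in> subdifferential \<theta> zb"
proof -
  have "\<theta> zb + ereal ((a i + c) \<bullet> (y - zb)) \<le> \<theta> y" for y
  proof (cases "y \<in> dom_of \<theta>")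
    case True
    have "c \<bullet> (y - zb) \<le> 0"
      using c True by (auto simp: dom_iff I_def active_I_def inner_diff_right)
    moreover have "a i \<bullet> y - \<alpha> i \<le> Max ((\<lambda>i. a i \<bullet> y - \<alpha> i) ` {1..l})"
      using i idx_subset(1) by (intro Max_ge) auto
    ultimately show ?thesis
      using active_value[OF i] by (simp add: \<theta>_zb \<theta>_dom[OF True] inner_diff_right inner_add_left)
  next
    case False
    then show ?thesis by (simp add: dom_of_def)
  qed
  then show ?thesis by (simp add: subdifferential_def \<theta>_zb)
qed

lemma S_facts:
  "subspace S" "i \<in> K \<Longrightarrow> j \<in> K \<Longrightarrow> a i - a j \<in> S" "t \<in> I \<Longrightarrow> d t \<in> S" "i \<in> K \<Longrightarrow> a i - lam \<in> S"
proof -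
  have ne: "subdifferential \<theta> zb \<noteq> {}" using lam_sub by blast
  note S = parallel_subspace_properties[OF ne, folded S_def]
  have a: "a i \<in> subdifferential \<theta> zb" if "i \<in> K" for i
    using active_in_subdifferential[OF that, of 0] by simp
  show "subspace S" by (rule S(1))
  show "a i - a j \<in> S" if "i \<in> K" "j \<in> K" using S(2)[OF a[OF that(1)] a[OF that(2)]] .
  show "a i - lam \<in> S" if "i \<in> K" using S(2)[OF a[OF that] lam_sub] .
  show "d t \<in> S" if "t \<in> I"
  proof -
    obtain i where "i \<in> K" using K_nonempty by blast
    with S(2)[OF active_in_subdifferential[OF this, of "d t"] a[OF this]] that show ?thesis by simp
  qed
qed

lemma finite_constraints: "finite constraints"
  using finite_idx by (simp add: constraints_def)

lemma constraints_in_S: "c \<in> constraints \<Longrightarrow> c \<in> S"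
  using S_facts(2,3) subspace_neg[OF S_facts(1) S_facts(3)] idx_subset(3,4)
  by (auto simp: constraints_def)

text \<open>All functionals in \<open>model\<close> belong to \<open>S\<close>, and ND controls
  \<open>D\<close> only when tested against \<open>S\<close>. This permits replacing
  \<open>\<Phi> p - zb\<close> by the image of the new variable under \<open>D\<close>.\<close>

lemma model_cong:
  assumes "\<And>c. c \<in> S \<Longrightarrow> c \<bullet> z = c \<bullet> z'"
  shows "model z = model z'"
proof -
  have "(\<lambda>i. (a i - lam) \<bullet> z) ` K = (\<lambda>i. (a i - lam) \<bullet> z') ` K"
    by (intro image_cong refl assms S_facts)
  moreover have "d t \<bullet> z = d t \<bullet> z'" if "t \<in> I" for t by (intro assms S_facts that)
  ultimately show ?thesis by (simp add: model_def)
qed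

lemma mem_G_iff: "z \<in> G \<longleftrightarrow> (\<forall>c\<in>constraints. c \<bullet> z \<le> 0)"
proof
  assume z: "z \<in> G"
  show "\<forall>c\<in>constraints. c \<bullet> z \<le> 0"
  proof
    fix c assume "c \<in> constraints"
    then consider i j where "i \<in> K" "j \<in> J1" "c = a i - a j" | t where "t \<in> I" "c = d t" | t where "t \<in> J2" "c = - d t"
      unfolding constraints_def by auto
    then show "c \<bullet> z \<le> 0"
    proof cases
      case 1 then show ?thesis using z by (cases "i \<in> J1") (auto simp: G_def cone_G_def)
    next
      case 2 then show ?thesis using z by (cases "t \<in> J2") (auto simp: G_def cone_G_def)
    next
      case 3 then show ?thesis using z by (auto simp: G_def cone_G_def)
    qed
  qed
next
  assume neg: "\<forall>c\<in>constraints. c \<bullet> z \<le> 0"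
  have A: "(a i - a j) \<bullet> z \<le> 0" if "i \<in> K" "j \<in> J1" for i j
    using that by (intro neg[rule_format]) (auto simp: constraints_def)
  have D: "d t \<bullet> z \<le> 0" if "t \<in> I" for t
    using that by (intro neg[rule_format]) (auto simp: constraints_def)
  have D': "- d t \<bullet> z \<le> 0" if "t \<in> J2" for t
    using that by (intro neg[rule_format]) (auto simp: constraints_def)
  have "(a i - a j) \<bullet> z = 0" if "i \<in> J1" "j \<in> J1" for i j
    using A[OF subsetD[OF idx_subset(3) that(1)] that(2)] A[OF subsetD[OF idx_subset(3) that(2)] that(1)]
    unfolding inner_diff_left by linarith
  moreover have "d t \<bullet> z = 0" if "t \<in> J2" for t
    using D[OF subsetD[OF idx_subset(4) that]] D'[OF that] by simp
  ultimately show "z \<in> G" using A D by (auto simp: G_def cone_G_def)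
qed

text \<open>The shift \<open>m\<close> is free because the \<open>\<eta> i\<close> sum to 1. If
  \<open>m\<close> is the largest \<open>a i \<bullet> z\<close> and all
  \<open>d t \<bullet> z \<le> 0\<close>, every product has a known sign; on \<open>G\<close> the
  choice \<open>m = a j \<bullet> z\<close> with \<open>j \<in> J1\<close> makes all of them
  vanish.\<close>

lemma lam_expand:
  "lam \<bullet> z = m - (\<Sum>i\<in>K. \<eta> i * (m - a i \<bullet> z)) + (\<Sum>t\<in>I. \<mu> t * (d t \<bullet> z))"
  using sum_\<eta> by (simp add: lam_eq inner_add_left inner_sum_left right_diff_distrib sum_subtractf flip: sum_distrib_right)

lemma model_on_G:
  assumes "z \<in> G"
  shows "model z = 0"
proof -
  obtain j where j: "j \<in> J1" using J1_nonempty by blast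
  have A: "a i \<bullet> z \<le> a j \<bullet> z" if "i \<in> K" for i
  proof -
    have "a i - a j \<in> constraints" using that j by (auto simp: constraints_def)
    with assms have "(a i - a j) \<bullet> z \<le> 0" unfolding mem_G_iff by blast
    then show ?thesis by (simp add: inner_diff_left)
  qed
  have E: "a i \<bullet> z = a j \<bullet> z" if "i \<in> J1" for i
  proof -
    have "(a i - a j) \<bullet> z = 0" using assms that j unfolding G_def cone_G_def by blast
    then show ?thesis by (simp add: inner_diff_left)
  qed
  have D: "d t \<bullet> z \<le> 0" if "t \<in> I" for t
  proof -
    have "d t \<in> constraints" using that by (simp add: constraints_def)
    then show ?thesis using assms unfolding mem_G_iff by blast
  qed
  have "(\<Sum>i\<in>K. \<eta> i * (a j \<bullet> z - a i \<bullet> z)) = 0"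
  proof (rule sum.neutral, rule ballI)
    fix i assume "i \<in> K"
    then show "\<eta> i * (a j \<bullet> z - a i \<bullet> z) = 0"
      using E[of i] \<eta>_nonneg[of i] by (cases "i \<in> J1") (auto simp: J1_def positive_indices_def)
  qed
  moreover have "(\<Sum>t\<in>I. \<mu> t * (d t \<bullet> z)) = 0"
  proof (rule sum.neutral, rule ballI)
    fix t assume t: "t \<in> I"
    show "\<mu> t * (d t \<bullet> z) = 0"
    proof (cases "t \<in> J2")
      case True
      then have "d t \<bullet> z = 0" using assms unfolding G_def cone_G_def by blast
      then show ?thesis by simp
    next
      case False
      then show ?thesis using t \<mu>_nonneg[of t] by (auto simp: J2_def positive_indices_def)
    qed
  qed
  ultimately have lam_z: "lam \<bullet> z = a j \<bullet> z" using lam_expand[of z "a j \<bullet> z"] by simp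
  have "Max ((\<lambda>i. (a i - lam) \<bullet> z) ` K) = 0"
  proof (intro Max_eqI)
    show "0 \<in> (\<lambda>i. (a i - lam) \<bullet> z) ` K"
      using j idx_subset(3) lam_z
      by (intro image_eqI[of _ _ j]) (auto simp: inner_diff_left)
  qed (use finite_idx(1) A lam_z in \<open>auto simp: inner_diff_left\<close>)
  then show ?thesis using D by (simp add: model_def zero_ereal_def)
qed

text \<open>By \<open>lam_expand\<close> a finite value of \<open>model z\<close> is a sum of
  nonnegative terms \<open>\<eta> i * (a k \<bullet> z - a i \<bullet> z)\<close> and
  \<open>- (\<mu> t * (d t \<bullet> z))\<close>. Each is at most the whole, and dividing by the
  positive weights bounds the constraints; \<open>M\<close> dominates the reciprocals of these
  weights.\<close>

lemma model_bounds_constraints: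
  obtains M where "0 < M" "\<And>z. (\<exists>r\<ge>0. model z = ereal r \<and> (\<forall>c\<in>constraints. c \<bullet> z \<le> M * r)) \<or> model z = \<infinity>"
proof -
  define M where "M = 1 + (\<Sum>j\<in>J1. 1 / \<eta> j) + (\<Sum>t\<in>J2. 1 / \<mu> t)"
  have pos: "0 < \<eta> j" if "j \<in> J1" for j using that by (simp add: J1_def positive_indices_def)
  have pos2: "0 < \<mu> t" if "t \<in> J2" for t using that by (simp add: J2_def positive_indices_def)
  have s: "0 \<le> (\<Sum>j\<in>J1. 1 / \<eta> j)" "0 \<le> (\<Sum>t\<in>J2. 1 / \<mu> t)"
    using pos pos2 by (simp_all add: sum_nonneg less_imp_le)
  have M: "0 < M" using s by (simp add: M_def add_pos_nonneg)
  have M1: "1 \<le> M * \<eta> j" if "j \<in> J1" for j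
  proof -
    have "1 / \<eta> j \<le> (\<Sum>j\<in>J1. 1 / \<eta> j)" using that pos finite_idx(3) by (intro member_le_sum) (simp_all add: less_imp_le)
    then have "1 / \<eta> j \<le> M" using s by (simp add: M_def)
    then show ?thesis using pos[OF that] by (simp add: pos_divide_le_eq)
  qed
  have M2: "1 \<le> M * \<mu> t" if "t \<in> J2" for t
  proof -
    have "1 / \<mu> t \<le> (\<Sum>t\<in>J2. 1 / \<mu> t)" using that pos2 finite_idx(4) by (intro member_le_sum) (simp_all add: less_imp_le)
    then have "1 / \<mu> t \<le> M" using s by (simp add: M_def)
    then show ?thesis using pos2[OF that] by (simp add: pos_divide_le_eq)
  qed
  show thesis
  proof (rule that[OF M])
    fix z
    show "(\<exists>r\<ge>0. model z = ereal r \<and> (\<forall>c\<in>constraints. c \<bullet> z \<le> M * r)) \<or> model z = \<infinity>"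
    proof (cases "\<forall>t\<in>I. d t \<bullet> z \<le> 0")
      case False
      then have "model z = \<infinity>" unfolding model_def by (rule if_not_P)
      then show ?thesis by blast
    next
      case D: True
      obtain k where k: "k \<in> K" "\<And>i. i \<in> K \<Longrightarrow> a i \<bullet> z \<le> a k \<bullet> z"
      proof -
        have "Max ((\<lambda>i. a i \<bullet> z) ` K) \<in> (\<lambda>i. a i \<bullet> z) ` K" using finite_idx(1) K_nonempty by (intro Max_in) auto
        then obtain k where "k \<in> K" "Max ((\<lambda>i. a i \<bullet> z) ` K) = a k \<bullet> z" by blast
        moreover have "a i \<bullet> z \<le> Max ((\<lambda>i. a i \<bullet> z) ` K)" if "i \<in> K" for i
          using that finite_idx(1) by (intro Max_ge) auto
        ultimately show thesis using that by simp
      qed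
      define r where "r = (a k - lam) \<bullet> z"
      have "Max ((\<lambda>i. (a i - lam) \<bullet> z) ` K) = r"
        unfolding r_def using k finite_idx(1) by (intro Max_eqI) (auto simp: inner_diff_left)
      then have model: "model z = ereal r" using D by (simp add: model_def)
      have t1: "0 \<le> \<eta> i * (a k \<bullet> z - a i \<bullet> z)" if "i \<in> K" for i
        using k(2)[OF that] \<eta>_nonneg[OF that] by simp
      have t2: "0 \<le> - (\<mu> t * (d t \<bullet> z))" if "t \<in> I" for t
        using D that \<mu>_nonneg[OF that] by (simp add: mult_nonneg_nonpos)
      have r: "r = (\<Sum>i\<in>K. \<eta> i * (a k \<bullet> z - a i \<bullet> z)) + (\<Sum>t\<in>I. - (\<mu> t * (d t \<bullet> z)))"
        using lam_expand[of z "a k \<bullet> z"] by (simp add: r_def inner_diff_left sum_negf)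
      have s1: "0 \<le> (\<Sum>i\<in>K. \<eta> i * (a k \<bullet> z - a i \<bullet> z))" by (intro sum_nonneg t1)
      have s2: "0 \<le> (\<Sum>t\<in>I. - (\<mu> t * (d t \<bullet> z)))" by (intro sum_nonneg t2)
      have r0: "0 \<le> r" unfolding r using s1 s2 by simp
      have r1: "\<eta> j * (a k \<bullet> z - a j \<bullet> z) \<le> r" if "j \<in> K" for j
        using member_le_sum[of j K "\<lambda>i. \<eta> i * (a k \<bullet> z - a i \<bullet> z)"] that t1 finite_idx(1) s2 unfolding r by fastforce
      have r2: "- (\<mu> t * (d t \<bullet> z)) \<le> r" if "t \<in> I" for t
        using member_le_sum[of t I "\<lambda>t. - (\<mu> t * (d t \<bullet> z))"] that t2 finite_idx(2) s1 unfolding r by fastforce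
      have "c \<bullet> z \<le> M * r" if "c \<in> constraints" for c
      proof -
        from that consider i j where "i \<in> K" "j \<in> J1" "c = a i - a j" | t where "t \<in> I" "c = d t"
          | t where "t \<in> J2" "c = - d t"
          unfolding constraints_def by auto
        then show ?thesis
        proof cases
          case 1
          have j: "j \<in> K" using 1 idx_subset(3) by blast
          have "c \<bullet> z \<le> a k \<bullet> z - a j \<bullet> z" using k(2)[OF 1(1)] 1(3) by (simp add: inner_diff_left)
          also have "\<dots> \<le> (M * \<eta> j) * (a k \<bullet> z - a j \<bullet> z)"
            using mult_right_mono[OF M1[OF 1(2)], of "a k \<bullet> z - a j \<bullet> z"] k(2)[OF j] by simp
          also have "\<dots> \<le> M * r" using mult_left_mono[OF r1[OF j], of M] M by (simp add: mult.assoc)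
          finally show ?thesis .
        next
          case 2
          have "c \<bullet> z \<le> 0" using 2 D by simp
          also have "0 \<le> M * r" using M r0 by simp
          finally show ?thesis .
        next
          case 3
          have t: "t \<in> I" using 3 idx_subset(4) by blast
          have "c \<bullet> z \<le> (M * \<mu> t) * (c \<bullet> z)"
            using mult_right_mono[OF M2[OF 3(1)], of "c \<bullet> z"] D t 3(2) by simp
          also have "\<dots> \<le> M * r" using mult_left_mono[OF r2[OF t], of M] M 3(2) by (simp add: mult.assoc)
          finally show ?thesis .
        qed
      qed
      with model r0 show ?thesis by blast
    qed
  qed
qed

lemma local_model:
  obtains r where "0 < r" "\<And>z. norm (z - zb) \<le> r \<Longrightarrow> \<theta> z = ereal (\<theta>b + lam \<bullet> (z - zb)) + model (z - zb)"
proof -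
  obtain k where k: "k \<in> K" using K_nonempty by blast
  obtain r1 where r1: "0 < r1" "\<And>u t. norm u \<le> r1 \<Longrightarrow> t \<in> {1..p} - I \<Longrightarrow> d t \<bullet> (zb + u) < \<beta> t"
  proof -
    have "d t \<bullet> zb < \<beta> t" if "t \<in> {1..p} - I" for t
      using that zb by (auto simp: dom_iff I_def active_I_def intro: le_neq_trans)
    from open_halfspaces_cball[of "{1..p} - I" d zb \<beta>, OF _ this] show thesis using that by blast
  qed
  \<comment> \<open>Staying below one fixed active piece \<open>k\<close> is enough for an inactive
    piece to drop out of the maximum.\<close>
  obtain r2 where r2: "0 < r2" "\<And>u j. norm u \<le> r2 \<Longrightarrow> j \<in> {1..l} - K \<Longrightarrow> (a j - a k) \<bullet> (zb + u) < \<alpha> j - \<alpha> k"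
  proof -
    have "(a j - a k) \<bullet> zb < \<alpha> j - \<alpha> k" if "j \<in> {1..l} - K" for j
      using inactive_value[OF that] active_value[OF k] by (simp add: inner_diff_left)
    from open_halfspaces_cball[of "{1..l} - K" "\<lambda>j. a j - a k" zb "\<lambda>j. \<alpha> j - \<alpha> k", OF _ this]
    show thesis using that by blast
  qed
  show thesis
  proof (rule that[of "min r1 r2"])
    show "0 < min r1 r2" using r1 r2 by simp
    fix z assume z: "norm (z - zb) \<le> min r1 r2"
    define u where "u = z - zb"
    have zu: "z = zb + u" by (simp add: u_def)
    have n: "norm u \<le> r1" "norm u \<le> r2" using z by (simp_all add: u_def)
    have dom: "z \<in> dom_of \<theta> \<longleftrightarrow> (\<forall>t\<in>I. d t \<bullet> u \<le> 0)"
    proof -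
      have "d t \<bullet> z \<le> \<beta> t \<longleftrightarrow> d t \<bullet> u \<le> 0" if "t \<in> I" for t
        using that by (simp add: zu inner_add_right I_def active_I_def)
      moreover have "d t \<bullet> z \<le> \<beta> t" if "t \<in> {1..p} - I" for t
        using r1(2)[OF n(1) that] by (simp add: zu)
      ultimately show ?thesis unfolding dom_iff using idx_subset(2) by blast
    qed
    show "\<theta> z = ereal (\<theta>b + lam \<bullet> (z - zb)) + model (z - zb)"
    proof (cases "z \<in> dom_of \<theta>")
      case False
      then have "\<theta> z = \<infinity>" by (simp add: dom_of_def)
      moreover have "model u = \<infinity>" using False dom by (simp add: model_def)
      ultimately show ?thesis by (simp add: u_def)
    next
      case True
      have val: "a i \<bullet> z - \<alpha> i = \<theta>b + lam \<bullet> u + (a i - lam) \<bullet> u" if "i \<in> K" for i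
        using active_value[OF that] by (simp add: zu inner_add_right inner_diff_left)
      define m where "m = Max ((\<lambda>i. (a i - lam) \<bullet> u) ` K)"
      have finK: "finite ((\<lambda>i. (a i - lam) \<bullet> u) ` K)" "(\<lambda>i. (a i - lam) \<bullet> u) ` K \<noteq> {}"
        using finite_idx(1) K_nonempty by auto
      obtain i where i: "i \<in> K" "m = (a i - lam) \<bullet> u" using Max_in[OF finK] by (auto simp: m_def)
      have mK: "(a j - lam) \<bullet> u \<le> m" if "j \<in> K" for j
        unfolding m_def using finK that by (intro Max_ge) auto
      have "Max ((\<lambda>i. a i \<bullet> z - \<alpha> i) ` {1..l}) = \<theta>b + lam \<bullet> u + m"
      proof (rule Max_eqI)
        show "\<theta>b + lam \<bullet> u + m \<in> (\<lambda>i. a i \<bullet> z - \<alpha> i) ` {1..l}"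
          using i val[OF i(1)] idx_subset(1) by (intro image_eqI[of _ _ i]) auto
        fix v assume "v \<in> (\<lambda>i. a i \<bullet> z - \<alpha> i) ` {1..l}"
        then obtain j where j: "j \<in> {1..l}" "v = a j \<bullet> z - \<alpha> j" by blast
        show "v \<le> \<theta>b + lam \<bullet> u + m"
        proof (cases "j \<in> K")
          case True then show ?thesis using val[OF True] mK[OF True] j by simp
        next
          case False
          then have "a j \<bullet> z - \<alpha> j < a k \<bullet> z - \<alpha> k"
            using r2(2)[OF n(2), of j] j by (simp add: zu inner_diff_left)
          then show ?thesis using val[OF k] mK[OF k] j by simp
        qed
      qed simp
      moreover have "model u = ereal m" using True dom by (simp add: model_def m_def)
      ultimately show ?thesis using \<theta>_dom[OF True] by (simp add: u_def)
    qed
  qed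
qed

text \<open>The sum of witnesses, one for each constraint that is negative somewhere on
  \<open>G\<close>; the other summands cannot spoil the sign, as all constraints are nonpositive on
  \<open>G\<close>.\<close>

lemma relative_interior_point:
  obtains e where "e \<in> G" "\<And>c. c \<in> constraints \<Longrightarrow> (\<forall>z\<in>G. c \<bullet> z = 0) \<or> c \<bullet> e < 0"
proof -
  define N where "N = {c \<in> constraints. \<exists>z\<in>G. c \<bullet> z < 0}"
  have finN: "finite N" using finite_constraints by (simp add: N_def)
  have "\<forall>c\<in>N. \<exists>z\<in>G. c \<bullet> z < 0" by (simp add: N_def)
  then obtain w where w: "\<And>c. c \<in> N \<Longrightarrow> w c \<in> G" "\<And>c. c \<in> N \<Longrightarrow> c \<bullet> w c < 0" by metis
  define e where "e = (\<Sum>c\<in>N. w c)"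
  have le: "c \<bullet> w c' \<le> 0" if "c \<in> constraints" "c' \<in> N" for c c'
    using w(1)[OF that(2)] that(1) by (simp add: mem_G_iff)
  show thesis
  proof (rule that[of e])
    show "e \<in> G" unfolding mem_G_iff e_def inner_sum_right using le by (auto intro: sum_nonpos)
    show "(\<forall>z\<in>G. c \<bullet> z = 0) \<or> c \<bullet> e < 0" if c: "c \<in> constraints" for c
    proof (cases "c \<in> N")
      case True
      have "(\<Sum>c'\<in>N. c \<bullet> w c') < (\<Sum>c'\<in>N. 0)"
        using finN True w(2)[OF True] le[OF c] by (intro sum_strict_mono_ex1) auto
      then show ?thesis by (simp add: e_def inner_sum_right)
    next
      case False
      then have "c \<bullet> z = 0" if "z \<in> G" for z
        using that c by (auto simp: N_def mem_G_iff not_less intro: antisym)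
      then show ?thesis by blast
    qed
  qed
qed

lemma G_subset_lineality:
  assumes "z \<in> G"
  shows "i \<in> Gamma1 a K J1 G \<Longrightarrow> j \<in> Gamma1 a K J1 G \<Longrightarrow> (a i - a j) \<bullet> z = 0"
    and "t \<in> Gamma2 d I G \<Longrightarrow> d t \<bullet> z = 0"
proof -
  show "(a i - a j) \<bullet> z = 0" if "i \<in> Gamma1 a K J1 G" "j \<in> Gamma1 a K J1 G"
  proof -
    obtain k where "k \<in> J1" using J1_nonempty by blast
    then have "(a i - a k) \<bullet> z = 0" "(a j - a k) \<bullet> z = 0" using that assms by (auto simp: Gamma1_def)
    then show ?thesis by (simp add: inner_diff_left)
  qed
qed (use assms in \<open>auto simp: Gamma2_def\<close>)

text \<open>The implicit equalities of \<open>G\<close> are captured by the two index sets: if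
  \<open>a i - a j\<close> with \<open>j \<in> J1\<close> vanishes on \<open>G\<close>, then both
  indices belong to \<open>Gamma1\<close>. So the directions of SSOSC preserve these equalities and
  can be added, when small, to a relatively interior point.\<close>

lemma vanishing_constraint:
  assumes c: "c \<in> constraints" "\<forall>z\<in>G. c \<bullet> z = 0"
    and u1: "\<And>i j. i \<in> Gamma1 a K J1 G \<Longrightarrow> j \<in> Gamma1 a K J1 G \<Longrightarrow> (a i - a j) \<bullet> u = 0"
    and u2: "\<And>t. t \<in> Gamma2 d I G \<Longrightarrow> d t \<bullet> u = 0"
  shows "c \<bullet> u = 0"
proof -
  from c(1) consider i j where "i \<in> K" "j \<in> J1" "c = a i - a j" | t where "t \<in> I" "c = d t"
    | t where "t \<in> J2" "c = - d t"
    unfolding constraints_def by auto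
  then show ?thesis
  proof cases
    case 1
    have J: "(a j - a j') \<bullet> z = 0" if "z \<in> G" "j' \<in> J1" for j' z
      using that 1(2) by (simp add: G_def cone_G_def)
    have "(a i - a j') \<bullet> z = 0" if "z \<in> G" "j' \<in> J1" for j' z
      using J[OF that] c(2) that 1(3) by (simp add: inner_diff_left)
    then have "i \<in> Gamma1 a K J1 G" using 1(1) by (simp add: Gamma1_def)
    moreover have "j \<in> Gamma1 a K J1 G" using J 1(2) idx_subset(3) by (auto simp: Gamma1_def)
    ultimately show ?thesis using u1 1(3) by simp
  next
    case 2
    then have "t \<in> Gamma2 d I G" using c(2) by (simp add: Gamma2_def)
    then show ?thesis using u2 2(2) by simp
  next
    case 3
    then have "t \<in> Gamma2 d I G" using c(2) idx_subset(4) by (auto simp: Gamma2_def)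
    then show ?thesis using u2 3(2) by simp
  qed
qed

end

subsection \<open>Gradients, Hessians and the reduction matrix\<close>

lemma gradient_inner:
  fixes F :: "'a::euclidean_space \<Rightarrow> real"
  assumes "(F has_derivative blinfun_apply f1) (at x)"
  shows "gradient F x = (\<Sum>b\<in>Basis. f1 b *\<^sub>R b)" and "gradient F x \<bullet> h = f1 h"
proof -
  define D where "D = (\<Sum>b\<in>Basis. f1 b *\<^sub>R b)"
  have D: "h \<bullet> D = f1 h" for h
  proof -
    have "f1 h = f1 (\<Sum>b\<in>Basis. (h \<bullet> b) *\<^sub>R b)" by (simp add: euclidean_representation)
    also have "\<dots> = (\<Sum>b\<in>Basis. (h \<bullet> b) * f1 b)" by (simp add: blinfun.sum_right blinfun.scaleR_right)
    finally show ?thesis by (simp add: D_def inner_sum_right mult.commute)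
  qed
  have "gradient F x = D" unfolding gradient_def
  proof (rule the_equality)
    show "GDERIV F x :> D" unfolding gderiv_def D using assms by simp
    fix D' assume "GDERIV F x :> D'"
    then have eq: "(\<lambda>h. h \<bullet> D') = blinfun_apply f1"
      unfolding gderiv_def using assms by (rule has_derivative_unique)
    have "h \<bullet> D' = h \<bullet> D" for h using fun_cong[OF eq, of h] D[of h] by simp
    then show "D' = D" using vector_eq_ldot[of D' D] by simp
  qed
  then show "gradient F x = (\<Sum>b\<in>Basis. f1 b *\<^sub>R b)" "gradient F x \<bullet> h = f1 h"
    using D[of h] by (simp_all add: D_def inner_commute)
qed

lemma hessian_quadratic_form:
  fixes F :: "real^'n \<Rightarrow> real"
  assumes d1: "\<And>x. (F has_derivative blinfun_apply (f1 x)) (at x)"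
    and d2: "(f1 has_derivative f2) (at x)"
  shows "u \<bullet> (hessian F x *v k) = f2 k u"
proof -
  define g2 where "g2 = (\<lambda>k. \<Sum>b\<in>Basis. f2 k b *\<^sub>R b)"
  have grad: "gradient F = (\<lambda>x. \<Sum>b\<in>Basis. f1 x b *\<^sub>R b)"
    by (rule ext) (rule gradient_inner(1)[OF d1])
  have ap: "((\<lambda>x. f1 x b *\<^sub>R b) has_derivative (\<lambda>k. f2 k b *\<^sub>R b)) (at x)" for b
    by (rule has_derivative_scaleR_left[OF bounded_linear.has_derivative[OF blinfun.bounded_linear_left d2]])
  have g2: "(gradient F has_derivative g2) (at x)"
    unfolding grad g2_def by (intro has_derivative_sum ap)
  have "gradient F differentiable (at x)" using g2 unfolding differentiable_def by blast
  then have "(gradient F has_derivative (\<lambda>h. hessian F x *v h)) (at x)"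
    unfolding hessian_def jacobian_works .
  from fun_cong[OF has_derivative_unique[OF this g2]] have "hessian F x *v k = g2 k" .
  moreover have "u \<bullet> g2 k = f2 k u"
  proof -
    have "f2 k u = f2 k (\<Sum>b\<in>Basis. (u \<bullet> b) *\<^sub>R b)" by (simp add: euclidean_representation)
    also have "\<dots> = (\<Sum>b\<in>Basis. (u \<bullet> b) * f2 k b)" by (simp only: blinfun.sum_right blinfun.scaleR_right real_scaleR_def)
    finally show ?thesis by (simp add: g2_def inner_sum_right mult.commute)
  qed
  ultimately show ?thesis by simp
qed

lemma transpose_inner: "(transpose A *v x) \<bullet> y = x \<bullet> (A *v y)" for A :: "real^'n^'m"
  by (simp add: dot_lmul_matrix)

text \<open>The kernel of the reduction matrix is the orthogonal complement of \<open>S(z)\<close>, so the condition ND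
  makes \<open>D\<close> surjective modulo that complement.\<close>

lemma nondegenerate_solve:
  fixes D :: "real^'n^('m::{finite,linorder})"
  assumes red: "is_reduction_matrix \<theta> z B" and nd: "nondegenerate D B"
  shows "\<exists>u. \<forall>c\<in>parallel_subspace (subdifferential \<theta> z). c \<bullet> (D *v u) = c \<bullet> w"
proof -
  define S where "S = parallel_subspace (subdifferential \<theta> z)"
  obtain A where A: "orthogonal_matrix A"
    and AS: "(\<lambda>y. transpose A *v y) ` S = {y. \<forall>i\<in>set (drop (dim S) coords). y $ i = 0}"
    and B: "B = map (\<lambda>i. row i (matrix_inv A)) (take (dim S) coords)"
    using red unfolding is_reduction_matrix_def Let_def S_def by blast
  have inv: "matrix_inv A = transpose A"
  proof -
    have "\<exists>A'. A ** A' = mat 1 \<and> A' ** A = mat 1" using A unfolding orthogonal_matrix_def by blast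
    from someI_ex[OF this] have "A ** matrix_inv A = mat 1" unfolding matrix_inv_def by blast
    then have "transpose A ** (A ** matrix_inv A) = transpose A" by simp
    moreover have "transpose A ** A = mat 1" using A by (simp add: orthogonal_matrix_def)
    ultimately show ?thesis by (simp add: matrix_mul_assoc)
  qed
  \<comment> \<open>In the coordinates given by \<open>transpose A\<close>, the vector
    \<open>c\<close> is supported in the first \<open>dim S\<close> positions and \<open>y\<close>
    in the remaining ones.\<close>
  have orth: "c \<bullet> y = 0" if c: "c \<in> S" and y: "y \<in> ker_rows B" for c y
  proof -
    have "c \<bullet> y = c \<bullet> ((A ** transpose A) *v y)"
      using A by (simp add: orthogonal_matrix_def)
    also have "\<dots> = (transpose A *v c) \<bullet> (transpose A *v y)"
      by (simp only: transpose_inner matrix_vector_mul_assoc)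
    also have "\<dots> = (\<Sum>i\<in>UNIV. (transpose A *v c) $ i * (transpose A *v y) $ i)"
      by (simp add: inner_vec_def)
    also have "\<dots> = 0"
    proof (rule sum.neutral, rule ballI)
      fix i :: 'm
      have "i \<in> set (take (dim S) coords @ drop (dim S) coords)" unfolding append_take_drop_id coords_def by simp
      then consider "i \<in> set (take (dim S) coords)" | "i \<in> set (drop (dim S) coords)"
        unfolding set_append by blast
      then show "(transpose A *v c) $ i * (transpose A *v y) $ i = 0"
      proof cases
        case 1
        then have "row i (transpose A) \<in> set B" unfolding B inv by auto
        then have "row i (transpose A) \<bullet> y = 0" using y unfolding ker_rows_def by blast
        then have "(transpose A *v y) $ i = 0" by (simp add: matrix_vector_mult_def row_def inner_vec_def)
        then show ?thesis by simp
      next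
        case 2
        have "transpose A *v c \<in> (\<lambda>y. transpose A *v y) ` S" using c by blast
        then have "(transpose A *v c) $ i = 0" unfolding AS using 2 by blast
        then show ?thesis by simp
      qed
    qed
    finally show ?thesis .
  qed
  have "w \<in> {D *v u + y |u y. y \<in> ker_rows B}" using nd by (simp add: nondegenerate_def)
  then obtain u y where "w = D *v u + y" "y \<in> ker_rows B" by blast
  then show ?thesis using orth unfolding S_def by (intro exI[of _ u]) (simp add: inner_add_right)
qed

text \<open>Solutions chosen pointwise need not depend linearly on \<open>w\<close>; they are chosen
  for the basis vectors and extended, so that composition with \<open>T\<close> preserves
  smoothness.\<close>

lemma linear_solution_operator:
  fixes D :: "'a::real_vector \<Rightarrow> 'b::euclidean_space"
  assumes D: "linear D" and solve: "\<And>w. \<exists>u. \<forall>c\<in>S. c \<bullet> D u = c \<bullet> w"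
  obtains T :: "'b \<Rightarrow> 'a" where "linear T" "\<And>c w. c \<in> S \<Longrightarrow> c \<bullet> D (T w) = c \<bullet> w"
proof -
  obtain s where s: "\<And>w c. c \<in> S \<Longrightarrow> c \<bullet> D (s w) = c \<bullet> w" using solve by metis
  define T where "T = (\<lambda>w. \<Sum>b\<in>Basis. (w \<bullet> b) *\<^sub>R s b)"
  show thesis
  proof (rule that[of T])
    show "linear T" unfolding T_def
      by (intro linear_compose_sum ballI linearI)
        (simp_all add: inner_add_left scaleR_add_left)
    show "c \<bullet> D (T w) = c \<bullet> w" if "c \<in> S" for c w
    proof -
      have "c \<bullet> D (T w) = (\<Sum>b\<in>Basis. (w \<bullet> b) * (c \<bullet> b))"
        using s[OF that] by (simp add: T_def linear_sum[OF D] linear_scale[OF D] inner_sum_right)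
      also have "\<dots> = c \<bullet> w" by (subst euclidean_inner[of c w]) (simp add: mult.commute)
      finally show ?thesis .
    qed
  qed
qed

subsection \<open>Characterization of full stability\<close>

theorem theorem4p1:
  fixes \<theta> :: "real^('m::{finite,linorder}) \<Rightarrow> ereal"
    and l p :: nat
    and a d :: "nat \<Rightarrow> real^('m::_)"
    and \<alpha> \<beta> :: "nat \<Rightarrow> real"
    and \<phi>0 :: "(real^'n) \<times> (real^'d) \<Rightarrow> real"
    and \<Phi> :: "(real^'n) \<times> (real^'d) \<Rightarrow> real^('m::_)"
    and xb vb :: "real^'n"
    and wb :: "real^'d"
    and lam :: "real^('m::_)"
    and \<eta> \<mu> :: "nat \<Rightarrow> real"
    and B :: "(real^('m::_)) list"
  defines "zb \<equiv> \<Phi> (xb, wb)"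
  defines "D \<equiv> partial_jacobian \<Phi> xb wb"
  defines "K \<equiv> active_K l a \<alpha> zb"
  defines "I \<equiv> active_I p d \<beta> zb"
  defines "J1 \<equiv> positive_indices K \<eta>"
  defines "J2 \<equiv> positive_indices I \<mu>"
  defines "G \<equiv> cone_G a d K I J1 J2"
  assumes "CPWL \<theta>"
    and "CPWL_representation \<theta> l a \<alpha> p d \<beta>"
    and "C2_smooth \<phi>0"
    and "C2_smooth \<Phi>"
    and "zb \<in> dom_of \<theta>"
    and "vb \<in> {gradient (\<lambda>x. \<phi>0 (x, wb)) xb + transpose D *v y |y. y \<in> subdifferential \<theta> zb}"
    and "is_reduction_matrix \<theta> zb B"
    and "nondegenerate D B"
    and "lam \<in> subdifferential \<theta> zb"
    and "vb = gradient (\<lambda>x. lagrangian \<phi>0 \<Phi> x wb lam) xb"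
    and "multiplier_representation a d K I lam \<eta> \<mu>"
  shows "fully_stable (objective \<phi>0 \<theta> \<Phi>) xb wb vb \<longleftrightarrow>
         composite_SSOSC (hessian (\<lambda>x. lagrangian \<phi>0 \<Phi> x wb lam) xb)
           (subspace_S a d (Gamma1 a K J1 G) (Gamma2 d I G) D)"
proof -
  define H where "H = hessian (\<lambda>x. lagrangian \<phi>0 \<Phi> x wb lam) xb"
  define U where "U = subspace_S a d (Gamma1 a K J1 G) (Gamma2 d I G) D"
  interpret cpwl_multiplier \<theta> l p a d \<alpha> \<beta> zb lam \<eta> \<mu> K I J1 J2 G
    using assms by unfold_locales auto
  obtain \<Phi>' \<Phi>'' where \<Phi>: "\<And>x. (\<Phi> has_derivative blinfun_apply (\<Phi>' x)) (at x)"
    "\<And>x. (\<Phi>' has_derivative blinfun_apply (\<Phi>'' x)) (at x)" "continuous_on UNIV \<Phi>''"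
    using \<open>C2_smooth \<Phi>\<close> unfolding C2_smooth_def by blast
  have d\<Phi>: "((\<lambda>x. \<Phi> (x, wb)) has_derivative (\<lambda>k. D *v k)) (at xb)"
    using jacobian_works[THEN iffD1, OF differentiableI[OF has_derivative_partial_fst[OF \<Phi>(1)]]]
    unfolding D_def partial_jacobian_def .
  have linD: "linear (\<lambda>k. D *v k)" by (rule matrix_vector_mul_linear)
  have "\<exists>u. \<forall>c\<in>S. c \<bullet> (D *v u) = c \<bullet> z" for z
    unfolding S_def by (rule nondegenerate_solve[OF \<open>is_reduction_matrix \<theta> zb B\<close> \<open>nondegenerate D B\<close>])
  from linear_solution_operator[OF linD this] obtain T where
    T: "linear T" "\<And>c z. c \<in> S \<Longrightarrow> c \<bullet> (D *v T z) = c \<bullet> z" by blast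
  \<comment> \<open>The constant makes \<open>f p\<close> equal to
    \<open>\<phi>0 p + \<theta>b + lam \<bullet> (\<Phi> p - zb)\<close>, so that near the reference
    point the objective exceeds \<open>f\<close> by exactly the \<open>model\<close> term.\<close>
  define f where "f = (\<lambda>p. \<phi>0 p + (lam \<bullet> \<Phi> p + (\<theta>b - lam \<bullet> zb)))"
  \<comment> \<open>Arranged as a sum for the closure rules of \<open>C2_smooth\<close>; the working
    form is \<open>\<psi>_eq\<close>. Tested against \<open>S\<close>, the image of
    \<open>\<psi> p\<close> under \<open>D\<close> is \<open>\<Phi> p - zb\<close>. The argument of
    \<open>T\<close> in \<open>\<psi>_eq\<close> has zero \<open>x\<close>-derivative at the
    reference point, so the \<open>x\<close>-derivative of \<open>\<psi>\<close> there is the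
    identity.\<close>
  define \<psi> where "\<psi> = (\<lambda>p. (fst p - T (D *v fst p)) + (T (\<Phi> p) + (T (D *v xb) - xb - T zb)))"
  have \<psi>_eq: "\<psi> p = (fst p - xb) + T (\<Phi> p - zb - D *v (fst p - xb))" for p
    by (simp add: \<psi>_def linear_diff[OF T(1)] matrix_vector_mult_diff_distrib)
  have bT: "bounded_linear T" using T(1) by (simp add: linear_conv_bounded_linear)
  have bD: "bounded_linear (\<lambda>k. D *v k)" by (rule matrix_vector_mul_bounded_linear)
  have C2f: "C2_smooth f" unfolding f_def
    by (intro C2_smooth_add C2_smooth_const \<open>C2_smooth \<phi>0\<close>
        C2_smooth_linear_compose[OF bounded_linear_inner_right \<open>C2_smooth \<Phi>\<close>])
  have C2\<psi>: "C2_smooth \<psi>" unfolding \<psi>_def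
    by (intro C2_smooth_add C2_smooth_const C2_smooth_linear_compose[OF bT \<open>C2_smooth \<Phi>\<close>]
        C2_smooth_bounded_linear bounded_linear_sub bounded_linear_fst
        bounded_linear_compose[OF bT] bounded_linear_compose[OF bD])
  obtain f' f'' where f: "\<And>x. (f has_derivative blinfun_apply (f' x)) (at x)"
    "\<And>x. (f' has_derivative blinfun_apply (f'' x)) (at x)" "continuous_on UNIV f''"
    using C2f unfolding C2_smooth_def by blast
  obtain \<psi>' \<psi>'' where \<psi>: "\<And>x. (\<psi> has_derivative blinfun_apply (\<psi>' x)) (at x)"
    "\<And>x. (\<psi>' has_derivative blinfun_apply (\<psi>'' x)) (at x)" "continuous_on UNIV \<psi>''"
    using C2\<psi> unfolding C2_smooth_def by blast
  define g where "g = (\<lambda>y. model (D *v y))"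
  define C where "C = {y. D *v y \<in> G}"
  have lagr: "((\<lambda>x. lagrangian \<phi>0 \<Phi> x wb lam) has_derivative blinfun_apply (f' (x, wb) o\<^sub>L inl_blinfun)) (at x)" for x
  proof -
    have "(\<lambda>x. lagrangian \<phi>0 \<Phi> x wb lam) = (\<lambda>x. f (x, wb) - (\<theta>b - lam \<bullet> zb))"
      by (simp add: lagrangian_def f_def)
    then show ?thesis
      using has_derivative_diff[OF has_derivative_partial_fst[OF f(1)[of "(x, wb)"]] has_derivative_const]
      by (simp add: blinfun_compose.rep_eq o_def)
  qed
  have d2: "((\<lambda>x. f' (x, wb) o\<^sub>L inl_blinfun) has_derivative (\<lambda>k. f'' (xb, wb) (k, 0) o\<^sub>L inl_blinfun)) (at xb)"
    using bounded_linear.has_derivative[OF bounded_bilinear.bounded_linear_left[OF bounded_bilinear_blinfun_compose]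
        has_derivative_partial_fst[OF f(2)[of "(xb, wb)"]], of inl_blinfun]
    by simp
  have H: "u \<bullet> (H *v u) = f'' (xb, wb) (u, 0) (u, 0)" for u
    unfolding H_def using hessian_quadratic_form[OF lagr d2, of u u] by simp
  have C_iff: "C = {y. \<forall>c\<in>constraints. (transpose D *v c) \<bullet> y \<le> 0}"
    unfolding C_def mem_G_iff transpose_inner ..
  obtain \<delta> where \<delta>: "0 < \<delta>" "\<And>y m. 0 \<le> m \<Longrightarrow> (\<And>c. c \<in> constraints \<Longrightarrow> (transpose D *v c) \<bullet> y \<le> m) \<Longrightarrow>
      \<delta> * norm (y - closest_point C y) \<le> m"
    using polyhedral_cone_error_bound[OF finite_constraints, of "\<lambda>c. transpose D *v c"] unfolding C_iff by blast
  obtain M where M: "0 < M" "\<And>z. (\<exists>r\<ge>0. model z = ereal r \<and> (\<forall>c\<in>constraints. c \<bullet> z \<le> M * r)) \<or> model z = \<infinity>"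
    using model_bounds_constraints by blast
  obtain rl where rl: "0 < rl" "\<And>z. norm (z - zb) \<le> rl \<Longrightarrow> \<theta> z = ereal (\<theta>b + lam \<bullet> (z - zb)) + model (z - zb)"
    using local_model by blast
  \<comment> \<open>The penalty constant \<open>\<delta> / M\<close> combines the bound of the
    distance by the violation with the bound of the violation by \<open>M\<close> times
    \<open>model\<close>.\<close>
  interpret reduced_composite "objective \<phi>0 \<theta> \<Phi>" f f' f'' \<psi> \<psi>' \<psi>'' g C U "\<delta> / M" xb vb wb
  proof
    show "\<psi> (xb, wb) = 0" by (simp add: \<psi>_eq zb_def linear_0[OF T(1)])
    show "\<psi>' (xb, wb) o\<^sub>L inl_blinfun = id_blinfun"
    proof (rule blinfun_eqI)
      fix k
      have "((\<lambda>x. (x - xb) + T (\<Phi> (x, wb) - zb - D *v (x - xb))) has_derivative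
          (\<lambda>k. (k - 0) + T (D *v k - 0 - D *v (k - 0)))) (at xb)"
        by (intro has_derivative_add has_derivative_diff has_derivative_ident has_derivative_const d\<Phi>
            bounded_linear.has_derivative[OF bT] bounded_linear.has_derivative[OF bD])
      then have "((\<lambda>x. \<psi> (x, wb)) has_derivative (\<lambda>k. k)) (at xb)"
        by (simp add: \<psi>_eq linear_0[OF T(1)])
      from has_derivative_unique[OF has_derivative_partial_fst[OF \<psi>(1)] this]
      show "(\<psi>' (xb, wb) o\<^sub>L inl_blinfun) k = id_blinfun k" by simp
    qed
    show "f' (xb, wb) o\<^sub>L inl_blinfun = blinfun_inner_right vb"
    proof (rule blinfun_eqI)
      fix k
      show "(f' (xb, wb) o\<^sub>L inl_blinfun) k = blinfun_inner_right vb k"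
        using gradient_inner(2)[OF lagr[of xb], of k] \<open>vb = gradient _ _\<close> by simp
    qed
    show "closed C"
    proof -
      have "C = (\<Inter>c\<in>constraints. {y. (transpose D *v c) \<bullet> y \<le> 0})" unfolding C_iff by blast
      then show ?thesis by (simp only:) (intro closed_INT ballI closed_halfspace_le)
    qed
    show "convex C"
    proof -
      have "C = (\<Inter>c\<in>constraints. {y. (transpose D *v c) \<bullet> y \<le> 0})" unfolding C_iff by blast
      then show ?thesis by (simp only:) (intro convex_INT convex_halfspace_le)
    qed
    show "cone C" unfolding cone_def C_iff by (simp add: mult_nonneg_nonpos del: transpose_matrix_vector)
    show "0 \<in> C" unfolding C_iff by simp
    show "subspace U" unfolding U_def subspace_S_def subspace_def
      by (simp add: matrix_vector_right_distrib matrix_vector_mult_scaleR inner_add_right)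
    show "C \<subseteq> U" unfolding C_def U_def subspace_S_def using G_subset_lineality by blast
    show "0 < \<delta> / M" using \<delta> M by simp
    show "g y = 0" if "y \<in> C" for y using that model_on_G by (simp add: g_def C_def)
    show "ereal (\<delta> / M * norm (y - closest_point C y)) \<le> g y" for y
    proof (cases "g y = \<infinity>")
      case False
      then obtain r where r: "0 \<le> r" "g y = ereal r" "\<forall>c\<in>constraints. c \<bullet> (D *v y) \<le> M * r"
        using M(2)[of "D *v y"] unfolding g_def by blast
      have "\<delta> * norm (y - closest_point C y) \<le> M * r"
        using r M by (intro \<delta>(2)) (simp_all add: transpose_inner del: transpose_matrix_vector)
      then show ?thesis using M r by (simp add: pos_divide_le_eq mult.commute)
    qed simp
    show "\<forall>\<^sub>F p in nhds (xb, wb). objective \<phi>0 \<theta> \<Phi> p = ereal (f p) + g (\<psi> p)"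
    proof -
      have "isCont \<Phi> (xb, wb)" using \<Phi>(1) has_derivative_continuous by blast
      then have "\<forall>\<^sub>F p in nhds (xb, wb). dist (\<Phi> p) (\<Phi> (xb, wb)) < rl"
        using rl(1) unfolding continuous_at_eps_delta eventually_nhds_metric by blast
      then show ?thesis
      proof eventually_elim
        case (elim p)
        have "\<theta> (\<Phi> p) = ereal (\<theta>b + lam \<bullet> (\<Phi> p - zb)) + model (\<Phi> p - zb)"
          using elim by (intro rl) (simp add: dist_norm zb_def)
        moreover have "model (\<Phi> p - zb) = g (\<psi> p)" unfolding g_def
        proof (rule model_cong)
          fix c assume c: "c \<in> S"
          show "c \<bullet> (\<Phi> p - zb) = c \<bullet> (D *v \<psi> p)"
            using T(2)[OF c, of "\<Phi> p - zb - D *v (fst p - xb)"]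
            by (simp add: \<psi>_eq matrix_vector_right_distrib inner_add_right inner_diff_right)
        qed
        moreover have "f p = \<phi>0 p + (\<theta>b + lam \<bullet> (\<Phi> p - zb))" by (simp add: f_def inner_diff_right)
        ultimately show ?case by (simp add: objective_def add.assoc flip: plus_ereal.simps(1))
      qed
    qed
  qed (use f \<psi> in auto)
  have curv_H: "curv u u = u \<bullet> (H *v u)" for u by (simp add: curv_def H)
  obtain e where e: "e \<in> G" "\<And>c. c \<in> constraints \<Longrightarrow> (\<forall>z\<in>G. c \<bullet> z = 0) \<or> c \<bullet> e < 0"
    using relative_interior_point by blast
  \<comment> \<open>The point \<open>e\<close> may lie outside the range of \<open>D\<close>, but
    \<open>D *v T e\<close> agrees with it when tested against \<open>S\<close>, which contains all
    constraint normals; so \<open>T e\<close> is a relatively interior point of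
    \<open>C\<close>.\<close>
  have De: "c \<bullet> (D *v T e) = c \<bullet> e" if "c \<in> constraints" for c
    by (rule T(2)[OF constraints_in_S[OF that]])
  define N where "N = {c \<in> constraints. c \<bullet> e < 0}"
  have finN: "finite N" using finite_constraints by (simp add: N_def)
  have strict: "(transpose D *v c) \<bullet> T e < 0" if "c \<in> N" for c
    using that De unfolding transpose_inner by (simp add: N_def)
  obtain \<rho> where \<rho>: "0 < \<rho>" "\<And>u c. norm u \<le> \<rho> \<Longrightarrow> c \<in> N \<Longrightarrow> (transpose D *v c) \<bullet> (T e + u) < 0"
    using open_halfspaces_cball[of N "\<lambda>c. transpose D *v c" "T e" "\<lambda>_. 0", OF finN strict] by blast
  have relint: "T e + u \<in> C" if u: "u \<in> U" "norm u \<le> \<rho>" for u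
    unfolding C_def mem_Collect_eq mem_G_iff
  proof
    fix c assume c: "c \<in> constraints"
    show "c \<bullet> (D *v (T e + u)) \<le> 0"
    proof (cases "c \<in> N")
      case True
      then show ?thesis using \<rho>(2)[OF u(2) True] unfolding transpose_inner by simp
    next
      case False
      \<comment> \<open>Directions in \<open>U\<close> leave these implicit equalities intact; only
        the strict constraints limit the radius \<open>\<rho>\<close>.\<close>
      then have van: "\<forall>z\<in>G. c \<bullet> z = 0" using e(2)[OF c] c by (auto simp: N_def)
      have "c \<bullet> (D *v u) = 0"
        by (rule vanishing_constraint[OF c van]) (use u(1) in \<open>auto simp: U_def subspace_S_def\<close>)
      moreover have "c \<bullet> (D *v T e) = 0" using De[OF c] van e(1) by simp
      ultimately show ?thesis by (simp add: matrix_vector_right_distrib inner_add_right)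
    qed
  qed
  have eC: "T e \<in> C" using relint[of 0] \<rho>(1) subspace_0[OF U(1)] by simp
  show ?thesis unfolding H_def[symmetric] U_def[symmetric] composite_SSOSC_def curv_H[symmetric]
  proof
    assume "fully_stable (objective \<phi>0 \<theta> \<Phi>) xb wb vb"
    then show "\<forall>u\<in>U. u \<noteq> 0 \<longrightarrow> curv u u > 0"
      using positive_definite_if_fully_stable[OF _ eC \<rho>(1) relint] by blast
  next
    assume "\<forall>u\<in>U. u \<noteq> 0 \<longrightarrow> curv u u > 0"
    then show "fully_stable (objective \<phi>0 \<theta> \<Phi>) xb wb vb"
      by (intro fully_stable_if_positive_definite) blast
  qed
qed

end
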